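(* Let $H$ be a fixed tree (not depending on $n$) with $\ell$ vertices $v_1,\dots,v_\ell$ and let $\boldsymbol\theta\in\{0,1\}^\ell$ be a fixed non-zero vector. Let $\boldsymbol T$ be a uniform random element of $\mathcal T_n$. Then $N_{H,\boldsymbol\theta}(\boldsymbol T)$ is asymptotically normal and $\delta_{\rm K}[N_{H,\boldsymbol\theta}(\boldsymbol T)]=O(n^{-1/4+\epsilon})$ for any $\epsilon>0$.
   Context: $\mathcal T_n$ is the set of trees with vertex set $[n]$. An occurrence of the pattern $(H,\boldsymbol\theta)$ in $T\in\mathcal T_n$ is a pair $(U,W)$ with $W\subseteq U\subseteq[n]$ such that $T[U]$ is isomorphic to $H$ via an isomorphism under which $W$ corresponds exactly to the vertices $v_i$ with $\theta_i=1$, and there is no edge of $T$ between $U\setminus W$ and $[n]\setminus U$; $N_{H,\boldsymbol\theta}(T)$ is the number of occurrences. For a random variable $X$, $\delta_{\rm K}[X]=\sup_{t\in\mathbb R}|\mathbb P(X-\mathbb E X\le t(\operatorname{Var}X)^{1/2})-\Phi(t)|$ with $\Phi$ the standard normal distribution function; $X=X_n$ is asymptotically normal if $\delta_{\rm K}[X_n]\to0$ as $n\to\infty$.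
   Formalization: The patterns with at most two vertices and all θ_i = 1 are excluded: for them N is the constant n (one vertex) or n−1 (two vertices), so Var N = 0, δ_K = 1, and the claim as stated is false; every other pattern is covered. *)

theory Defs
  imports "Graph_Theory.Graph_Theory" "HOL-Probability.Probability"
begin

text \<open>
  A simple graph is a \<^locale>\<open>pair_graph\<close>: each undirected edge is represented by its two
  opposite arcs. Every edge therefore gives rise to an arc cycle of length 2, which is why
  the library's \<^term>\<open>forest\<close> and \<^term>\<open>Digraph_Component.tree\<close> (suited to oriented graphs) are
  not used. In a \<^locale>\<open>pair_graph\<close> the arc cycles of length at least 3 are exactly the
  cycles of the undirected graph.
\<close>

definition undirected_tree :: "'a pair_pre_digraph \<Rightarrow> bool" where
  "undirected_tree G \<longleftrightarrow>
     pair_graph G \<and>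
     Digraph_Component.connected (with_proj G) \<and>
     (\<nexists>p. pre_digraph.cycle (with_proj G) p \<and> length p \<ge> 3)"

definition labelled_trees :: "nat \<Rightarrow> nat pair_pre_digraph set" where
  "labelled_trees n = {T. undirected_tree T \<and> pverts T = {1..n}}"

text \<open>
  The vertices of the pattern tree \<open>H\<close> are \<open>v 1, \<dots>, v l\<close>, and only the values of
  \<open>v\<close> and \<open>\<theta>\<close> on \<open>{1..l}\<close> matter. The conjunct about \<open>app_iso\<close> says that \<open>\<phi>\<close> is an
  isomorphism from \<open>H\<close> onto the subgraph of \<open>T\<close> induced by \<open>U\<close>.
\<close>

definition pattern_occurrence ::
    "'a pair_pre_digraph \<Rightarrow> nat \<Rightarrow> (nat \<Rightarrow> 'a) \<Rightarrow> (nat \<Rightarrow> nat) \<Rightarrow>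
     'b pair_pre_digraph \<Rightarrow> 'b set \<Rightarrow> 'b set \<Rightarrow> bool" where
  "pattern_occurrence H l v \<theta> T U W \<longleftrightarrow>
     W \<subseteq> U \<and> U \<subseteq> pverts T \<and>
     (\<exists>\<phi>. pre_digraph.digraph_isomorphism (with_proj H) \<phi> \<and>
          app_iso \<phi> (with_proj H) = with_proj T \<restriction> U \<and>
          W = iso_verts \<phi> ` {v i | i. i \<in> {1..l} \<and> \<theta> i = 1}) \<and>
     (\<forall>x \<in> U - W. \<forall>y \<in> pverts T - U. (x, y) \<notin> parcs T)"

definition pattern_count ::
    "'a pair_pre_digraph \<Rightarrow> nat \<Rightarrow> (nat \<Rightarrow> 'a) \<Rightarrow> (nat \<Rightarrow> nat) \<Rightarrow> 'b pair_pre_digraph \<Rightarrow> nat" where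
  "pattern_count H l v \<theta> T = card {(U, W). pattern_occurrence H l v \<theta> T U W}"

definition delta_K :: "'a pmf \<Rightarrow> ('a \<Rightarrow> real) \<Rightarrow> real" where
  "delta_K p X =
     (SUP t. \<bar>measure_pmf.prob p
                {x. X x - measure_pmf.expectation p X \<le> t * sqrt (measure_pmf.variance p X)}
              - cdf std_normal_distribution t\<bar>)"

definition asymptotically_normal :: "(nat \<Rightarrow> 'a pmf) \<Rightarrow> (nat \<Rightarrow> 'a \<Rightarrow> real) \<Rightarrow> bool" where
  "asymptotically_normal p X \<longleftrightarrow> (\<lambda>n. delta_K (p n) (X n)) \<longlonglongrightarrow> 0"

text \<open>
  For \<open>n = 0\<close> there is no tree and the following value is unspecified; only the behaviour
  as \<open>n\<close> tends to infinity is ever used.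
\<close>

definition uniform_tree :: "nat \<Rightarrow> nat pair_pre_digraph pmf" where
  "uniform_tree n = pmf_of_set (labelled_trees n)"

end

theory Submission
  imports Defs "HOL-Combinatorics.Multiset_Permutations" "HOL-Real_Asymp.Real_Asymp"
begin

text \<open>
  A uniform labelled tree on \<open>n\<close> vertices has the shape of the graph on \<open>{0..<n}\<close> that joins
  \<open>i + 1\<close> to \<open>min u\<^sub>i i\<close> for independent uniform letters \<open>u\<^sub>0, \<dots>, u\<^sub>n\<^sub>-\<^sub>2 < n\<close> (the Aldous--Broder
  algorithm), so the pattern count has the law of a function \<open>F\<close> of independent letters. Changing one letter
  alters \<open>F\<close> by at most a power of the maximal degree, which has moments of order \<open>n\<^sup>\<epsilon>\<close>.
  Stein's method bounds the distance of the standardised \<open>F\<close> to the normal law, tested against a ramp of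
  width \<open>d\<close>: telescoping over hybrids of the word and an independent copy produces a random variable \<open>T\<close>
  with mean \<open>Var F\<close>, whose variance is of order \<open>n\<^sup>1\<^sup>+\<^sup>\<epsilon>\<close> by the Efron--Stein inequality,
  because distant letters contribute independently. As \<open>Var F\<close> is at least linear in \<open>n\<close>, the
  resulting error is of order \<open>d + n\<^sup>-\<^sup>1\<^sup>/\<^sup>2\<^sup>+\<^sup>\<epsilon> / d\<close>, and \<open>d = n\<^sup>-\<^sup>1\<^sup>/\<^sup>4\<close> is optimal.

  For the lower bound on the variance, replace a fringe subtree isomorphic to a fixed tree \<open>A\<close> by a
  tree \<open>B\<close> of the same size that begins with the same long handle but contains a different number of
  occurrences. Every such switch changes the count by the same non-zero constant and changes the number of
  \<open>A\<close>-fringes minus \<open>B\<close>-fringes by two. Summing over all switches and applying the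
  Cauchy--Schwarz inequality bounds the variance from below by the expected number of fringe subtrees,
  which Cayley's formula shows to be linear. Suitable \<open>A\<close> and \<open>B\<close> are found among a path and a bouquet of
  many small trees.
\<close>

subsection \<open>Trees as symmetric relations\<close>

text \<open>Every estimate needs the effect of a local change to be independent of what lies
  elsewhere. For a letter this works because it moves a single edge and occurrences have bounded
  diameter: two letters interact only if their edges are close in the union of all trees under
  comparison. Degrees are not bounded, so all constants become powers of a random quantity,
  \<open>crowding\<close>; its exponential moment pays for any power, and this loss is the
  n^\<epsilon>. The handle solves the same problem for fringes. It is longer than the diameter of an
  occurrence, so an occurrence meeting the exchanged part cannot see where the fringe hangs, and the
  change is a constant fixed by \<open>A\<close> and \<open>B\<close>. That some pair
  \<open>A\<close>, \<open>B\<close> has different counts follows from growth rates: in a path the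
  count is bounded or linear in the size, and a suitable bouquet makes it at least linear, quadratic
  or bounded instead. Patterns that count all vertices or all edges have no such pair and are
  excluded. A tree has many codes; uniformity rests on every rooted tree on n vertices having
  exactly n! of them.\<close>

definition edge :: "'a \<Rightarrow> 'a \<Rightarrow> 'a rel" where
  "edge x y = {(x, y), (y, x)}"

lemma edge_iff [simp]: "(a, b) \<in> edge x y \<longleftrightarrow> a = x \<and> b = y \<or> a = y \<and> b = x"
  by (auto simp: edge_def)

lemma edge_commute: "edge x y = edge y x"
  by (auto simp: edge_def)

text \<open>Growth by hanging leaves gives an induction principle for gluing, cutting and
  acyclicity; \<open>is_treeI\<close> and \<open>undirected_tree_iff\<close> show that it describes
  exactly the connected graphs without cycles.\<close>

inductive is_tree :: "'a set \<Rightarrow> 'a rel \<Rightarrow> bool" where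
  single: "is_tree {x} {}"
| leaf: "is_tree V A \<Longrightarrow> x \<in> V \<Longrightarrow> y \<notin> V \<Longrightarrow> is_tree (insert y V) (A \<union> edge x y)"

lemma is_tree_finite: "is_tree V A \<Longrightarrow> finite V"
  and is_tree_nonempty: "is_tree V A \<Longrightarrow> V \<noteq> {}"
  by (induction rule: is_tree.induct) auto

lemma is_tree_subset: "is_tree V A \<Longrightarrow> A \<subseteq> V \<times> V"
  by (induction rule: is_tree.induct) (auto simp: edge_def)

lemma is_tree_finite_arcs: "is_tree V A \<Longrightarrow> finite A"
  by (rule finite_subset[OF is_tree_subset]) (auto dest: is_tree_finite)

lemma is_tree_sym: "is_tree V A \<Longrightarrow> (x, y) \<in> A \<Longrightarrow> (y, x) \<in> A"
  by (induction arbitrary: x y rule: is_tree.induct) auto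

lemma is_tree_irrefl: "is_tree V A \<Longrightarrow> (x, x) \<notin> A"
  by (induction rule: is_tree.induct) auto

lemma is_tree_connected:
  "is_tree V A \<Longrightarrow> x \<in> V \<Longrightarrow> y \<in> V \<Longrightarrow> (x, y) \<in> A\<^sup>*"
proof (induction arbitrary: x y rule: is_tree.induct)
  case (leaf V A x0 y0)
  let ?A = "A \<union> edge x0 y0"
  have sub: "A\<^sup>* \<subseteq> ?A\<^sup>*" by (rule rtrancl_mono) simp
  have IH: "(a, b) \<in> ?A\<^sup>*" if "a \<in> V" "b \<in> V" for a b
    using leaf.IH[OF that] sub by auto
  have "(x0, y0) \<in> ?A\<^sup>*" "(y0, x0) \<in> ?A\<^sup>*" by auto
  then have "(a, y0) \<in> ?A\<^sup>*" "(y0, a) \<in> ?A\<^sup>*" if "a \<in> V" for a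
    using rtrancl_trans[OF IH[OF that \<open>x0 \<in> V\<close>]] rtrancl_trans[OF _ IH[OF \<open>x0 \<in> V\<close> that]] by blast+
  then show ?case using IH leaf.prems by blast
qed auto

text \<open>Induction over the construction of the second tree. If its last leaf is not the glued
  vertex, the leaf is hung on after gluing. If it is, \<open>y0\<close> is first hung on
  \<open>x\<close>, so that it joins the first tree, and the remaining part is glued to it along the
  edge from \<open>y0\<close> to \<open>x0\<close>.\<close>

lemma is_tree_glue:
  assumes "is_tree V' A'" "is_tree V A" "V \<inter> V' = {}" "x \<in> V" "y \<in> V'"
  shows "is_tree (V \<union> V') (A \<union> edge x y \<union> A')"
  using assms
proof (induction arbitrary: V A x y rule: is_tree.induct)
  case (single z)
  then show ?case using is_tree.leaf[of V A x z] by simp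
next
  case (leaf V' A' x0 y0)
  show ?case
  proof (cases "y = y0")
    case False
    then have "is_tree (V \<union> V') (A \<union> edge x y \<union> A')"
      by (intro leaf.IH leaf.prems) (use leaf.prems in auto)
    then have "is_tree (insert y0 (V \<union> V')) ((A \<union> edge x y \<union> A') \<union> edge x0 y0)"
      by (rule is_tree.leaf) (use leaf.prems leaf.hyps in auto)
    also have "insert y0 (V \<union> V') = V \<union> insert y0 V'" by auto
    also have "(A \<union> edge x y \<union> A') \<union> edge x0 y0 = A \<union> edge x y \<union> (A' \<union> edge x0 y0)" by auto
    finally show ?thesis .
  next
    case True
    have "is_tree (insert y0 V) (A \<union> edge x y0)"
      by (rule is_tree.leaf) (use leaf.prems in auto)
    then have "is_tree (insert y0 V \<union> V') ((A \<union> edge x y0) \<union> edge y0 x0 \<union> A')"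
      by (rule leaf.IH) (use leaf.prems leaf.hyps in auto)
    also have "insert y0 V \<union> V' = V \<union> insert y0 V'" by auto
    also have "(A \<union> edge x y0) \<union> edge y0 x0 \<union> A' = A \<union> edge x y \<union> (A' \<union> edge x0 y0)"
      using True by (auto simp: edge_def)
    finally show ?thesis .
  qed
qed

section \<open>Removing leaves and undoing a gluing\<close>

lemma is_tree_isolated:
  assumes "is_tree V A" "x \<in> V" "A `` {x} = {}"
  shows "V = {x}"
proof -
  have "y = x" if y: "y \<in> V" for y
  proof (rule ccontr)
    assume "y \<noteq> x"
    then obtain z where "(x, z) \<in> A"
      using is_tree_connected[OF assms(1,2) y] by (metis converse_rtranclE)
    then show False using assms(3) by blast
  qed
  then show ?thesis using assms(2) by blast
qed

text \<open>The removed leaf need not be the one added last. The delicate case is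
  \<open>y = x0\<close>: if \<open>y0\<close> is its sole neighbour, \<open>x0\<close> is isolated
  in the earlier tree, which is therefore a single vertex.\<close>

lemma is_tree_remove_leaf:
  assumes "is_tree V A" "A `` {y} = {x}"
  shows "is_tree (V - {y}) (A - edge x y)"
  using assms
proof (induction arbitrary: x y rule: is_tree.induct)
  case (leaf V A x0 y0)
  have sub: "A \<subseteq> V \<times> V" by (rule is_tree_subset) fact
  have nb: "A `` {y} \<union> edge x0 y0 `` {y} = {x}" using leaf.prems by (simp add: Un_Image)
  consider "y = y0" | "y = x0" "x0 \<noteq> y0" | "y \<noteq> x0" "y \<noteq> y0" by blast
  then show ?case
  proof cases
    case 1
    have "x0 \<in> edge x0 y0 `` {y0}" by auto
    then have "x = x0" using nb 1 by auto
    moreover have "A \<inter> edge x0 y0 = {}" using sub leaf.hyps(3) by (auto simp: edge_def)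
    then have "(A \<union> edge x0 y0) - edge x0 y0 = A" by blast
    moreover have "insert y0 V - {y0} = V" using leaf.hyps(3) by simp
    ultimately show ?thesis using 1 leaf.hyps(1) by (simp only:)
  next
    case 2
    have "y0 \<in> edge x0 y0 `` {x0}" by auto
    then have x: "x = y0" using nb 2 by auto
    have "A `` {x0} \<subseteq> {y0}" using nb 2 x by auto
    then have "A `` {x0} = {}" using sub leaf.hyps(3) by auto
    then have V: "V = {x0}" using is_tree_isolated[OF leaf.hyps(1,2)] by simp
    have "A = {}" using sub V is_tree_irrefl[OF leaf.hyps(1)] by auto
    then have "(A \<union> edge x0 y0) - edge x y = {}" using x 2 by (auto simp: edge_def)
    moreover have "insert y0 V - {y} = {y0}" using V 2 by auto
    ultimately show ?thesis using is_tree.single[of y0] by (simp only:)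
  next
    case 3
    then have "edge x0 y0 `` {y} = {}" by (auto simp: edge_def)
    then have nb': "A `` {y} = {x}" using nb by simp
    then have y: "y \<in> V" "x \<in> V" using sub by auto
    have "is_tree (insert y0 (V - {y})) ((A - edge x y) \<union> edge x0 y0)"
      by (rule is_tree.leaf[OF leaf.IH[OF nb']]) (use leaf.hyps 3 in auto)
    moreover have "insert y0 (V - {y}) = insert y0 V - {y}" using 3 by auto
    moreover have "edge x0 y0 \<inter> edge x y = {}" using 3 y leaf.hyps(3) by (auto simp: edge_def)
    then have "(A - edge x y) \<union> edge x0 y0 = (A \<union> edge x0 y0) - edge x y" by blast
    ultimately show ?thesis by (simp only:)
  qed
qed auto

text \<open>The vertices of \<open>V'\<close> are stripped in the reverse order of their
  construction. When the glued vertex is the last leaf, it is moved to the other side, the rest of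
  \<open>V'\<close> is stripped by induction, and it is then removed as a leaf hanging on
  \<open>x\<close>.\<close>

lemma is_tree_unglue:
  assumes "is_tree V' A'" "is_tree (V \<union> V') (A \<union> edge x y \<union> A')" "V \<inter> V' = {}"
    and "x \<in> V" "y \<in> V'" "A \<subseteq> V \<times> V"
  shows "is_tree V A"
  using assms
proof (induction arbitrary: V A x y rule: is_tree.induct)
  case (single z)
  have z: "z \<notin> V" "y = z" using single.prems(2,4) by auto
  then have "(A \<union> edge x y \<union> {}) `` {z} = {x}" using single.prems(3,5) by (auto simp: edge_def)
  from is_tree_remove_leaf[OF single.prems(1) this]
  have "is_tree ((V \<union> {z}) - {z}) ((A \<union> edge x y \<union> {}) - edge x z)" .
  moreover have "(V \<union> {z}) - {z} = V" using z by auto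
  moreover have "(A \<union> edge x y \<union> {}) - edge x z = A"
    using z single.prems(5) by (auto simp: edge_def)
  ultimately show ?case by (simp only:)
next
  case (leaf V' A' x0 y0)
  have sub: "A' \<subseteq> V' \<times> V'" by (rule is_tree_subset) fact
  have y0: "y0 \<notin> V" "y0 \<notin> V'" "x0 \<in> V'" "x0 \<noteq> y0" and disj: "V \<inter> V' = {}"
    using leaf.prems(2) leaf.hyps(2,3) by auto
  have A0: "(y0, a) \<notin> A" "(a, y0) \<notin> A" "(y0, a) \<notin> A'" "(a, y0) \<notin> A'" for a
    using sub leaf.prems(5) y0 by auto
  have x: "x \<in> V" "x \<noteq> y0" using leaf.prems(3) y0 by auto
  show ?case
  proof (cases "y = y0")
    case False
    let ?A = "A \<union> edge x y \<union> (A' \<union> edge x0 y0)"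
    have yV': "y \<in> V'" using False leaf.prems(4) by auto
    have "?A `` {y0} = {x0}" using A0 x y0 False by (auto simp: Image_def)
    from is_tree_remove_leaf[OF leaf.prems(1) this]
    have "is_tree ((V \<union> insert y0 V') - {y0}) (?A - edge x0 y0)" .
    moreover have "(V \<union> insert y0 V') - {y0} = V \<union> V'" using y0 by auto
    moreover have "(A \<union> edge x y \<union> A') \<inter> edge x0 y0 = {}"
      using A0 x y0 False by (auto simp: edge_def)
    then have "?A - edge x0 y0 = A \<union> edge x y \<union> A'" by blast
    ultimately have "is_tree (V \<union> V') (A \<union> edge x y \<union> A')" by (simp only:)
    from leaf.IH[OF this disj x(1) yV' leaf.prems(5)] show ?thesis .
  next
    case True
    have "insert y0 V \<union> V' = V \<union> insert y0 V'" by auto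
    moreover have "(A \<union> edge x y0) \<union> edge y0 x0 \<union> A' = A \<union> edge x y \<union> (A' \<union> edge x0 y0)"
      using True by (auto simp: edge_def)
    ultimately have "is_tree (insert y0 V \<union> V') ((A \<union> edge x y0) \<union> edge y0 x0 \<union> A')"
      using leaf.prems(1) by (simp only:)
    moreover have "insert y0 V \<inter> V' = {}" using disj y0 by auto
    moreover have "A \<union> edge x y0 \<subseteq> insert y0 V \<times> insert y0 V"
      using leaf.prems(5) x by (auto simp: edge_def)
    ultimately have t: "is_tree (insert y0 V) (A \<union> edge x y0)"
      using leaf.IH[OF _ _ insertI1 y0(3)] by blast
    have "(A \<union> edge x y0) `` {y0} = {x}" using A0 by (auto simp: edge_def)
    from is_tree_remove_leaf[OF t this]
    have "is_tree (insert y0 V - {y0}) ((A \<union> edge x y0) - edge x y0)" .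
    moreover have "insert y0 V - {y0} = V" using y0 by auto
    moreover have "A \<inter> edge x y0 = {}" using A0 by (auto simp: edge_def)
    then have "(A \<union> edge x y0) - edge x y0 = A" by blast
    ultimately show ?thesis by (simp only:)
  qed
qed

lemma is_tree_image:
  assumes "is_tree V A" "inj_on f V"
  shows "is_tree (f ` V) (map_prod f f ` A)"
  using assms
proof (induction rule: is_tree.induct)
  case (single x)
  show ?case using is_tree.single[of "f x"] by simp
next
  case (leaf V A x y)
  have inj: "inj_on f V" and "f y \<notin> f ` V"
    using leaf.prems leaf.hyps(3) by (auto simp: inj_on_insert)
  have "is_tree (insert (f y) (f ` V)) ((map_prod f f ` A) \<union> edge (f x) (f y))"
    by (rule is_tree.leaf[OF leaf.IH[OF inj]]) (use leaf.hyps(2) \<open>f y \<notin> f ` V\<close> in auto)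
  also have "(map_prod f f ` A) \<union> edge (f x) (f y) = map_prod f f ` (A \<union> edge x y)"
    by (simp add: edge_def image_Un)
  finally show ?case by simp
qed

text \<open>Two leaves are produced, so that one of them differs from \<open>r\<close>: the last
  vertex \<open>y0\<close>, and a leaf of the earlier tree other than \<open>x0\<close>, which the
  new edge does not touch (or \<open>x0\<close> itself if the earlier tree is a point).\<close>

lemma is_tree_leaf_exists:
  assumes "is_tree V A" "r \<in> V" "V \<noteq> {r}"
  shows "\<exists>y \<in> V. y \<noteq> r \<and> (\<exists>x. A `` {y} = {x})"
  using assms
proof (induction arbitrary: r rule: is_tree.induct)
  case (leaf V A x0 y0)
  have sub: "A \<subseteq> V \<times> V" by (rule is_tree_subset) fact
  have "(A \<union> edge x0 y0) `` {y0} = {x0}" using sub leaf.hyps(3) by (auto simp: edge_def)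
  moreover have "\<exists>y \<in> insert y0 V. y \<noteq> y0 \<and> (\<exists>x. (A \<union> edge x0 y0) `` {y} = {x})"
  proof (cases "V = {x0}")
    case True
    then have "A = {}" using sub is_tree_irrefl[OF leaf.hyps(1)] by auto
    then have "(A \<union> edge x0 y0) `` {x0} = {y0}" using leaf.hyps(2,3) by (auto simp: edge_def)
    moreover have "x0 \<noteq> y0" using leaf.hyps(2,3) by auto
    ultimately show ?thesis using leaf.hyps(2) by (intro bexI[of _ x0] conjI exI[of _ y0]) simp_all
  next
    case False
    from leaf.IH[OF leaf.hyps(2) False]
    obtain y x where y: "y \<in> V" "y \<noteq> x0" "A `` {y} = {x}" by (elim bexE conjE exE)
    have "y \<noteq> y0" using y(1) leaf.hyps(3) by auto
    then have "edge x0 y0 `` {y} = {}" using y(2) by (auto simp: edge_def)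
    then have "(A \<union> edge x0 y0) `` {y} = {x}" using y(3) by (simp add: Un_Image)
    then show ?thesis using \<open>y \<noteq> y0\<close> y(1) by (intro bexI[of _ y] conjI exI[of _ x]) simp_all
  qed
  ultimately show ?case by (cases "r = y0") (blast, intro bexI[of _ y0], auto)
qed simp

section \<open>Cycles, paths and the usual description of trees\<close>

definition cyclic_list :: "'a rel \<Rightarrow> 'a list \<Rightarrow> bool" where
  "cyclic_list A vs \<longleftrightarrow> distinct vs \<and> 3 \<le> length vs \<and>
     (\<forall>i < length vs. (vs ! i, vs ! (Suc i mod length vs)) \<in> A)"

text \<open>The vertex added last has only one neighbour, whereas on a cycle of length at least 3
  its predecessor and successor are different vertices. So the cycle lies in the earlier
  tree.\<close>

lemma is_tree_acyclic:
  assumes "is_tree V A" shows "\<not> cyclic_list A vs"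
  using assms
proof (induction rule: is_tree.induct)
  case (single x)
  then show ?case unfolding cyclic_list_def
    by (metis empty_iff less_le_trans zero_less_numeral)
next
  case (leaf V A x y)
  have sub: "A \<subseteq> V \<times> V" by (rule is_tree_subset) fact
  show ?case
  proof
    assume c: "cyclic_list (A \<union> edge x y) vs"
    define k where "k = length vs"
    have k: "3 \<le> k" and d: "distinct vs"
      and arc: "\<And>i. i < k \<Longrightarrow> (vs ! i, vs ! (Suc i mod k)) \<in> A \<union> edge x y"
      using c by (auto simp: cyclic_list_def k_def)
    have ny: "vs ! i \<noteq> y" if i: "i < k" for i
    proof
      assume y: "vs ! i = y"
      define j where "j = (if i = 0 then k - 1 else i - 1)"
      have j: "j < k" "Suc j mod k = i" using i k by (auto simp: j_def)
      have "vs ! (Suc i mod k) = x" using arc[OF i] y sub leaf.hyps by auto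
      moreover have "vs ! j = x" using arc[OF j(1)] j(2) y sub leaf.hyps by auto
      moreover have "Suc i mod k < k" using k by simp
      ultimately have "Suc i mod k = j"
        using j(1) nth_eq_iff_index_eq[OF d, of "Suc i mod k" j] unfolding k_def by metis
      then show False using i k by (auto simp: j_def mod_Suc split: if_splits)
    qed
    have "(vs ! i, vs ! (Suc i mod k)) \<in> A" if "i < k" for i
      using arc[OF that] ny[OF that] ny[of "Suc i mod k"] k by auto
    then have "cyclic_list A vs" using k d by (simp add: cyclic_list_def k_def)
    then show False using leaf.IH by simp
  qed
qed

lemma is_tree_path:
  assumes "is_tree V A" "a \<in> V" "b \<in> V"
  shows "\<exists>vs. distinct vs \<and> vs \<noteq> [] \<and> hd vs = a \<and> last vs = b \<and> set vs \<subseteq> V \<and> successively (\<lambda>x y. (x, y) \<in> A) vs"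
  using assms
proof (induction arbitrary: a b rule: is_tree.induct)
  case (single x)
  then show ?case by (intro exI[of _ "[x]"]) auto
next
  case (leaf V A x y)
  let ?S = "successively (\<lambda>u v. (u, v) \<in> A \<union> edge x y)"
  have mono: "?S vs" if "successively (\<lambda>u v. (u, v) \<in> A) vs" for vs
    using that by (rule successively_mono) auto
  consider "a = y" "b = y" | "a = y" "b \<in> V" | "a \<in> V" "b = y" | "a \<in> V" "b \<in> V"
    using leaf.prems by auto
  then show ?case
  proof cases
    case 1
    then show ?thesis by (intro exI[of _ "[y]"]) auto
  next
    case 2
    obtain vs where "distinct vs" "vs \<noteq> []" "hd vs = x" "last vs = b" "set vs \<subseteq> V"
      "successively (\<lambda>u v. (u, v) \<in> A) vs" using leaf.IH[OF leaf.hyps(2) 2(2)] by blast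
    with 2 leaf.hyps mono[of vs] show ?thesis
      by (intro exI[of _ "y # vs"]) (auto simp: successively_Cons)
  next
    case 3
    obtain vs where "distinct vs" "vs \<noteq> []" "hd vs = a" "last vs = x" "set vs \<subseteq> V"
      "successively (\<lambda>u v. (u, v) \<in> A) vs" using leaf.IH[OF 3(1) leaf.hyps(2)] by blast
    with 3 leaf.hyps mono[of vs] show ?thesis
      by (intro exI[of _ "vs @ [y]"]) (auto simp: successively_append_iff)
  next
    case 4
    obtain vs where "distinct vs" "vs \<noteq> []" "hd vs = a" "last vs = b" "set vs \<subseteq> V"
      "successively (\<lambda>u v. (u, v) \<in> A) vs" using leaf.IH[OF 4] by blast
    with mono[of vs] show ?thesis by (intro exI[of _ vs]) auto
  qed
qed

text \<open>A subtree of \<open>A\<close> on as many vertices as possible spans \<open>V\<close>,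
  since otherwise connectivity supplies an arc along which it can grow. An arc of \<open>A\<close>
  outside it would close a cycle with the tree path between its ends.\<close>

lemma is_treeI:
  assumes fin: "finite V" and ne: "V \<noteq> {}" and sub: "A \<subseteq> V \<times> V" and irr: "\<And>x. (x, x) \<notin> A"
    and sy: "\<And>x y. (x, y) \<in> A \<Longrightarrow> (y, x) \<in> A"
    and conn: "\<And>x y. x \<in> V \<Longrightarrow> y \<in> V \<Longrightarrow> (x, y) \<in> A\<^sup>*"
    and acyc: "\<And>vs. \<not> cyclic_list A vs"
  shows "is_tree V A"
proof -
  let ?P = "\<lambda>S. S \<subseteq> V \<and> (\<exists>B \<subseteq> A. is_tree S B)"
  obtain v where "v \<in> V" using ne by auto
  then have "?P {v}" using is_tree.single[of v] by (intro conjI exI[of _ "{}"]) auto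
  moreover have "\<forall>S. ?P S \<longrightarrow> card S < Suc (card V)" using card_mono[OF fin] by (simp add: less_Suc_eq_le)
  ultimately obtain S where S: "?P S" and max: "\<And>S'. ?P S' \<Longrightarrow> card S' \<le> card S"
    using ex_has_greatest_nat[of ?P "{v}" card "Suc (card V)"] by blast
  then obtain B where B: "B \<subseteq> A" "is_tree S B" by auto
  have "S = V"
  proof (rule ccontr)
    assume "S \<noteq> V"
    then obtain s t where st: "s \<in> S" "t \<in> V" "t \<notin> S" using S is_tree_nonempty[OF B(2)] by blast
    have "(s, t) \<in> A\<^sup>*" using conn st S by auto
    then have "\<exists>x y. (x, y) \<in> A \<and> x \<in> S \<and> y \<notin> S" using st(1,3)
      by (induction rule: rtrancl_induct) auto
    then obtain x y where xy: "(x, y) \<in> A" "x \<in> S" "y \<notin> S" by blast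
    have "is_tree (insert y S) (B \<union> edge x y)" using B xy by (intro is_tree.leaf)
    moreover have "B \<union> edge x y \<subseteq> A" using B xy sy by (auto simp: edge_def)
    ultimately have "?P (insert y S)" using S xy sub by (intro conjI exI[of _ "B \<union> edge x y"]) auto
    from max[OF this] show False using xy is_tree_finite[OF B(2)] by simp
  qed
  moreover have "B = A"
  proof (rule ccontr)
    assume "B \<noteq> A"
    then obtain a b where ab: "(a, b) \<in> A" "(a, b) \<notin> B" using B by auto
    then have "a \<in> S" "b \<in> S" using sub \<open>S = V\<close> by auto
    from is_tree_path[OF B(2) this] obtain vs where vs: "distinct vs" "vs \<noteq> []" "hd vs = a"
      "last vs = b" "successively (\<lambda>x y. (x, y) \<in> B) vs" by blast
    define k where "k = length vs"
    have "k \<noteq> 0" using vs by (simp add: k_def)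
    \<comment> \<open>One vertex would make the arc a loop and two vertices would make it an arc of
      \<open>B\<close>, so the closed path is a genuine cycle.\<close>
    have "k \<noteq> 1" using vs ab irr by (auto simp: k_def length_Suc_conv)
    moreover have "k \<noteq> 2" using vs ab by (auto simp: k_def length_Suc_conv numeral_2_eq_2)
    ultimately have k: "3 \<le> k" using \<open>k \<noteq> 0\<close> by simp
    have "(vs ! i, vs ! (Suc i mod k)) \<in> A" if "i < k" for i
    proof (cases "Suc i = k")
      case True
      then have "i = length vs - 1" by (simp add: k_def)
      then have "vs ! i = b" "vs ! 0 = a" using vs(2-4) by (simp_all add: last_conv_nth hd_conv_nth)
      then show ?thesis using True ab sy by simp
    next
      case False
      then show ?thesis using vs(5) that B by (auto simp: successively_conv_nth k_def)
    qed
    then have "cyclic_list A vs" using vs k by (simp add: cyclic_list_def k_def)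
    then show False using acyc by simp
  qed
  ultimately show ?thesis using B by simp
qed

section \<open>Agreement with the digraph notions of cycle and connectivity\<close>

lemma pcas_nth:
  fixes u :: 'a
  assumes "pcas u p v" "p \<noteq> []"
  shows "fst (p ! 0) = u" "snd (last p) = v"
    "\<And>i. Suc i < length p \<Longrightarrow> fst (p ! Suc i) = snd (p ! i)"
  using assms
proof (induction p arbitrary: u)
  case (Cons e p)
  { case 1 then show ?case by simp }
  { case 2 then show ?case using Cons.IH(2)[where u="snd e"] by (cases p) auto }
  { case (3 i)
    then show ?case using Cons.IH(1)[where u="snd e"] Cons.IH(3)[where u="snd e"] by (cases p; cases i) auto }
qed auto

lemma pcas_verts: "pcas u p v \<Longrightarrow> pawalk_verts u p = u # map snd p"
  by (induction p arbitrary: u) (auto)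

lemma pcas_if_successively:
  "successively (\<lambda>e f. snd e = fst f) p \<Longrightarrow> p \<noteq> [] \<Longrightarrow> pcas (fst (hd p)) p (snd (last p))"
proof (induction p)
  case (Cons e p)
  then show ?case by (cases p) auto
qed simp

text \<open>The heads of the arcs of a cycle are its vertices. In the other direction the arcs are
  listed from \<open>vs ! 0\<close> on, so their heads come out as \<open>rotate1 vs\<close>, which
  is distinct as well.\<close>

lemma cycle_iff_cyclic_list:
  assumes "pair_wf_digraph G"
  shows "(\<exists>p. pre_digraph.cycle (with_proj G) p \<and> length p \<ge> 3) \<longleftrightarrow> (\<exists>vs. cyclic_list (parcs G) vs)"
proof
  interpret pair_wf_digraph G by fact
  assume "\<exists>p. pre_digraph.cycle (with_proj G) p \<and> length p \<ge> 3"
  then obtain p u where p: "awalk u p u" "distinct (tl (pawalk_verts u p))" "3 \<le> length p"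
    unfolding cycle_def by auto
  have c: "pcas u p u" and sub: "set p \<subseteq> parcs G" using p(1) by (auto simp: awalk_def)
  have ne: "p \<noteq> []" using p(3) by auto
  have "(snd (p ! i), snd (p ! (Suc i mod length p))) \<in> parcs G" if i: "i < length p" for i
  proof -
    let ?j = "Suc i mod length p"
    have j: "?j < length p" using ne by simp
    have "fst (p ! ?j) = snd (p ! i)"
    proof (cases "Suc i = length p")
      case True
      then have "i = length p - 1" by simp
      then show ?thesis using True pcas_nth(1,2)[OF c ne] ne by (simp add: last_conv_nth)
    next
      case False
      then show ?thesis using pcas_nth(3)[OF c ne, of i] i by simp
    qed
    then have "(snd (p ! i), snd (p ! ?j)) = p ! ?j" by (metis prod.collapse)
    then show ?thesis using sub j nth_mem by fastforce
  qed
  moreover have "distinct (map snd p)" using p(2) pcas_verts[OF c] by simp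
  moreover have "0 < length p" using p(3) by linarith
  ultimately have "cyclic_list (parcs G) (map snd p)" using p(3) by (simp add: cyclic_list_def)
  then show "\<exists>vs. cyclic_list (parcs G) vs" by blast
next
  interpret pair_wf_digraph G by fact
  assume "\<exists>vs. cyclic_list (parcs G) vs"
  then obtain vs where vs: "cyclic_list (parcs G) vs" by blast
  define k where "k = length vs"
  have k: "3 \<le> k" and d: "distinct vs"
    and arc: "\<And>i. i < k \<Longrightarrow> (vs ! i, vs ! (Suc i mod k)) \<in> parcs G"
    using vs by (auto simp: cyclic_list_def k_def)
  define p where "p = map (\<lambda>i. (vs ! i, vs ! (Suc i mod k))) [0..<k]"
  have len: "length p = k" and ne: "p \<noteq> []" using k by (auto simp: p_def)
  have "pcas (vs ! 0) p (vs ! 0)"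
  proof -
    have "successively (\<lambda>e f. snd e = fst f) p"
      unfolding successively_conv_nth by (auto simp: p_def)
    from pcas_if_successively[OF this ne] show ?thesis
      using k by (simp add: p_def hd_map last_map)
  qed
  moreover have "set p \<subseteq> parcs G" using arc by (auto simp: p_def)
  moreover have "vs ! 0 \<in> pverts G" using arc[of 0] k in_arcsD1 by auto
  moreover have "distinct (map snd p)"
  proof -
    have "map snd p = rotate1 vs"
      by (rule nth_equalityI) (auto simp: p_def k_def nth_rotate1)
    then show ?thesis using d by simp
  qed
  ultimately have "cycle p"
    unfolding cycle_def awalk_def using ne pcas_verts[of "vs ! 0" p "vs ! 0"]
    by (auto intro!: exI[of _ "vs ! 0"])
  then show "\<exists>p. pre_digraph.cycle (with_proj G) p \<and> length p \<ge> 3" using len k by auto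
qed

text \<open>Arcs come in opposite pairs, so \<open>mk_symmetric\<close> adds no arcs and
  connectivity of the digraph is plain reachability; cycles are translated by
  \<open>cycle_iff_cyclic_list\<close>.\<close>

lemma undirected_tree_iff: "undirected_tree G \<longleftrightarrow> is_tree (pverts G) (parcs G)"
proof
  assume u: "undirected_tree G"
  then interpret pair_graph G by (simp add: undirected_tree_def)
  have sy: "(y, x) \<in> parcs G" if "(x, y) \<in> parcs G" for x y
    using that pair_sym_arcs by (auto simp: symmetric_def dest: symD)
  have mk: "parcs (mk_symmetric (with_proj G)) = parcs G"
  proof -
    have "parcs (mk_symmetric (with_proj G)) = parcs G \<union> (parcs G)\<inverse>"
      by (auto simp: parcs_mk_symmetric)
    then show ?thesis using sy by blast
  qed
  have sc: "strongly_connected (with_proj (mk_symmetric (with_proj G)))"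
    using u by (simp add: undirected_tree_def connected_def)
  have conn: "(x, y) \<in> (parcs G)\<^sup>*" if "x \<in> pverts G" "y \<in> pverts G" for x y
  proof -
    have "(x, y) \<in> rtrancl_on (pverts G) (parcs G)"
      using sc that mk by (auto simp: strongly_connected_def reachable_def)
    then show ?thesis by (induction rule: rtrancl_on_induct) auto
  qed
  show "is_tree (pverts G) (parcs G)"
  proof (rule is_treeI)
    show "pverts G \<noteq> {}" using sc by (simp add: strongly_connected_def)
    show "parcs G \<subseteq> pverts G \<times> pverts G" using wellformed' by auto
    show "(x, x) \<notin> parcs G" for x using no_loops' by blast
    show "\<not> cyclic_list (parcs G) vs" for vs
      using u cycle_iff_cyclic_list[of G] pair_wf_digraph by (auto simp: undirected_tree_def)
  qed (use pair_finite_verts sy conn in blast)+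
next
  assume t: "is_tree (pverts G) (parcs G)"
  have sub: "parcs G \<subseteq> pverts G \<times> pverts G" using t by (rule is_tree_subset)
  have sy: "sym (parcs G)" using is_tree_sym[OF t] by (auto intro: symI)
  have pg: "pair_graph G"
    using sub is_tree_irrefl[OF t] is_tree_finite[OF t] is_tree_finite_arcs[OF t] sy
    by unfold_locales (auto simp: symmetric_def)
  interpret pair_graph G by fact
  have mk: "parcs (mk_symmetric (with_proj G)) = parcs G"
  proof -
    have "parcs (mk_symmetric (with_proj G)) = parcs G \<union> (parcs G)\<inverse>"
      by (auto simp: parcs_mk_symmetric)
    then show ?thesis using is_tree_sym[OF t] by blast
  qed
  have "(x, y) \<in> rtrancl_on (pverts G) (parcs G)" if "x \<in> pverts G" "y \<in> pverts G" for x y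
    using is_tree_connected[OF t that] that
  proof (induction rule: rtrancl_induct)
    case (step b c)
    have bc: "b \<in> pverts G" "c \<in> pverts G" using step.hyps(2) sub by auto
    show ?case
      by (rule rtrancl_on_into_rtrancl_on[OF step.IH[OF step.prems(1) bc(1)] step.hyps(2) bc(2)])
  qed auto
  then have "strongly_connected (with_proj (mk_symmetric (with_proj G)))"
    using is_tree_nonempty[OF t] mk by (auto simp: strongly_connected_def reachable_def)
  moreover have "\<not> (\<exists>p. pre_digraph.cycle (with_proj G) p \<and> length p \<ge> 3)"
    using cycle_iff_cyclic_list[of G] is_tree_acyclic[OF t] pair_wf_digraph by auto
  ultimately show "undirected_tree G"
    using pg by (simp add: undirected_tree_def connected_def)
qed

subsection \<open>Coding trees by words\<close>

definition words :: "'a set \<Rightarrow> nat \<Rightarrow> 'a list set" where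
  "words K m = {us. set us \<subseteq> K \<and> length us = m}"

lemma finite_words: "finite K \<Longrightarrow> finite (words K m)"
  by (simp add: words_def finite_lists_length_eq)

lemma card_words: "finite K \<Longrightarrow> card (words K m) = card K ^ m"
  by (simp add: words_def card_lists_length_eq)

text \<open>On an alphabet of n letters, a uniform letter at position \<open>i\<close> selects each
  vertex below \<open>i\<close> with probability 1/n and \<open>i\<close> itself otherwise. This is
  the law of the vertex from which the random walk on the complete graph with loops makes its next
  discovery, vertices being numbered in the order of discovery.\<close>

definition code_graph :: "nat list \<Rightarrow> nat rel" where
  "code_graph us = (\<Union>i < length us. edge (Suc i) (min (us ! i) i))"

definition relabel :: "'a list \<Rightarrow> nat rel \<Rightarrow> 'a rel" where
  "relabel xs A = map_prod ((!) xs) ((!) xs) ` A"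

lemma code_graph_Nil [simp]: "code_graph [] = {}"
  by (simp add: code_graph_def)

lemma code_graph_snoc:
  "code_graph (us @ [w]) = code_graph us \<union> edge (Suc (length us)) (min w (length us))"
proof -
  have "(\<Union>i < length us. edge (Suc i) (min ((us @ [w]) ! i) i)) = code_graph us"
    unfolding code_graph_def by (intro SUP_cong) (auto simp: nth_append)
  then show ?thesis
    unfolding code_graph_def by (simp add: lessThan_Suc Un_commute)
qed

lemma is_tree_code_graph: "is_tree {..length us} (code_graph us)"
proof (induction us rule: rev_induct)
  case Nil
  show ?case using is_tree.single[of 0] by simp
next
  case (snoc w us)
  have "is_tree (insert (Suc (length us)) {..length us})
      (code_graph us \<union> edge (min w (length us)) (Suc (length us)))"
    by (rule is_tree.leaf[OF snoc]) auto
  then show ?case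
    by (simp add: code_graph_snoc atMost_Suc edge_commute[of "min w (length us)"])
qed

lemma code_graph_subset: "code_graph us \<subseteq> {..length us} \<times> {..length us}"
  by (rule is_tree_subset[OF is_tree_code_graph])

lemma is_tree_relabel:
  assumes "distinct xs" "length xs = Suc (length us)"
  shows "is_tree (set xs) (relabel xs (code_graph us))"
proof -
  have "inj_on ((!) xs) {..length us}"
    using assms by (auto simp: inj_on_def nth_eq_iff_index_eq)
  moreover have "(!) xs ` {..length us} = set xs"
    using assms(2) by (auto simp: set_conv_nth less_Suc_eq_le)
  ultimately show ?thesis
    unfolding relabel_def using is_tree_image[OF is_tree_code_graph] by fastforce
qed

lemma relabel_snoc:
  assumes "length ys = Suc (length ws)"
  shows "relabel (ys @ [x]) (code_graph (ws @ [w]))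
       = relabel ys (code_graph ws) \<union> edge (ys ! min w (length ws)) x"
proof -
  have "relabel (ys @ [x]) (code_graph ws) = relabel ys (code_graph ws)"
    unfolding relabel_def
  proof (rule image_cong[OF refl])
    fix p assume "p \<in> code_graph ws"
    then have "fst p \<le> length ws" "snd p \<le> length ws" using code_graph_subset by fastforce+
    then show "map_prod ((!) (ys @ [x])) ((!) (ys @ [x])) p = map_prod ((!) ys) ((!) ys) p"
      using assms by (cases p) (simp add: nth_append)
  qed
  moreover have "map_prod ((!) (ys @ [x])) ((!) (ys @ [x])) ` edge (Suc (length ws)) (min w (length ws))
      = edge (ys ! min w (length ws)) x"
    using assms by (auto simp: edge_def nth_append)
  ultimately show ?thesis by (simp add: code_graph_snoc relabel_def image_Un)
qed

text \<open>The alphabet size \<open>N\<close> is independent of the number of vertices, because the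
  count below proceeds by removing the last vertex while the letters keep their range. Fixing the
  first vertex amounts to counting codes of a rooted tree.\<close>

definition codes :: "nat \<Rightarrow> 'a set \<Rightarrow> 'a rel \<Rightarrow> 'a \<Rightarrow> ('a list \<times> nat list) set" where
  "codes N V A r = {(xs, us). distinct xs \<and> set xs = V \<and> length xs = Suc (length us) \<and>
     set us \<subseteq> {..<N} \<and> hd xs = r \<and> relabel xs (code_graph us) = A}"

lemma finite_codes:
  assumes "finite V" shows "finite (codes N V A r)"
proof (rule finite_subset)
  show "codes N V A r \<subseteq> permutations_of_set V \<times> words {..<N} (card V - 1)"
    by (auto simp: codes_def permutations_of_set_def words_def distinct_card[symmetric])
qed (use assms in \<open>auto simp: finite_words\<close>)

text \<open>The vertices that can come last in a code. The root qualifies only if it is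
  alone.\<close>

definition leaves :: "'a set \<Rightarrow> 'a rel \<Rightarrow> 'a \<Rightarrow> 'a set" where
  "leaves V A r = (if V = {r} then {r} else {x \<in> V. x \<noteq> r \<and> (\<exists>y. A `` {x} = {y})})"

lemma codes_last_decomp:
  assumes t: "is_tree V A" and r: "r \<in> V" "V \<noteq> {r}" and c: "(xs, us) \<in> codes N V A r"
  obtains ys ws w where "xs = ys @ [last xs]" "us = ws @ [w]" "ys \<noteq> []" "last xs \<noteq> r"
    "length ys = Suc (length ws)" "w < N" "last xs \<notin> set ys"
    "A `` {last xs} = {ys ! min w (length ws)}" "ys ! min w (length ws) \<in> set ys"
    "(ys, ws) \<in> codes N (V - {last xs}) (A - edge (ys ! min w (length ws)) (last xs)) r"
proof -
  have xs: "distinct xs" "set xs = V" "length xs = Suc (length us)" "set us \<subseteq> {..<N}" "hd xs = r"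
    "relabel xs (code_graph us) = A" using c by (auto simp: codes_def)
  have "us \<noteq> []"
  proof
    assume "us = []"
    then have "xs = [r]" using xs(3,5) by (cases xs) auto
    then show False using xs(2) r(2) by simp
  qed
  then obtain ws w where us: "us = ws @ [w]" by (cases us rule: rev_cases) auto
  obtain ys x where xs': "xs = ys @ [x]" using xs(3) by (cases xs rule: rev_cases) auto
  have len: "length ys = Suc (length ws)" using xs(3) us xs' by simp
  then have ne: "ys \<noteq> []" by auto
  let ?y = "ys ! min w (length ws)"
  have A: "A = relabel ys (code_graph ws) \<union> edge ?y x"
    using xs(6) relabel_snoc[OF len] us xs' by simp
  have d: "distinct ys" "x \<notin> set ys" using xs(1) xs' by auto
  have y: "?y \<in> set ys" using len by (intro nth_mem) simp
  have sub: "relabel ys (code_graph ws) \<subseteq> set ys \<times> set ys"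
    by (rule is_tree_subset[OF is_tree_relabel[OF d(1) len]])
  have "A `` {x} = {?y}" using sub d(2) unfolding A by (auto simp: edge_def)
  moreover have "relabel ys (code_graph ws) \<inter> edge ?y x = {}" using sub d(2) by (auto simp: edge_def)
  then have "relabel ys (code_graph ws) = A - edge ?y x" unfolding A by blast
  moreover have "hd ys = r" using xs(5) xs' ne by simp
  moreover have "x \<noteq> r" using d(2) \<open>hd ys = r\<close> ne hd_in_set by metis
  moreover have "set ys = V - {x}" using xs(2) xs' d(2) by auto
  ultimately show thesis
    using that[of ys ws w] us xs' len ne y d xs(4) by (simp add: codes_def)
qed

lemma codes_not_leaf:
  assumes "is_tree V A" "r \<in> V" "V \<noteq> {r}" "x \<notin> leaves V A r"
  shows "{p \<in> codes N V A r. last (fst p) = x} = {}"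
proof -
  have False if c: "(xs, us) \<in> codes N V A r" "last xs = x" for xs us
  proof -
    have "xs \<noteq> []" using c by (auto simp: codes_def)
    then have "x \<in> V" using c by (auto simp: codes_def)
    with codes_last_decomp[OF assms(1-3) c(1)] c(2) have "x \<in> leaves V A r"
      using assms(3) unfolding leaves_def by (metis (mono_tags, lifting) mem_Collect_eq)
    then show False using assms(4) by simp
  qed
  then show ?thesis by auto
qed

text \<open>The last letter of a code only decides where the last vertex hangs, so codes ending in
  the leaf \<open>x\<close> are codes of the tree without \<open>x\<close>, followed by a letter
  that selects its neighbour.\<close>

lemma codes_leaf:
  assumes t: "is_tree V A" and r: "r \<in> V" "V \<noteq> {r}" and x: "x \<in> V" "x \<noteq> r" "A `` {x} = {y}"
  shows "{p \<in> codes N V A r. last (fst p) = x}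
     = (\<lambda>((ys, ws), w). (ys @ [x], ws @ [w])) `
        (SIGMA p : codes N (V - {x}) (A - edge y x) r. {w. w < N \<and> fst p ! min w (length (snd p)) = y})"
    (is "?L = ?f ` ?R")
proof
  show "?L \<subseteq> ?f ` ?R"
  proof
    fix p assume "p \<in> ?L"
    then obtain xs us where p: "p = (xs, us)" and c: "(xs, us) \<in> codes N V A r" and lx: "last xs = x"
      by (cases p) auto
    obtain ys ws w where h: "xs = ys @ [last xs]" "us = ws @ [w]" "ys \<noteq> []" "last xs \<noteq> r"
      "length ys = Suc (length ws)" "w < N" "last xs \<notin> set ys"
      "A `` {last xs} = {ys ! min w (length ws)}" "ys ! min w (length ws) \<in> set ys"
      "(ys, ws) \<in> codes N (V - {last xs}) (A - edge (ys ! min w (length ws)) (last xs)) r"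
      by (rule codes_last_decomp[OF t r c]) (rule that)
    have y: "ys ! min w (length ws) = y" using h(8) x(3) lx by simp
    have "((ys, ws), w) \<in> ?R" using h(6,10) y lx by simp
    moreover have "(xs, us) = (\<lambda>((ys, ws), w). (ys @ [x], ws @ [w])) ((ys, ws), w)"
      using h(1,2) lx by simp
    ultimately show "p \<in> ?f ` ?R" unfolding p by (rule rev_image_eqI)
  qed
  show "?f ` ?R \<subseteq> ?L"
  proof
    fix p assume "p \<in> ?f ` ?R"
    then obtain q where q: "q \<in> ?R" "p = ?f q" by (rule imageE)
    obtain ys ws w where "q = ((ys, ws), w)" by (metis surj_pair)
    with q have p: "p = (ys @ [x], ws @ [w])"
      and c: "(ys, ws) \<in> codes N (V - {x}) (A - edge y x) r"
      and w: "w < N" and y: "ys ! min w (length ws) = y"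
      by simp_all
    have h: "distinct ys" "set ys = V - {x}" "length ys = Suc (length ws)" "set ws \<subseteq> {..<N}"
      "hd ys = r" "relabel ys (code_graph ws) = A - edge y x" using c by (auto simp: codes_def)
    have "(x, y) \<in> A" using x(3) by auto
    moreover from this have "(y, x) \<in> A" by (rule is_tree_sym[OF t])
    ultimately have "edge y x \<subseteq> A" by (simp add: edge_def)
    moreover have "relabel (ys @ [x]) (code_graph (ws @ [w])) = (A - edge y x) \<union> edge y x"
      by (simp only: relabel_snoc[OF h(3)] h(6) y)
    ultimately have "relabel (ys @ [x]) (code_graph (ws @ [w])) = A" by blast
    moreover have "ys \<noteq> []" using h(3) by auto
    ultimately show "p \<in> ?L"
      unfolding p using h w x(1) by (auto simp: codes_def)
  qed
qed

text \<open>All letters from \<open>k\<close> on are capped to \<open>k\<close>, so the vertex in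
  last position is selected by \<open>N - k\<close> letters and any other vertex by one.\<close>

lemma card_choices:
  assumes "distinct ys" "length ys = Suc k" "y \<in> set ys" "k < N"
  shows "card {w. w < N \<and> ys ! min w k = y} = (if last ys = y then N - k else 1)"
proof -
  obtain j where j: "j \<le> k" "ys ! j = y"
    using assms(2,3) by (auto simp: in_set_conv_nth less_Suc_eq_le)
  have eq: "ys ! min w k = y \<longleftrightarrow> min w k = j" for w
    using j assms(1,2) by (auto simp: nth_eq_iff_index_eq[symmetric, of ys])
  have "ys \<noteq> []" using assms(2) by auto
  then have l: "last ys = y \<longleftrightarrow> j = k"
    using j assms(1,2) by (simp add: last_conv_nth nth_eq_iff_index_eq[symmetric, of ys]) (metis nth_eq_iff_index_eq lessI less_Suc_eq_le)
  show ?thesis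
  proof (cases "j = k")
    case True
    then have "{w. w < N \<and> ys ! min w k = y} = {k..<N}" unfolding eq by auto
    then show ?thesis using True l by simp
  next
    case False
    then have "{w. w < N \<and> ys ! min w k = y} = {j}" unfolding eq using j assms(4) by auto
    then show ?thesis using False l by simp
  qed
qed

text \<open>Each code of the smaller tree extends in one way, and one that ends in \<open>y\<close>
  in \<open>N - card V + 1\<close> further ways, because its word has length
  \<open>card V - 2\<close>.\<close>

lemma card_codes_leaf:
  assumes t: "is_tree V A" and r: "r \<in> V" "V \<noteq> {r}" and x: "x \<in> V" "x \<noteq> r" "A `` {x} = {y}"
    and N: "card V \<le> N"
  shows "card {p \<in> codes N V A r. last (fst p) = x}
     = card (codes N (V - {x}) (A - edge y x) r)
       + (N - card V + 1) * card {p \<in> codes N (V - {x}) (A - edge y x) r. last (fst p) = y}"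
proof -
  let ?C = "codes N (V - {x}) (A - edge y x) r"
  have fin: "finite V" "finite ?C" using is_tree_finite[OF t] by (auto intro: finite_codes)
  have y: "y \<in> V - {x}" using x(3) is_tree_subset[OF t] is_tree_irrefl[OF t, of x] by auto
  have "card {p \<in> codes N V A r. last (fst p) = x}
      = card (SIGMA p : ?C. {w. w < N \<and> fst p ! min w (length (snd p)) = y})"
    unfolding codes_leaf[OF t r x] by (rule card_image) (auto simp: inj_on_def)
  also have "\<dots> = (\<Sum>p \<in> ?C. card {w. w < N \<and> fst p ! min w (length (snd p)) = y})"
    using fin by (intro card_SigmaI) auto
  also have "\<dots> = (\<Sum>p \<in> ?C. 1 + (if last (fst p) = y then N - card V + 1 else 0))"
  proof (rule sum.cong[OF refl], clarify)
    fix ys ws assume c: "(ys, ws) \<in> ?C"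
    have h: "distinct ys" "set ys = V - {x}" "length ys = Suc (length ws)" using c by (auto simp: codes_def)
    have cV: "card V = Suc (Suc (length ws))"
      using distinct_card[OF h(1)] h(2,3) x(1) fin(1) by (metis card_Suc_Diff1)
    have k: "length ws < N" and ys: "y \<in> set ys" using cV N y h(2) by simp_all
    have "N - length ws = 1 + (N - card V + 1)" using cV N by simp
    with card_choices[OF h(1,3) ys k]
    show "card {w. w < N \<and> fst (ys, ws) ! min w (length (snd (ys, ws))) = y}
        = 1 + (if last (fst (ys, ws)) = y then N - card V + 1 else 0)"
      by simp
  qed
  also have "\<dots> = card ?C + (N - card V + 1) * card {p \<in> ?C. last (fst p) = y}"
    unfolding sum.distrib using fin by (simp add: sum.If_cases Int_def)
  finally show ?thesis .
qed

lemma leaves_subset: "r \<in> V \<Longrightarrow> leaves V A r \<subseteq> V"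
  by (auto simp: leaves_def)

lemma leaves_nonempty:
  assumes "is_tree V A" "r \<in> V" shows "leaves V A r \<noteq> {}"
  using is_tree_leaf_exists[OF assms] by (auto simp: leaves_def)

text \<open>Removing \<open>x\<close> affects the leaf status of no vertex but its neighbour
  \<open>y\<close>, which was not a leaf and may become one.\<close>

lemma leaves_remove:
  assumes t: "is_tree V A" and r: "r \<in> V" "V \<noteq> {r}" and x: "x \<in> V" "x \<noteq> r" "A `` {x} = {y}"
  shows "leaves (V - {x}) (A - edge y x) r - {y} = leaves V A r - {x}" "y \<notin> leaves V A r"
    "is_tree (V - {x}) (A - edge y x)"
proof -
  show t': "is_tree (V - {x}) (A - edge y x)" by (rule is_tree_remove_leaf[OF t x(3)])
  have "(x, y) \<in> A" using x(3) by auto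
  then have y: "y \<in> V" "y \<noteq> x" "(y, x) \<in> A"
    using is_tree_subset[OF t] is_tree_irrefl[OF t, of x] is_tree_sym[OF t, of x y] by auto
  show yl: "y \<notin> leaves V A r"
  proof
    assume "y \<in> leaves V A r"
    then have "y \<noteq> r" "\<exists>z. A `` {y} = {z}" using r(2) by (auto simp: leaves_def)
    then obtain z where z: "A `` {y} = {z}" by blast
    moreover have "x \<in> A `` {y}" using y(3) by auto
    ultimately have "A `` {y} = {x}" by auto
    then have "(A - edge y x) `` {y} = {}" by (auto simp: edge_def)
    from is_tree_isolated[OF t' _ this] have "V - {x} = {y}" using y by auto
    moreover have "r \<in> V - {x}" using r(1) x(2) by simp
    ultimately show False using \<open>y \<noteq> r\<close> by simp
  qed
  have nb: "(A - edge y x) `` {z} = A `` {z}" if "z \<noteq> x" "z \<noteq> y" for z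
    using that by (auto simp: edge_def)
  have xl: "x \<in> leaves V A r" using x r(2) by (auto simp: leaves_def)
  show "leaves (V - {x}) (A - edge y x) r - {y} = leaves V A r - {x}"
  proof (cases "V - {x} = {r}")
    case True
    then have "y = r" using y by auto
    moreover have "leaves V A r \<subseteq> {x}" using True r(2) by (auto simp: leaves_def)
    ultimately show ?thesis using True by (auto simp: leaves_def)
  next
    case False
    have "z \<in> leaves (V - {x}) (A - edge y x) r - {y} \<longleftrightarrow> z \<in> leaves V A r - {x}" for z
      using yl nb[of z] False r(2) by (cases "z = x"; cases "z = y") (auto simp: leaves_def)
    then show ?thesis by blast
  qed
qed

text \<open>The count depends on the tree only through its numbers of vertices and leaves and is the
  same for every leaf in last position. The induction on the number of vertices runs through
  \<open>card_codes_leaf\<close>; summing over the last vertex gives the total.\<close>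

lemma card_codes_last:
  assumes "is_tree V A" "r \<in> V" "card V \<le> N"
  shows "card {p \<in> codes N V A r. last (fst p) = x} =
      (if x \<in> leaves V A r then fact (card (leaves V A r) - 1) * (\<Prod>i < card V - card (leaves V A r). N - i) else 0)"
    "card (codes N V A r) = fact (card (leaves V A r)) * (\<Prod>i < card V - card (leaves V A r). N - i)"
proof -
  let ?F = "\<lambda>V l. (\<Prod>i < card V - l. N - i)"
  \<comment> \<open>Stated for arbitrary trees, since the induction below needs it for the tree
    without its last vertex.\<close>
  have total: "card (codes N V A r) = fact (card (leaves V A r)) * ?F V (card (leaves V A r))"
    if t: "is_tree V A" "r \<in> V" and h: "\<And>x. card {p \<in> codes N V A r. last (fst p) = x} =
      (if x \<in> leaves V A r then fact (card (leaves V A r) - 1) * ?F V (card (leaves V A r)) else 0)" for V A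
  proof -
    let ?L = "leaves V A r"
    have fin: "finite V" "finite (codes N V A r)" using is_tree_finite[OF t(1)] by (auto intro: finite_codes)
    have finL: "finite ?L" using leaves_subset[OF t(2)] fin(1) finite_subset by blast
    have "card (codes N V A r) = (\<Sum>x\<in>V. card {p \<in> codes N V A r. last (fst p) = x})"
    proof -
      have "(\<lambda>p. last (fst p)) ` codes N V A r \<subseteq> V"
      proof clarify
        fix xs us assume "(xs, us) \<in> codes N V A r"
        then have "set xs = V" "xs \<noteq> []" by (auto simp: codes_def)
        then show "last (fst (xs, us)) \<in> V" by auto
      qed
      from sum.group[OF fin(2,1) this, of "\<lambda>_. 1::nat"] show ?thesis by simp
    qed
    also have "\<dots> = (\<Sum>x\<in>?L. fact (card ?L - 1) * ?F V (card ?L))"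
      unfolding h using leaves_subset[OF t(2)] fin(1) by (simp add: sum.If_cases Int_absorb1)
    also have "\<dots> = fact (card ?L) * ?F V (card ?L)"
      using leaves_nonempty[OF t] finL by (simp add: fact_reduce[of "card ?L"] card_gt_0_iff)
    finally show ?thesis .
  qed
  have main: "card {p \<in> codes N V A r. last (fst p) = x} =
      (if x \<in> leaves V A r then fact (card (leaves V A r) - 1) * ?F V (card (leaves V A r)) else 0)" for x
    using assms
  proof (induction "card V" arbitrary: V A x rule: less_induct)
    case less
    note t = less.prems(1) and r = less.prems(2)
    have fin: "finite V" using is_tree_finite[OF t] .
    show ?case
    proof (cases "V = {r}")
      case True
      have A: "A = {}" using is_tree_subset[OF t] is_tree_irrefl[OF t] True by auto
      have eq: "codes N V A r = {([r], [])}"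
      proof
        show "codes N V A r \<subseteq> {([r], [])}"
        proof clarify
          fix xs us assume "(xs, us) \<in> codes N V A r"
          then have h: "distinct xs" "set xs = {r}" "length xs = Suc (length us)" using True by (auto simp: codes_def)
          have "length xs = 1" using distinct_card[OF h(1)] h(2) by simp
          then show "xs = [r] \<and> us = []" using h(2,3) by (cases xs) auto
        qed
      qed (use True A in \<open>auto simp: codes_def relabel_def\<close>)
      have "{p \<in> codes N V A r. last (fst p) = x} = (if x = r then {([r], [])} else {})"
        unfolding eq by (cases "x = r") auto
      then have "card {p \<in> codes N V A r. last (fst p) = x} = (if x = r then 1 else 0)"
        by (simp only: split: if_split) simp
      moreover have "leaves V A r = {r}" "card V = 1" using True by (simp_all add: leaves_def)
      ultimately show ?thesis by (cases "x = r") simp_all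
    next
      case False
      show ?thesis
      proof (cases "x \<in> leaves V A r")
        case nl: False
        then show ?thesis using codes_not_leaf[OF t r False nl, of N] by (simp only: card.empty if_False)
      next
        case True
        then obtain y where x: "x \<in> V" "x \<noteq> r" "A `` {x} = {y}" using False by (auto simp: leaves_def)
        let ?L = "leaves V A r" and ?V' = "V - {x}" and ?A' = "A - edge y x"
        let ?L' = "leaves ?V' ?A' r"
        note rem = leaves_remove[OF t r False x]
        have cV: "card V = Suc (card ?V')" using x(1) fin by (metis card_Suc_Diff1)
        have r': "r \<in> ?V'" using r x(2) by auto
        have finL: "finite ?L" "finite ?L'"
          using finite_subset[OF leaves_subset[OF r] fin]
            finite_subset[OF leaves_subset[OF r'] finite_Diff[OF fin]] by simp_all
        have cL: "card ?L = Suc (card (?L' - {y}))" using rem(1) True finL(1) by (metis card_Suc_Diff1)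
        have IH: "card {p \<in> codes N ?V' ?A' r. last (fst p) = z} =
            (if z \<in> ?L' then fact (card ?L' - 1) * ?F ?V' (card ?L') else 0)" for z
          using less.hyps[OF _ rem(3) r'] cV less.prems(3) by simp
        have eq: "card {p \<in> codes N V A r. last (fst p) = x} =
            fact (card ?L') * ?F ?V' (card ?L')
            + (N - card V + 1) * (if y \<in> ?L' then fact (card ?L' - 1) * ?F ?V' (card ?L') else 0)"
          unfolding card_codes_leaf[OF t r False x less.prems(3)] total[OF rem(3) r' IH] IH ..
        show ?thesis
        \<comment> \<open>If \<open>y\<close> does not become a leaf, vertices and leaves both drop
          by one and the product is unchanged. If it does, the number of leaves is unchanged, the
          product loses one factor, and this factor splits as \<open>l + (N - card V + 1)\<close>,
          one summand for each term of the recursion.\<close>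
        proof (cases "y \<in> ?L'")
          case yn: False
          then have "card ?L = Suc (card ?L')" using cL by simp
          then show ?thesis using eq True yn cV by simp
        next
          case yy: True
          define l where "l = card ?L"
          have l: "card ?L' = l" using cL card_Suc_Diff1[OF finL(2) yy] by (simp only: l_def)
          have l1: "l \<ge> 1" using True finL(1) by (auto simp: l_def Suc_le_eq card_gt_0_iff)
          have le: "l \<le> card ?V'" using card_mono[OF _ leaves_subset[OF r']] fin l by (metis finite_Diff)
          define m where "m = card ?V' - l"
          have F: "?F V l = ?F ?V' l * (N - m)" using cV le by (simp add: m_def Suc_diff_le)
          have "N - m = l + (N - card V + 1)" using cV le less.prems(3) by (simp add: m_def)
          moreover have "fact l = l * (fact (l - 1) :: nat)" using l1 by (simp add: fact_reduce[of l])
          ultimately have "fact (l - 1) * ?F V l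
              = fact l * ?F ?V' l + (N - card V + 1) * (fact (l - 1) * ?F ?V' l)"
            by (simp only: F distrib_left distrib_right mult_ac)
          then show ?thesis using eq True yy l by (simp only: l_def[symmetric] if_True)
        qed
      qed
    qed
  qed
  show "card {p \<in> codes N V A r. last (fst p) = x} =
      (if x \<in> leaves V A r then fact (card (leaves V A r) - 1) * (\<Prod>i < card V - card (leaves V A r). N - i) else 0)"
    by (rule main)
  show "card (codes N V A r) = fact (card (leaves V A r)) * (\<Prod>i < card V - card (leaves V A r). N - i)"
    by (rule total[OF assms(1,2) main])
qed

lemma fact_mult_prod: "m \<le> n \<Longrightarrow> fact (n - m) * (\<Prod>i < m. n - i) = (fact n :: nat)"
proof (induction m)
  case (Suc m)
  then have "fact (n - m) = (n - m) * fact (n - Suc m)" by (simp add: fact_reduce[of "n - m"])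
  then show ?case using Suc by (simp add: algebra_simps)
qed simp

text \<open>With as many letters as vertices the falling product completes the factorial of the
  number of leaves, and the shape of the tree drops out. This is the reason why uniform codes
  produce uniform trees.\<close>

lemma card_codes:
  assumes "is_tree V A" "r \<in> V"
  shows "card (codes (card V) V A r) = fact (card V)"
proof -
  have "card (leaves V A r) \<le> card V"
    using leaves_subset[OF assms(2)] is_tree_finite[OF assms(1)] by (rule card_mono[rotated])
  then show ?thesis
    using card_codes_last(2)[OF assms order_refl]
      fact_mult_prod[of "card V - card (leaves V A r)" "card V"] by simp
qed

section \<open>Uniform trees and Cayley's formula\<close>

definition trees :: "'a set \<Rightarrow> 'a rel set" where
  "trees V = {A. is_tree V A}"

lemma finite_trees: "finite V \<Longrightarrow> finite (trees V)"
  by (rule finite_subset[of _ "Pow (V \<times> V)"]) (auto simp: trees_def dest: is_tree_subset)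

text \<open>Each tree with a marked root arises from exactly \<open>fact (Suc m)\<close> pairs of an
  ordering of \<open>V\<close> and a word. Since \<open>f\<close> does not see the ordering, the
  \<open>fact (Suc m)\<close> orderings cancel against this multiplicity; the factor
  \<open>Suc m\<close> counts the roots.\<close>

theorem sum_trees_eq_sum_codes:
  fixes f :: "'a rel \<Rightarrow> real"
  assumes V: "finite V" "card V = Suc m"
    and f: "\<And>xs us. distinct xs \<Longrightarrow> set xs = V \<Longrightarrow> us \<in> words {..<Suc m} m \<Longrightarrow>
      f (relabel xs (code_graph us)) = g us"
  shows "real (Suc m) * (\<Sum>A \<in> trees V. f A) = (\<Sum>us \<in> words {..<Suc m} m. g us)"
proof -
  let ?P = "permutations_of_set V \<times> words {..<Suc m} m"
  let ?T = "trees V \<times> V"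
  let ?h = "\<lambda>(xs, us). (relabel xs (code_graph us), hd xs)"
  have len: "length xs = Suc m" if "distinct xs" "set xs = V" for xs
    using distinct_card[OF that(1)] that(2) V(2) by simp
  have fin: "finite ?P" "finite ?T" using V by (auto simp: finite_words finite_trees)
  have im: "?h ` ?P \<subseteq> ?T"
  proof clarify
    fix xs us assume h: "xs \<in> permutations_of_set V" "us \<in> words {..<Suc m} m"
    then have x: "distinct xs" "set xs = V" by (auto simp: permutations_of_set_def)
    have "xs \<noteq> []" using len[OF x] by auto
    moreover have "is_tree V (relabel xs (code_graph us))"
      using is_tree_relabel[OF x(1), of us] len[OF x] h(2) x(2) by (simp add: words_def)
    ultimately show "relabel xs (code_graph us) \<in> trees V \<and> hd xs \<in> V"
      using x(2) by (auto simp: trees_def)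
  qed
  have fib: "{p \<in> ?P. ?h p = (A, r)} = codes (Suc m) V A r" for A r
    using len by (auto simp: codes_def permutations_of_set_def words_def)
  have "fact (Suc m) * (\<Sum>us \<in> words {..<Suc m} m. g us) = (\<Sum>xs \<in> permutations_of_set V. \<Sum>us \<in> words {..<Suc m} m. g us)"
    using V by (simp add: card_permutations_of_set del: fact_Suc)
  also have "\<dots> = (\<Sum>p \<in> ?P. f (fst (?h p)))"
    unfolding sum.cartesian_product
    by (intro sum.cong refl) (auto simp: permutations_of_set_def f)
  also have "\<dots> = (\<Sum>t \<in> ?T. \<Sum>p \<in> {p \<in> ?P. ?h p = t}. f (fst (?h p)))"
    by (rule sum.group[OF fin im, symmetric])
  also have "\<dots> = (\<Sum>t \<in> ?T. fact (Suc m) * f (fst t))"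
  proof (rule sum.cong[OF refl], clarify)
    fix A r assume "A \<in> trees V" "r \<in> V"
    then have c: "card (codes (Suc m) V A r) = fact (Suc m)"
      using card_codes[of V A r] V(2) by (simp add: trees_def)
    have "(\<Sum>p \<in> {p \<in> ?P. ?h p = (A, r)}. f (fst (?h p))) = (\<Sum>p \<in> {p \<in> ?P. ?h p = (A, r)}. f A)"
      by (intro sum.cong refl) auto
    also have "\<dots> = fact (Suc m) * f A" unfolding fib using c by (simp del: fact_Suc)
    finally show "(\<Sum>p \<in> {p \<in> ?P. ?h p = (A, r)}. f (fst (?h p))) = fact (Suc m) * f (fst (A, r))" by simp
  qed
  also have "\<dots> = fact (Suc m) * (real (Suc m) * (\<Sum>A \<in> trees V. f A))"
  proof -
    have "(\<Sum>t \<in> ?T. fact (Suc m) * f (fst t)) = (\<Sum>A \<in> trees V. \<Sum>r \<in> V. fact (Suc m) * f A)"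
      unfolding sum.cartesian_product by (intro sum.cong refl) auto
    also have "\<dots> = (\<Sum>A \<in> trees V. real (Suc m) * (fact (Suc m) * f A))"
      by (simp only: sum_constant V(2))
    also have "\<dots> = fact (Suc m) * (real (Suc m) * (\<Sum>A \<in> trees V. f A))"
      unfolding sum_distrib_left by (intro sum.cong refl) (simp only: mult_ac)
    finally show ?thesis .
  qed
  finally show ?thesis by simp
qed

text \<open>The number of trees is multiplied by the number of vertices so that the exponent is not
  negative for a single vertex.\<close>

corollary cayley:
  assumes "finite V" "card V = Suc m"
  shows "Suc m * card (trees V) = Suc m ^ m"
proof -
  have "real (Suc m) * (\<Sum>A \<in> trees V. 1) = (\<Sum>us \<in> words {..<Suc m} m. 1)"
    by (rule sum_trees_eq_sum_codes[OF assms]) simp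
  then have "real (Suc m) * real (card (trees V)) = real (Suc m ^ m)"
    by (simp only: sum_constant mult_1_right card_words[OF finite_lessThan] card_lessThan)
  then show ?thesis by (metis of_nat_mult of_nat_eq_iff)
qed

subsection \<open>The Stein equation\<close>

definition ramp :: "real \<Rightarrow> real \<Rightarrow> real \<Rightarrow> real" where
  "ramp z d x = max 0 (min 1 ((z + d - x) / d))"

lemma ramp_bounds: "0 \<le> ramp z d x" "ramp z d x \<le> 1"
  by (auto simp: ramp_def)

lemma ramp_eq_1: "d > 0 \<Longrightarrow> x \<le> z \<Longrightarrow> ramp z d x = 1"
  by (auto simp: ramp_def min_def max_def field_simps)

lemma ramp_eq_0: "d > 0 \<Longrightarrow> x \<ge> z + d \<Longrightarrow> ramp z d x = 0"
  by (auto simp: ramp_def min_def max_def field_simps)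

lemma ramp_lipschitz:
  assumes "d > 0" shows "\<bar>ramp z d x - ramp z d y\<bar> \<le> \<bar>x - y\<bar> / d"
proof -
  have "\<bar>ramp z d x - ramp z d y\<bar> \<le> \<bar>(z + d - x) / d - (z + d - y) / d\<bar>"
    unfolding ramp_def by (auto simp: min_def max_def)
  also have "\<dots> = \<bar>x - y\<bar> / d"
    using assms by (simp add: diff_divide_distrib[symmetric] abs_minus_commute)
  finally show ?thesis .
qed

lemma continuous_on_ramp: "d > 0 \<Longrightarrow> continuous_on S (ramp z d)"
  unfolding ramp_def by (intro continuous_intros) auto

section \<open>Tails of the normal density\<close>

abbreviation \<phi> :: "real \<Rightarrow> real" where "\<phi> \<equiv> std_normal_density"

lemma phi_pos: "0 < \<phi> x" by (simp add: normal_density_pos)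

lemma phi_le_1: "\<phi> x \<le> 1"
proof -
  have "1 \<le> sqrt (2 * pi)" using pi_gt3 by (simp add: real_le_rsqrt)
  moreover have "exp (- x\<^sup>2 / 2) \<le> 1" by simp
  ultimately have "exp (- x\<^sup>2 / 2) \<le> sqrt (2 * pi)" by linarith
  then show ?thesis by (simp add: std_normal_density_def field_simps)
qed

lemma phi_deriv: "(\<phi> has_real_derivative - x * \<phi> x) (at x)"
  unfolding std_normal_density_def
  by (auto intro!: derivative_eq_intros simp: field_simps power2_eq_square)

lemma integrable_phi: "integrable lborel \<phi>"
  by (simp add: integrable_normal_density)

lemma integral_phi: "(\<integral>x. \<phi> x \<partial>lborel) = 1"
  by simp

lemma continuous_on_phi: "continuous_on S \<phi>"
  unfolding std_normal_density_def by (intro continuous_intros) auto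

lemma phi_tendsto_0: "(\<phi> \<longlongrightarrow> 0) at_top"
  unfolding std_normal_density_def
  by real_asymp

text \<open>Mills' bound: beyond \<open>w\<close> the density is at most
  \<open>x * \<phi> x / w\<close>, which has the antiderivative
  \<open>- \<phi> x / w\<close>.\<close>

lemma phi_tail_nn:
  assumes "w > 0"
  shows "(\<integral>\<^sup>+x. ennreal (\<phi> x) * indicator {w..} x \<partial>lborel) \<le> ennreal (\<phi> w / w)"
proof -
  have "(\<integral>\<^sup>+x. ennreal (\<phi> x) * indicator {w..} x \<partial>lborel)
      \<le> (\<integral>\<^sup>+x. ennreal (x * \<phi> x / w) * indicator {w..} x \<partial>lborel)"
    using assms phi_pos
    by (intro nn_integral_mono) (auto split: split_indicator intro!: ennreal_leI simp: field_simps less_imp_le)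
  also have "\<dots> = ennreal (0 - (- \<phi> w / w))"
  proof (rule nn_integral_FTC_atLeast[where F="\<lambda>x. - \<phi> x / w"])
    show "(\<lambda>x. x * \<phi> x / w) \<in> borel_measurable borel" by measurable
    show "((\<lambda>x. - \<phi> x / w) has_real_derivative x * \<phi> x / w) (at x)" for x
      using DERIV_cdivide[OF DERIV_minus[OF phi_deriv[of x]], of w] by simp
    show "\<And>x. w \<le> x \<Longrightarrow> 0 \<le> x * \<phi> x / w" using assms phi_pos by (simp add: less_imp_le)
    show "((\<lambda>x. - \<phi> x / w) \<longlongrightarrow> 0) at_top"
      using tendsto_divide[OF tendsto_minus[OF phi_tendsto_0] tendsto_const[of w]] assms by simp
  qed
  finally show ?thesis by simp
qed

lemma phi_head_nn:
  assumes "w < 0"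
  shows "(\<integral>\<^sup>+x. ennreal (\<phi> x) * indicator {..w} x \<partial>lborel) \<le> ennreal (\<phi> w / (- w))"
proof -
  have "(\<integral>\<^sup>+x. ennreal (\<phi> x) * indicator {..w} x \<partial>lborel)
     = (\<integral>\<^sup>+x. ennreal (\<phi> (-x)) * indicator {..w} (-x) \<partial>lborel)"
    using nn_integral_real_affine[of "\<lambda>x. ennreal (\<phi> x) * indicator {..w} x" "-1" 0] by simp
  also have "\<dots> = (\<integral>\<^sup>+x. ennreal (\<phi> x) * indicator {-w..} x \<partial>lborel)"
    by (intro nn_integral_cong) (auto split: split_indicator simp: std_normal_density_def)
  also have "\<dots> \<le> ennreal (\<phi> (-w) / (-w))" using phi_tail_nn[of "-w"] assms by simp
  finally show ?thesis by (simp add: std_normal_density_def)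
qed

lemma abs_set_lebesgue_integral_le:
  fixes k g :: "real \<Rightarrow> real"
  assumes "\<And>x. \<bar>k x\<bar> \<le> g x" and "k \<in> borel_measurable borel" and "S \<in> sets borel" and "0 \<le> b"
    and "(\<integral>\<^sup>+x. ennreal (g x) * indicator S x \<partial>lborel) \<le> ennreal b"
  shows "\<bar>LINT x:S|lborel. k x\<bar> \<le> b"
proof -
  have "ennreal (norm (LINT x:S|lborel. k x)) \<le> (\<integral>\<^sup>+x. norm (indicator S x *\<^sub>R k x) \<partial>lborel)"
    unfolding set_lebesgue_integral_def
  proof (cases "integrable lborel (\<lambda>x. indicator S x *\<^sub>R k x)")
    case True
    then show "ennreal (norm (LINT x|lborel. indicator S x *\<^sub>R k x))
      \<le> (\<integral>\<^sup>+x. norm (indicator S x *\<^sub>R k x) \<partial>lborel)"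
      by (rule integral_norm_bound_ennreal)
  next
    \<comment> \<open>The Bochner integral of a non-integrable function is 0, so the bound holds
      trivially.\<close>
    case False
    then show "ennreal (norm (LINT x|lborel. indicator S x *\<^sub>R k x))
      \<le> (\<integral>\<^sup>+x. norm (indicator S x *\<^sub>R k x) \<partial>lborel)"
      by (subst not_integrable_integral_eq) simp_all
  qed
  also have "\<dots> \<le> (\<integral>\<^sup>+x. ennreal (g x) * indicator S x \<partial>lborel)"
    using assms(1) by (intro nn_integral_mono) (auto split: split_indicator intro: ennreal_leI)
  also have "\<dots> \<le> ennreal b" by fact
  finally show ?thesis using assms(4) by (simp add: ennreal_le_iff)
qed

definition gauss_mean :: "(real \<Rightarrow> real) \<Rightarrow> real" where
  "gauss_mean h = (LINT x|lborel. h x * \<phi> x)"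

text \<open>The bounded solution of f'(w) - w f(w) = h(w) - E h(Z) for a standard normal Z, obtained
  with the integrating factor \<open>\<phi>\<close>.\<close>

definition stein_sol :: "(real \<Rightarrow> real) \<Rightarrow> real \<Rightarrow> real" where
  "stein_sol h w = (LINT x:{..w}|lborel. (h x - gauss_mean h) * \<phi> x) / \<phi> w"

locale stein_test =
  fixes h :: "real \<Rightarrow> real"
  assumes cont: "continuous_on UNIV h" and h01: "\<And>x. 0 \<le> h x" "\<And>x. h x \<le> 1"
begin

lemma meas [measurable]: "h \<in> borel_measurable borel"
  using cont by (rule borel_measurable_continuous_onI)

lemma integrable_h: "integrable lborel (\<lambda>x. h x * \<phi> x)"
  by (rule Bochner_Integration.integrable_bound[OF integrable_phi])
    (use h01 phi_pos in \<open>auto intro!: AE_I2 simp: abs_mult mult_le_cancel_right1 less_imp_le simp del: std_normal_density_def\<close>)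

lemma gauss_mean_01: "0 \<le> gauss_mean h" "gauss_mean h \<le> 1"
proof -
  show "0 \<le> gauss_mean h" unfolding gauss_mean_def
    using h01 phi_pos by (intro Bochner_Integration.integral_nonneg) (simp add: less_imp_le)
  have "gauss_mean h \<le> (LINT x|lborel. \<phi> x)" unfolding gauss_mean_def
    using h01 phi_pos by (intro integral_mono integrable_h integrable_phi) (simp add: mult_le_cancel_right1 less_imp_le not_less)
  then show "gauss_mean h \<le> 1" by simp
qed

abbreviation "k \<equiv> (\<lambda>x. (h x - gauss_mean h) * \<phi> x)"
abbreviation "K \<equiv> (\<lambda>w. LINT x:{..w}|lborel. k x)"

lemma centred_le_1: "\<bar>h x - gauss_mean h\<bar> \<le> 1"
  using h01[of x] gauss_mean_01 by auto

lemma k_le: "\<bar>k x\<bar> \<le> \<phi> x"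
  using centred_le_1[of x] phi_pos[of x] by (simp add: abs_mult mult_le_cancel_right1 del: std_normal_density_def)

lemma integrable_k: "integrable lborel k"
  by (rule Bochner_Integration.integrable_bound[OF integrable_phi])
    (use k_le phi_pos in \<open>auto intro!: AE_I2 simp: less_imp_le simp del: std_normal_density_def\<close>)

lemma integral_k: "(LINT x|lborel. k x) = 0"
  by (simp add: left_diff_distrib integrable_h integrable_phi integral_phi gauss_mean_def
      del: std_normal_density_def)

lemma set_integrable_k: "S \<in> sets borel \<Longrightarrow> set_integrable lborel S k"
  unfolding set_integrable_def by (rule integrable_mult_indicator[OF _ integrable_k]) simp

text \<open>The part of the integral left of \<open>w - 1\<close> is constant near \<open>w\<close>,
  and the remaining integral is over a compact interval, where the fundamental theorem
  applies.\<close>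

lemma K_deriv: "(K has_real_derivative k w) (at w)"
proof -
  have ck: "continuous_on S k" for S
    by (intro continuous_intros continuous_on_phi continuous_on_subset[OF cont]) auto
  have "((\<lambda>u. integral {w - 1..u} k) has_real_derivative k w) (at w within {w-1..w+1})"
    by (rule integral_has_real_derivative[OF ck]) auto
  then have 1: "((\<lambda>u. integral {w - 1..u} k) has_real_derivative k w) (at w)"
    by (simp add: at_within_Icc_at)
  have 2: "K u = (LINT x:{..<w-1}|lborel. k x) + integral {w-1..u} k" if "u > w - 1" for u
  proof -
    have "{..u} = {..<w-1} \<union> {w-1..u}" using that by auto
    moreover have "(LINT x:{..<w-1} \<union> {w-1..u}|lborel. k x)
        = (LINT x:{..<w-1}|lborel. k x) + (LINT x:{w-1..u}|lborel. k x)"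
      by (rule set_integral_Un[OF _ set_integrable_k set_integrable_k]) auto
    ultimately have "K u = (LINT x:{..<w-1}|lborel. k x) + (LINT x:{w-1..u}|lborel. k x)"
      by (simp only:)
    then show ?thesis using set_borel_integral_eq_integral(2)[OF set_integrable_k[of "{w-1..u}"]] by simp
  qed
  have "((\<lambda>u. (LINT x:{..<w-1}|lborel. k x) + integral {w-1..u} k) has_real_derivative k w) (at w)"
    using 1 by (auto intro!: derivative_eq_intros)
  then show ?thesis
    by (rule has_field_derivative_transform_within_open[where S="{w-1<..}"]) (auto simp: 2)
qed

lemma stein_sol_deriv:
  "(stein_sol h has_real_derivative w * stein_sol h w + h w - gauss_mean h) (at w)"
proof -
  have "((\<lambda>w. K w / \<phi> w) has_real_derivative
      (k w * \<phi> w - K w * (- w * \<phi> w)) / (\<phi> w * \<phi> w)) (at w)"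
    using phi_pos[of w] by (intro DERIV_divide K_deriv phi_deriv) simp
  also have "(k w * \<phi> w - K w * (- w * \<phi> w)) / (\<phi> w * \<phi> w) = w * (K w / \<phi> w) + h w - gauss_mean h"
    using phi_pos[of w] by (simp add: field_simps del: std_normal_density_def)
  finally show ?thesis unfolding stein_sol_def .
qed

lemma K_le_1: "\<bar>K w\<bar> \<le> 1"
proof (rule abs_set_lebesgue_integral_le[of k \<phi>])
  have "(\<integral>\<^sup>+x. ennreal (\<phi> x) * indicator {..w} x \<partial>lborel) \<le> (\<integral>\<^sup>+x. ennreal (\<phi> x) \<partial>lborel)"
    by (intro nn_integral_mono) (auto split: split_indicator)
  also have "\<dots> = 1"
    using nn_integral_eq_integral[OF integrable_phi] phi_pos by (simp add: less_imp_le)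
  finally show "(\<integral>\<^sup>+x. ennreal (\<phi> x) * indicator {..w} x \<partial>lborel) \<le> ennreal 1" by simp
qed (use k_le in auto)

text \<open>The total integral of \<open>k\<close> vanishes, so for positive \<open>w\<close> the
  integral over the left ray may be replaced by the one over the right ray; on either side it is
  bounded by a Gaussian tail.\<close>

lemma K_mills: "\<bar>w\<bar> * \<bar>K w\<bar> \<le> \<phi> w"
proof (cases "w = 0")
  case False
  have "\<bar>K w\<bar> \<le> \<phi> w / \<bar>w\<bar>"
  proof (cases "w > 0")
    case True
    have "{..w} \<union> {w<..} = UNIV" by auto
    then have "K w + (LINT x:{w<..}|lborel. k x) = (LINT x:UNIV|lborel. k x)"
      by (subst set_integral_Un[symmetric]) (auto simp: set_integrable_k)
    also have "\<dots> = 0" using integral_k by (simp add: set_lebesgue_integral_def)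
    finally have "\<bar>K w\<bar> = \<bar>LINT x:{w<..}|lborel. k x\<bar>" by linarith
    also have "\<dots> \<le> \<phi> w / w"
    proof (rule abs_set_lebesgue_integral_le[of k \<phi>])
      have "(\<integral>\<^sup>+x. ennreal (\<phi> x) * indicator {w<..} x \<partial>lborel)
          \<le> (\<integral>\<^sup>+x. ennreal (\<phi> x) * indicator {w..} x \<partial>lborel)"
        by (intro nn_integral_mono) (auto split: split_indicator)
      also have "\<dots> \<le> ennreal (\<phi> w / w)" using phi_tail_nn True by simp
      finally show "(\<integral>\<^sup>+x. ennreal (\<phi> x) * indicator {w<..} x \<partial>lborel) \<le> ennreal (\<phi> w / w)" .
    qed (use k_le True phi_pos[of w] in \<open>auto simp: less_imp_le\<close>)
    finally show ?thesis using True by simp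
  next
    case f: False
    have "\<bar>K w\<bar> \<le> \<phi> w / (-w)"
      by (rule abs_set_lebesgue_integral_le[of k \<phi>])
       (use k_le f False phi_pos[of w] phi_head_nn[of w] in \<open>auto simp: less_imp_le divide_le_0_iff\<close>)
    then show ?thesis using f by simp
  qed
  then show ?thesis using False by (simp add: field_simps del: std_normal_density_def)
qed (use phi_pos[of 0] in \<open>simp add: less_imp_le\<close>)

lemma stein_sol_mult_bound: "\<bar>w * stein_sol h w\<bar> \<le> 1"
  using K_mills[of w] phi_pos[of w] by (simp add: stein_sol_def abs_mult del: std_normal_density_def)

text \<open>Away from the origin the bound on \<open>w * stein_sol h w\<close> suffices. Near it the
  numerator is at most 1 and \<open>1 / \<phi> w\<close> is at most sqrt (2 pi e), about
  4.13.\<close>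

lemma stein_sol_bound: "\<bar>stein_sol h w\<bar> \<le> 5"
proof (cases "\<bar>w\<bar> \<ge> 1")
  case True
  then have "\<bar>stein_sol h w\<bar> \<le> \<bar>w\<bar> * \<bar>stein_sol h w\<bar>" by (simp add: mult_le_cancel_right1)
  then show ?thesis using stein_sol_mult_bound[of w] by (simp add: abs_mult)
next
  case False
  then have "\<bar>w\<bar>\<^sup>2 \<le> 1" by (intro power_le_one) auto
  then have 1: "exp (w\<^sup>2 / 2) \<le> exp (1/2)" by simp
  have "(exp (1/2) * sqrt (2 * pi))\<^sup>2 = exp 1 * (2 * pi)"
    by (simp add: power_mult_distrib exp_double[symmetric])
  also have "\<dots> \<le> 3 * 8" using exp_le pi_less_4 by (intro mult_mono) auto
  also have "\<dots> \<le> 5\<^sup>2" by simp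
  finally have "exp (1/2) * sqrt (2 * pi) \<le> 5" by (rule power2_le_imp_le) simp
  moreover have "exp (w\<^sup>2 / 2) * sqrt (2 * pi) \<le> exp (1/2) * sqrt (2 * pi)"
    using 1 by (rule mult_right_mono) simp
  ultimately have 2: "exp (w\<^sup>2 / 2) * sqrt (2 * pi) \<le> 5" by (rule order_trans[rotated])
  have "\<bar>stein_sol h w\<bar> \<le> 1 / \<phi> w"
    using K_le_1[of w] phi_pos[of w] by (simp add: stein_sol_def divide_right_mono del: std_normal_density_def)
  also have "\<dots> = exp (w\<^sup>2 / 2) * sqrt (2 * pi)"
    by (simp add: std_normal_density_def exp_minus field_simps)
  finally show ?thesis using 2 by simp
qed

lemma stein_sol_deriv_bound: "\<bar>w * stein_sol h w + h w - gauss_mean h\<bar> \<le> 2"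
  using stein_sol_mult_bound[of w] centred_le_1[of w] by linarith

lemma stein_sol_lipschitz: "\<bar>stein_sol h x - stein_sol h y\<bar> \<le> 2 * \<bar>x - y\<bar>"
proof -
  have "norm (stein_sol h x - stein_sol h y) \<le> 2 * norm (x - y)"
    by (rule field_differentiable_bound[OF convex_UNIV])
      (auto intro: stein_sol_deriv stein_sol_deriv_bound)
  then show ?thesis by simp
qed

text \<open>The derivative is given by the Stein equation itself, and its variation has three
  sources: \<open>2 * \<bar>w\<bar>\<close> comes from the Lipschitz constant of the solution, 5
  from its size, and \<open>c\<close> from the test function. This is where a steep ramp is paid
  for.\<close>

lemma stein_sol_taylor:
  assumes lip: "\<And>x y. \<bar>h x - h y\<bar> \<le> c * \<bar>x - y\<bar>"
  shows "\<bar>stein_sol h (w + t) - stein_sol h w - t * (w * stein_sol h w + h w - gauss_mean h)\<bar>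
           \<le> t\<^sup>2 * (2 * \<bar>w\<bar> + 5 + c)"
proof -
  define f' where "f' = (\<lambda>w. w * stein_sol h w + h w - gauss_mean h)"
  have d: "(stein_sol h has_real_derivative f' x) (at x)" for x
    unfolding f'_def by (rule stein_sol_deriv)
  have "0 \<le> c * \<bar>1 - 0\<bar>" by (rule order_trans[OF abs_ge_zero lip])
  then have c0: "0 \<le> c" by simp
  have f'_diff: "\<bar>f' (w + s) - f' w\<bar> \<le> \<bar>s\<bar> * (2 * \<bar>w\<bar> + 5 + c)" for s
  proof -
    have "f' (w + s) - f' w = w * (stein_sol h (w + s) - stein_sol h w) + s * stein_sol h (w + s)
        + (h (w + s) - h w)"
      unfolding f'_def by (simp add: algebra_simps)
    then have "\<bar>f' (w + s) - f' w\<bar> \<le> \<bar>w\<bar> * \<bar>stein_sol h (w + s) - stein_sol h w\<bar>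
        + \<bar>s\<bar> * \<bar>stein_sol h (w + s)\<bar> + \<bar>h (w + s) - h w\<bar>"
      unfolding abs_mult[symmetric] by linarith
    also have "\<dots> \<le> \<bar>w\<bar> * (2 * \<bar>s\<bar>) + \<bar>s\<bar> * 5 + c * \<bar>s\<bar>"
      using stein_sol_lipschitz[of "w + s" w] stein_sol_bound[of "w + s"] lip[of "w + s" w]
      by (intro add_mono mult_left_mono) auto
    finally show ?thesis by (simp add: algebra_simps)
  qed
  \<comment> \<open>Subtracting the tangent direction at \<open>w\<close> leaves a function whose
    derivative is the increment of \<open>f'\<close>, so the mean value inequality gives a quadratic
    remainder.\<close>
  define g where "g = (\<lambda>x. stein_sol h x - x * f' w)"
  have "norm (g (w + t) - g w) \<le> (\<bar>t\<bar> * (2 * \<bar>w\<bar> + 5 + c)) * norm ((w + t) - w)"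
  proof (rule field_differentiable_bound[of "closed_segment w (w + t)" g "\<lambda>x. f' x - f' w"])
    show "(g has_real_derivative f' x - f' w) (at x within closed_segment w (w + t))" for x
      unfolding g_def by (auto intro!: derivative_eq_intros has_field_derivative_at_within[OF d])
    fix x assume "x \<in> closed_segment w (w + t)"
    then have "\<bar>x - w\<bar> \<le> \<bar>t\<bar>" using segment_bound1[of x w "w + t"] by simp
    moreover have "\<bar>f' x - f' w\<bar> \<le> \<bar>x - w\<bar> * (2 * \<bar>w\<bar> + 5 + c)" using f'_diff[of "x - w"] by simp
    ultimately show "norm (f' x - f' w) \<le> \<bar>t\<bar> * (2 * \<bar>w\<bar> + 5 + c)"
      using c0 mult_right_mono[of "\<bar>x - w\<bar>" "\<bar>t\<bar>" "2 * \<bar>w\<bar> + 5 + c"] by simp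
  qed auto
  moreover have "g (w + t) - g w = stein_sol h (w + t) - stein_sol h w - t * f' w"
    unfolding g_def by (simp add: algebra_simps)
  moreover have "(\<bar>t\<bar> * (2 * \<bar>w\<bar> + 5 + c)) * norm ((w + t) - w) = t\<^sup>2 * (2 * \<bar>w\<bar> + 5 + c)"
  proof -
    have "(\<bar>t\<bar> * (2 * \<bar>w\<bar> + 5 + c)) * norm ((w + t) - w) = \<bar>t\<bar>\<^sup>2 * (2 * \<bar>w\<bar> + 5 + c)"
      by (simp only: real_norm_def add_diff_cancel_left' power2_eq_square mult_ac)
    then show ?thesis by (simp only: power2_abs)
  qed
  ultimately show ?thesis by (simp only: f'_def real_norm_def)
qed

end

lemma stein_test_ramp: "d > 0 \<Longrightarrow> stein_test (ramp z d)"
  by unfold_locales (auto simp: ramp_bounds continuous_on_ramp)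

lemma cdf_std_normal:
  "cdf std_normal_distribution t = (LINT x|lborel. indicator {..t} x * \<phi> x)"
proof -
  have "cdf std_normal_distribution t = enn2real (\<integral>\<^sup>+x. ennreal (\<phi> x) * indicator {..t} x \<partial>lborel)"
    by (simp add: cdf_def measure_def emeasure_density)
  also have "(\<integral>\<^sup>+x. ennreal (\<phi> x) * indicator {..t} x \<partial>lborel) = (\<integral>\<^sup>+x. ennreal (indicator {..t} x * \<phi> x) \<partial>lborel)"
    by (intro nn_integral_cong) (auto split: split_indicator)
  also have "enn2real \<dots> = (LINT x|lborel. indicator {..t} x * \<phi> x)"
    using phi_pos by (intro integral_eq_nn_integral[symmetric]) (auto simp: less_imp_le)
  finally show ?thesis .
qed

lemma integrable_indicator_phi: "S \<in> sets borel \<Longrightarrow> integrable lborel (\<lambda>x. indicator S x * \<phi> x)"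
  using integrable_mult_indicator[OF _ integrable_phi, of S] by simp

lemma cdf_std_normal_lipschitz:
  assumes "0 \<le> d"
  shows "cdf std_normal_distribution (t + d) \<le> cdf std_normal_distribution t + d"
proof -
  have "cdf std_normal_distribution (t + d) - cdf std_normal_distribution t
      = (LINT x|lborel. indicator {..t+d} x * \<phi> x - indicator {..t} x * \<phi> x)"
    unfolding cdf_std_normal by (intro Bochner_Integration.integral_diff[symmetric] integrable_indicator_phi) auto
  also have "\<dots> \<le> (LINT x|lborel. indicator {t..t+d} x)"
    using assms phi_le_1 phi_pos
    by (intro integral_mono Bochner_Integration.integrable_diff integrable_indicator_phi)
      (auto split: split_indicator simp: less_imp_le)
  also have "\<dots> = d" using assms by simp
  finally show ?thesis by simp
qed

lemma gauss_mean_ramp: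
  assumes "d > 0"
  shows "cdf std_normal_distribution z \<le> gauss_mean (ramp z d)"
    "gauss_mean (ramp z d) \<le> cdf std_normal_distribution (z + d)"
proof -
  interpret stein_test "ramp z d" using stein_test_ramp[OF assms] .
  show "cdf std_normal_distribution z \<le> gauss_mean (ramp z d)"
    unfolding cdf_std_normal gauss_mean_def
    using phi_pos ramp_bounds ramp_eq_1[OF assms]
    by (intro integral_mono integrable_h integrable_indicator_phi)
      (auto split: split_indicator simp: less_imp_le)
  show "gauss_mean (ramp z d) \<le> cdf std_normal_distribution (z + d)"
    unfolding cdf_std_normal gauss_mean_def
    using phi_pos ramp_bounds ramp_eq_0[OF assms]
    by (intro integral_mono integrable_h integrable_indicator_phi)
      (auto split: split_indicator simp: less_imp_le mult_le_cancel_right1 not_le)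
qed

subsection \<open>Occurrences of the pattern are local\<close>

lemma relpow_reflcl_mono: "n \<le> m \<Longrightarrow> (R\<^sup>=) ^^ n \<subseteq> (R\<^sup>=) ^^ m"
proof (induction m)
  case (Suc m)
  show ?case
  proof (cases "n = Suc m")
    case False
    then have "(R\<^sup>=) ^^ n \<subseteq> (R\<^sup>=) ^^ m" using Suc by simp
    also have "\<dots> \<subseteq> (R\<^sup>=) ^^ Suc m" by (auto intro: relpow_Suc_I)
    finally show ?thesis .
  qed simp
qed simp

text \<open>Powers of the reflexive closure are the walks of at most \<open>k\<close> arcs, so this
  is a closed ball.\<close>

definition rball :: "'b rel \<Rightarrow> nat \<Rightarrow> 'b \<Rightarrow> 'b set" where
  "rball \<Gamma> k x = ((\<Gamma>\<^sup>=) ^^ k) `` {x}"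

lemma rball_self: "x \<in> rball \<Gamma> k x"
  using relpow_reflcl_mono[of 0 k \<Gamma>] by (auto simp: rball_def)

lemma card_rball:
  assumes "\<And>v. finite (\<Gamma> `` {v})" "\<And>v. card (\<Gamma> `` {v}) \<le> d"
  shows "finite (rball \<Gamma> k x) \<and> card (rball \<Gamma> k x) \<le> (d + 1) ^ k"
proof (induction k)
  case (Suc k)
  have eq: "rball \<Gamma> (Suc k) x = (\<Union>y \<in> rball \<Gamma> k x. insert y (\<Gamma> `` {y}))"
    by (auto simp: rball_def)
  have "card (rball \<Gamma> (Suc k) x) \<le> (\<Sum>y \<in> rball \<Gamma> k x. card (insert y (\<Gamma> `` {y})))"
    unfolding eq using Suc by (intro card_UN_le) simp
  also have "\<dots> \<le> (\<Sum>y \<in> rball \<Gamma> k x. d + 1)"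
  proof (rule sum_mono)
    fix y
    have "card (insert y (\<Gamma> `` {y})) \<le> Suc (card (\<Gamma> `` {y}))"
      using assms(1) by (simp add: card_insert_if)
    then show "card (insert y (\<Gamma> `` {y})) \<le> d + 1" using assms(2)[of y] by linarith
  qed
  also have "\<dots> = card (rball \<Gamma> k x) * (d + 1)" by simp
  also have "\<dots> \<le> (d + 1) ^ k * (d + 1)" using Suc by (intro mult_right_mono) simp_all
  finally have "card (rball \<Gamma> (Suc k) x) \<le> (d + 1) ^ Suc k" by (simp add: mult.commute)
  moreover have "finite (rball \<Gamma> (Suc k) x)" unfolding eq using Suc assms(1) by simp
  ultimately show ?case by simp
qed (simp add: rball_def)

text \<open>Only arcs that leave a vertex outside \<open>X\<close> are compared, since
  \<open>emb\<close> inspects only arcs leaving the image.\<close>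

definition agree_off :: "'b set \<Rightarrow> 'b rel \<Rightarrow> 'b rel \<Rightarrow> bool" where
  "agree_off X A B \<longleftrightarrow> (\<forall>v z. v \<notin> X \<longrightarrow> ((v, z) \<in> A \<longleftrightarrow> (v, z) \<in> B))"

text \<open>\<open>nondeg\<close> removes the patterns with a deterministic count. Together with
  \<open>WH_ne\<close> it forces at least two vertices, so that a host tree can be represented by
  its arcs alone; see \<open>occs_Field\<close>.\<close>

locale tree_pattern =
  fixes VH :: "'a set" and AH :: "'a rel" and WH :: "'a set"
  assumes tree: "is_tree VH AH" and WH: "WH \<subseteq> VH" and WH_ne: "WH \<noteq> {}"
    and nondeg: "\<not> (card VH \<le> 2 \<and> WH = VH)"
begin

definition emb :: "'b rel \<Rightarrow> ('a \<Rightarrow> 'b) \<Rightarrow> bool" where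
  "emb A f \<longleftrightarrow> inj_on f VH \<and> (\<forall>x \<in> VH. \<forall>y \<in> VH. (x, y) \<in> AH \<longleftrightarrow> (f x, f y) \<in> A) \<and>
     (\<forall>x \<in> VH - WH. \<forall>z. (f x, z) \<in> A \<longrightarrow> z \<in> f ` VH)"

text \<open>Passing to images identifies embeddings that differ by an automorphism of the pattern
  preserving \<open>WH\<close>.\<close>

definition occs :: "'b rel \<Rightarrow> ('b set \<times> 'b set) set" where
  "occs A = (\<lambda>f. (f ` VH, f ` WH)) ` {f. emb A f}"

text \<open>A crude bound for the diameter: the reflexive transitive closure of a finite relation is
  exhausted by the powers up to its number of arcs.\<close>

definition radius :: nat where "radius = card AH"

lemma finite_VH: "finite VH" using is_tree_finite[OF tree] .

lemma card_VH: "card VH \<ge> 2"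
proof (rule ccontr)
  assume "\<not> card VH \<ge> 2"
  moreover have "card VH \<noteq> 0" using finite_VH is_tree_nonempty[OF tree] by simp
  ultimately have "card VH = 1" by linarith
  then obtain x where "VH = {x}" by (auto simp: card_1_singleton_iff)
  then show False using WH WH_ne nondeg by auto
qed

lemma AH_sub: "AH \<subseteq> VH \<times> VH" using is_tree_subset[OF tree] .

lemma emb_relpow:
  assumes "emb A f" "A \<subseteq> \<Gamma>" "(x, y) \<in> AH ^^ n"
  shows "(f x, f y) \<in> \<Gamma> ^^ n"
  using assms(3)
proof (induction n arbitrary: y)
  case (Suc n)
  then obtain z where z: "(x, z) \<in> AH ^^ n" "(z, y) \<in> AH" by (meson relpow_Suc_E)
  have "(f z, f y) \<in> \<Gamma>" using z(2) AH_sub assms(1,2) by (auto simp: emb_def)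
  with Suc.IH[OF z(1)] show ?case by (rule relpow_Suc_I)
qed simp

lemma emb_rball:
  assumes "emb A f" "A \<subseteq> \<Gamma>" "x \<in> VH" "y \<in> VH"
  shows "f y \<in> rball \<Gamma> radius (f x)"
proof -
  have "(x, y) \<in> AH\<^sup>*" by (rule is_tree_connected[OF tree assms(3,4)])
  then obtain n where n: "n \<le> radius" "(x, y) \<in> AH ^^ n"
    unfolding rtrancl_finite_eq_relpow[OF is_tree_finite_arcs[OF tree]] radius_def by blast
  have "(f x, f y) \<in> (\<Gamma>\<^sup>=) ^^ n"
    using emb_relpow[OF assms(1) _ n(2), of "\<Gamma>\<^sup>="] assms(2) by auto
  then show ?thesis using relpow_reflcl_mono[OF n(1), of \<Gamma>] by (auto simp: rball_def)
qed

lemma occs_rball: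
  assumes "(U, W) \<in> occs A" "A \<subseteq> \<Gamma>" "x \<in> U"
  shows "U \<subseteq> rball \<Gamma> radius x"
  using assms emb_rball by (fastforce simp: occs_def)

lemma occs_nonempty: "(U, W) \<in> occs A \<Longrightarrow> U \<noteq> {}"
  using is_tree_nonempty[OF tree] by (auto simp: occs_def)

lemma occs_card: "(U, W) \<in> occs A \<Longrightarrow> card U = card VH \<and> finite U \<and> W \<subseteq> U"
  using finite_VH WH by (auto simp: occs_def emb_def card_image)

text \<open>No vertex of the pattern is isolated, so every vertex of an occurrence lies on an arc of
  the host. This replaces a reference to the vertex set of the host.\<close>

lemma occs_Field:
  assumes "(U, W) \<in> occs A" shows "U \<subseteq> Field A"
proof
  fix u assume "u \<in> U"
  then obtain f x where f: "emb A f" "x \<in> VH" "u = f x" using assms by (auto simp: occs_def)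
  have "AH `` {x} \<noteq> {}" using is_tree_isolated[OF tree f(2)] card_VH by fastforce
  then obtain y where "(x, y) \<in> AH" by auto
  then have "(f x, f y) \<in> A" using f(1) AH_sub by (auto simp: emb_def)
  then show "u \<in> Field A" using f(3) by (auto simp: Field_def)
qed

lemma emb_agree:
  assumes "\<forall>u \<in> f ` VH. \<forall>z. (u, z) \<in> A \<longleftrightarrow> (u, z) \<in> B"
  shows "emb A f \<longleftrightarrow> emb B f"
proof -
  have "(f x, z) \<in> A \<longleftrightarrow> (f x, z) \<in> B" if "x \<in> VH" for x z using assms that by blast
  then show ?thesis unfolding emb_def by auto
qed

lemma occs_agree:
  assumes "\<forall>u \<in> U. \<forall>z. (u, z) \<in> A \<longleftrightarrow> (u, z) \<in> B"
  shows "(U, W) \<in> occs A \<longleftrightarrow> (U, W) \<in> occs B"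
  unfolding occs_def using emb_agree[of _ A B] assms by auto

lemma card_occs_within:
  assumes "finite S"
  shows "finite {p \<in> occs A. fst p \<subseteq> S} \<and> card {p \<in> occs A. fst p \<subseteq> S} \<le> card S ^ card VH"
proof -
  have sub: "{p \<in> occs A. fst p \<subseteq> S} \<subseteq> (\<lambda>f. (f ` VH, f ` WH)) ` (VH \<rightarrow>\<^sub>E S)"
  proof
    fix p assume "p \<in> {p \<in> occs A. fst p \<subseteq> S}"
    then obtain f where f: "p = (f ` VH, f ` WH)" "f ` VH \<subseteq> S" by (auto simp: occs_def)
    have "restrict f VH ` VH = f ` VH" "restrict f VH ` WH = f ` WH" using WH by (auto intro!: image_cong)
    then have "p = (\<lambda>f. (f ` VH, f ` WH)) (restrict f VH)" using f(1) by (simp only:)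
    moreover have "restrict f VH \<in> VH \<rightarrow>\<^sub>E S" using f(2) by auto
    ultimately show "p \<in> (\<lambda>f. (f ` VH, f ` WH)) ` (VH \<rightarrow>\<^sub>E S)" by (rule image_eqI)
  qed
  have fin: "finite (VH \<rightarrow>\<^sub>E S)" using finite_VH assms by (rule finite_PiE)
  have "card {p \<in> occs A. fst p \<subseteq> S} \<le> card (VH \<rightarrow>\<^sub>E S)"
    by (rule order_trans[OF card_mono[OF finite_imageI[OF fin] sub] card_image_le[OF fin]])
  then show ?thesis using finite_subset[OF sub finite_imageI[OF fin]] by (simp add: card_funcsetE finite_VH)
qed

lemma finite_occs:
  assumes "finite A" shows "finite (occs A)"
proof -
  have "finite (Field A)" using assms by (rule finite_Field)
  then have fin: "finite {p \<in> occs A. fst p \<subseteq> Field A}" using card_occs_within by blast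
  have "fst p \<subseteq> Field A" if "p \<in> occs A" for p
    using occs_Field[of "fst p" "snd p" A] that by simp
  then have eq: "occs A = {p \<in> occs A. fst p \<subseteq> Field A}" by blast
  show ?thesis by (subst eq) (rule fin)
qed

text \<open>Occurrences are connected, so one that meets \<open>X\<close> lies in the union of the
  balls around the points of \<open>X\<close>, and there \<open>card_occs_within\<close>
  applies.\<close>

lemma card_occs_meeting:
  assumes "A \<subseteq> \<Gamma>" "\<And>v. finite (\<Gamma> `` {v})" "\<And>v. card (\<Gamma> `` {v}) \<le> d" "finite X"
  shows "card {p \<in> occs A. fst p \<inter> X \<noteq> {}} \<le> (card X * (d + 1) ^ radius) ^ card VH"
proof -
  let ?S = "\<Union>x \<in> X. rball \<Gamma> radius x"
  have fin: "finite ?S" using assms(4) card_rball[OF assms(2,3)] by blast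
  have "card ?S \<le> (\<Sum>x \<in> X. card (rball \<Gamma> radius x))" by (rule card_UN_le[OF assms(4)])
  also have "\<dots> \<le> (\<Sum>x \<in> X. (d + 1) ^ radius)"
    by (rule sum_mono) (use card_rball[OF assms(2,3)] in blast)
  finally have S: "card ?S \<le> card X * (d + 1) ^ radius" by simp
  have "{p \<in> occs A. fst p \<inter> X \<noteq> {}} \<subseteq> {p \<in> occs A. fst p \<subseteq> ?S}"
  proof
    fix p assume "p \<in> {p \<in> occs A. fst p \<inter> X \<noteq> {}}"
    then obtain x where p: "p \<in> occs A" and x: "x \<in> fst p" "x \<in> X" by blast
    have "fst p \<subseteq> rball \<Gamma> radius x"
      using occs_rball[of "fst p" "snd p" A \<Gamma> x] p x(1) assms(1) by simp
    then show "p \<in> {p \<in> occs A. fst p \<subseteq> ?S}" using p x(2) by blast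
  qed
  then have "card {p \<in> occs A. fst p \<inter> X \<noteq> {}} \<le> card {p \<in> occs A. fst p \<subseteq> ?S}"
    using card_occs_within[OF fin] by (intro card_mono) auto
  also have "\<dots> \<le> card ?S ^ card VH" using card_occs_within[OF fin] by blast
  also have "\<dots> \<le> (card X * (d + 1) ^ radius) ^ card VH" using S by (rule power_mono) simp
  finally show ?thesis .
qed

lemma card_occs_split:
  assumes "finite A"
  shows "card (occs A) = card {p \<in> occs A. fst p \<inter> X \<noteq> {}} + card {p \<in> occs A. fst p \<inter> X = {}}"
proof -
  have "occs A = {p \<in> occs A. fst p \<inter> X \<noteq> {}} \<union> {p \<in> occs A. fst p \<inter> X = {}}" by auto
  then show ?thesis
    using card_Un_disjoint[of "{p \<in> occs A. fst p \<inter> X \<noteq> {}}" "{p \<in> occs A. fst p \<inter> X = {}}"]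
      finite_occs[OF assms] by auto
qed

lemma occs_off_agree:
  assumes "agree_off X A B"
  shows "{p \<in> occs A. fst p \<inter> X = {}} = {p \<in> occs B. fst p \<inter> X = {}}"
proof -
  have "(U, W) \<in> occs A \<longleftrightarrow> (U, W) \<in> occs B" if "U \<inter> X = {}" for U W
    using assms that by (intro occs_agree) (auto simp: agree_off_def)
  then show ?thesis by auto
qed

lemma diff_card_occs:
  assumes "finite A" "finite B" "agree_off X A B"
  shows "real (card (occs A)) - real (card (occs B))
    = real (card {p \<in> occs A. fst p \<inter> X \<noteq> {}}) - real (card {p \<in> occs B. fst p \<inter> X \<noteq> {}})"
proof -
  have "{p \<in> occs A. fst p \<inter> X = {}} = {p \<in> occs B. fst p \<inter> X = {}}"
    by (rule occs_off_agree[OF assms(3)])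
  then show ?thesis
    using card_occs_split[OF assms(1), of X] card_occs_split[OF assms(2), of X] by simp
qed

lemma abs_diff_card_occs:
  assumes fin: "finite A" "finite B" and agree: "agree_off X A B"
    and sub: "A \<subseteq> \<Gamma>" "B \<subseteq> \<Gamma>" and deg: "\<And>v. finite (\<Gamma> `` {v})" "\<And>v. card (\<Gamma> `` {v}) \<le> d"
    and X: "finite X"
  shows "\<bar>real (card (occs A)) - real (card (occs B))\<bar> \<le> real ((card X * (d + 1) ^ radius) ^ card VH)"
  using diff_card_occs[OF fin agree] card_occs_meeting[OF sub(1) deg X] card_occs_meeting[OF sub(2) deg X] by linarith

text \<open>An occurrence that meets \<open>X\<close> is too small to reach \<open>Y\<close>, so a
  change at \<open>Y\<close> leaves the occurrences that meet \<open>X\<close> as they are. Only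
  these enter the first difference.\<close>

lemma second_diff_card_occs:
  assumes fin: "finite A00" "finite A10" "finite A01" "finite A11"
    and X: "agree_off X A00 A10" "agree_off X A01 A11"
    and Y: "agree_off Y A00 A01" "agree_off Y A10 A11"
    and sub: "A00 \<subseteq> \<Gamma>" "A10 \<subseteq> \<Gamma>" "A01 \<subseteq> \<Gamma>" "A11 \<subseteq> \<Gamma>"
    and far: "\<And>x y. x \<in> X \<Longrightarrow> y \<in> Y \<Longrightarrow> y \<notin> rball \<Gamma> radius x"
  shows "real (card (occs A00)) - real (card (occs A10)) = real (card (occs A01)) - real (card (occs A11))"
proof -
  have miss: "fst p \<inter> Y = {}" if p: "p \<in> occs A" "A \<subseteq> \<Gamma>" "fst p \<inter> X \<noteq> {}" for p A
  proof -
    obtain x where x: "x \<in> fst p" "x \<in> X" using p(3) by auto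
    have "fst p \<subseteq> rball \<Gamma> radius x"
      using occs_rball[of "fst p" "snd p" A \<Gamma> x] p(1,2) x(1) by simp
    then show ?thesis using far[OF x(2)] by blast
  qed
  have eq: "{p \<in> occs A. fst p \<inter> X \<noteq> {}} = {p \<in> occs B. fst p \<inter> X \<noteq> {}}"
    if h: "agree_off Y A B" "A \<subseteq> \<Gamma>" "B \<subseteq> \<Gamma>" for A B
    using occs_off_agree[OF h(1)] miss[OF _ h(2)] miss[OF _ h(3)] by blast
  show ?thesis
    unfolding diff_card_occs[OF fin(1,2) X(1)] diff_card_occs[OF fin(3,4) X(2)]
      eq[OF Y(1) sub(1,3)] eq[OF Y(2) sub(2,4)] ..
qed

section \<open>Invariance under relabelling of the host\<close>

lemma emb_cong:
  assumes "\<And>x. x \<in> VH \<Longrightarrow> f x = h x"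
  shows "emb A f \<longleftrightarrow> emb A h"
proof -
  have 1: "f ` VH = h ` VH" using assms by (rule image_cong[OF refl])
  have 2: "inj_on f VH \<longleftrightarrow> inj_on h VH" using assms by (rule inj_on_cong)
  show ?thesis unfolding emb_def 1 2 using assms by simp
qed

lemma emb_relabel:
  assumes g: "inj_on g S" and A: "A \<subseteq> S \<times> S" and f: "f ` VH \<subseteq> S"
  shows "emb (map_prod g g ` A) (g \<circ> f) \<longleftrightarrow> emb A f"
proof -
  have fS: "f x \<in> S" if "x \<in> VH" for x using f that by blast
  have arc: "(g u, z) \<in> map_prod g g ` A \<longleftrightarrow> (\<exists>w. z = g w \<and> (u, w) \<in> A)" if u: "u \<in> S" for u z
  proof
    assume "(g u, z) \<in> map_prod g g ` A"
    then obtain a b where ab: "(a, b) \<in> A" "g u = g a" "z = g b" by auto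
    then have "u = a" using inj_onD[OF g ab(2) u] A by blast
    then show "\<exists>w. z = g w \<and> (u, w) \<in> A" using ab by blast
  next
    assume "\<exists>w. z = g w \<and> (u, w) \<in> A"
    then obtain w where "z = g w" "(u, w) \<in> A" by blast
    then show "(g u, z) \<in> map_prod g g ` A" by (intro image_eqI[of _ _ "(u, w)"]) simp_all
  qed
  have arc2: "(g (f x), g (f y)) \<in> map_prod g g ` A \<longleftrightarrow> (f x, f y) \<in> A" if x: "x \<in> VH" and y: "y \<in> VH" for x y
  proof -
    have "w = f y" if "g (f y) = g w" "(f x, w) \<in> A" for w
      using inj_onD[OF g that(1) fS[OF y]] that(2) A by blast
    then show ?thesis unfolding arc[OF fS[OF x]] by blast
  qed
  have mem: "g w \<in> (g \<circ> f) ` VH \<longleftrightarrow> w \<in> f ` VH" if "w \<in> S" for w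
    unfolding image_comp[symmetric] by (rule inj_on_image_mem_iff[OF g that f])
  have arc3: "(\<forall>z. (g (f x), z) \<in> map_prod g g ` A \<longrightarrow> z \<in> (g \<circ> f) ` VH) \<longleftrightarrow> (\<forall>w. (f x, w) \<in> A \<longrightarrow> w \<in> f ` VH)"
    if x: "x \<in> VH" for x
  proof -
    have "(\<forall>z. (g (f x), z) \<in> map_prod g g ` A \<longrightarrow> z \<in> (g \<circ> f) ` VH)
        \<longleftrightarrow> (\<forall>w. (f x, w) \<in> A \<longrightarrow> g w \<in> (g \<circ> f) ` VH)"
      unfolding arc[OF fS[OF x]] by blast
    also have "\<dots> \<longleftrightarrow> (\<forall>w. (f x, w) \<in> A \<longrightarrow> w \<in> f ` VH)" using mem A by blast
    finally show ?thesis .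
  qed
  have inj: "inj_on (g \<circ> f) VH \<longleftrightarrow> inj_on f VH"
    using comp_inj_on_iff[of f VH g] inj_on_subset[OF g f] inj_on_imageI2[of g f VH] by blast
  have c2: "(\<forall>x \<in> VH. \<forall>y \<in> VH. (x, y) \<in> AH \<longleftrightarrow> ((g \<circ> f) x, (g \<circ> f) y) \<in> map_prod g g ` A)
      \<longleftrightarrow> (\<forall>x \<in> VH. \<forall>y \<in> VH. (x, y) \<in> AH \<longleftrightarrow> (f x, f y) \<in> A)"
    by (intro ball_cong refl) (simp only: o_apply arc2)
  have c3: "(\<forall>x \<in> VH - WH. \<forall>z. ((g \<circ> f) x, z) \<in> map_prod g g ` A \<longrightarrow> z \<in> (g \<circ> f) ` VH)
      \<longleftrightarrow> (\<forall>x \<in> VH - WH. \<forall>w. (f x, w) \<in> A \<longrightarrow> w \<in> f ` VH)"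
  proof (rule ball_cong[OF refl])
    fix x assume x: "x \<in> VH - WH"
    have "(g \<circ> f) x = g (f x)" by simp
    then show "(\<forall>z. ((g \<circ> f) x, z) \<in> map_prod g g ` A \<longrightarrow> z \<in> (g \<circ> f) ` VH)
        \<longleftrightarrow> (\<forall>w. (f x, w) \<in> A \<longrightarrow> w \<in> f ` VH)"
      using arc3[of x] x by (simp only: Diff_iff)
  qed
  show ?thesis unfolding emb_def inj c2 c3 ..
qed

text \<open>Injectivity is available on \<open>S\<close> only. An embedding into the relabelled host
  is pulled back by \<open>inv_into\<close>, which is legitimate because its image consists of
  endpoints of arcs.\<close>

lemma occs_image:
  assumes g: "inj_on g S" and A: "A \<subseteq> S \<times> S"
  shows "occs (map_prod g g ` A) = (\<lambda>(U, W). (g ` U, g ` W)) ` occs A"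
    and "card (occs (map_prod g g ` A)) = card (occs A)"
proof -
  have sub: "U \<subseteq> S" if "(U, W) \<in> occs A" for U W
    using occs_Field[OF that] A by (auto simp: Field_def)
  show eq: "occs (map_prod g g ` A) = (\<lambda>(U, W). (g ` U, g ` W)) ` occs A"
  proof
    show "occs (map_prod g g ` A) \<subseteq> (\<lambda>(U, W). (g ` U, g ` W)) ` occs A"
    proof
      fix p assume p: "p \<in> occs (map_prod g g ` A)"
      then obtain h where h: "emb (map_prod g g ` A) h" "p = (h ` VH, h ` WH)" by (auto simp: occs_def)
      have "h ` VH \<subseteq> Field (map_prod g g ` A)" using occs_Field[of "h ` VH" "h ` WH"] p h(2) by simp
      also have "\<dots> \<subseteq> g ` S" using A by (auto simp: Field_def)
      finally have hS: "h ` VH \<subseteq> g ` S" .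
      define f where "f = (\<lambda>x. inv_into S g (h x))"
      have gf: "g (f x) = h x" and fS: "f x \<in> S" if "x \<in> VH" for x
      proof -
        have "h x \<in> g ` S" using hS that by blast
        then show "g (f x) = h x" "f x \<in> S" unfolding f_def by (rule f_inv_into_f, rule inv_into_into)
      qed
      have "emb (map_prod g g ` A) (g \<circ> f)"
        using h(1) emb_cong[of "g \<circ> f" h] gf by simp
      moreover have "f ` VH \<subseteq> S" using fS by blast
      ultimately have "emb A f" using emb_relabel[OF assms] by blast
      then have "(f ` VH, f ` WH) \<in> occs A" unfolding occs_def by blast
      moreover have "g ` f ` VH = h ` VH" unfolding image_image using gf by (rule image_cong[OF refl])
      moreover have "g ` f ` WH = h ` WH" unfolding image_image using gf WH by (intro image_cong[OF refl]) blast
      ultimately show "p \<in> (\<lambda>(U, W). (g ` U, g ` W)) ` occs A"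
        unfolding h(2) by (intro image_eqI[of _ _ "(f ` VH, f ` WH)"]) simp_all
    qed
    show "(\<lambda>(U, W). (g ` U, g ` W)) ` occs A \<subseteq> occs (map_prod g g ` A)"
    proof
      fix p assume "p \<in> (\<lambda>(U, W). (g ` U, g ` W)) ` occs A"
      then obtain f where f: "emb A f" "p = (g ` f ` VH, g ` f ` WH)" by (auto simp: occs_def)
      then have "(f ` VH, f ` WH) \<in> occs A" unfolding occs_def by blast
      then have "emb (map_prod g g ` A) (g \<circ> f)" using emb_relabel[OF assms] f(1) sub by blast
      then show "p \<in> occs (map_prod g g ` A)"
        unfolding occs_def f(2) image_comp by blast
    qed
  qed
  have "inj_on (\<lambda>(U, W). (g ` U, g ` W)) (occs A)"
  proof (rule inj_onI)
    fix p q assume h: "p \<in> occs A" "q \<in> occs A" "(\<lambda>(U, W). (g ` U, g ` W)) p = (\<lambda>(U, W). (g ` U, g ` W)) q"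
    have S: "fst p \<subseteq> S" "snd p \<subseteq> S" "fst q \<subseteq> S" "snd q \<subseteq> S"
      using sub[of "fst p" "snd p"] sub[of "fst q" "snd q"] h(1,2)
        occs_card[of "fst p" "snd p" A] occs_card[of "fst q" "snd q" A] by auto
    have "g ` fst p = g ` fst q" "g ` snd p = g ` snd q" using h(3) by (auto simp: case_prod_beta)
    then show "p = q" using inj_on_image_eq_iff[OF g] S by (metis prod_eqI)
  qed
  then show "card (occs (map_prod g g ` A)) = card (occs A)" unfolding eq by (rule card_image)
qed

end

text \<open>A letter moves one edge, and the change is visible only from its child, its old parent
  and its new parent.\<close>

lemma code_graph_update_agree:
  assumes "k < length us"
  shows "agree_off {Suc k, min (us ! k) k, min b k} (code_graph us) (code_graph (us[k := b]))"
  using assms by (auto simp: agree_off_def code_graph_def nth_list_update split: if_splits)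

text \<open>A neighbour of \<open>v\<close> is its parent, a child chosen by a letter equal to
  \<open>v\<close>, or \<open>Suc v\<close>; the last one may arise from the capped letter at
  position \<open>v\<close>.\<close>

lemma code_graph_degree:
  "finite (code_graph us `` {v}) \<and> card (code_graph us `` {v}) \<le> count_list us v + 2"
proof -
  let ?N = "{i. i < length us \<and> us ! i = v}"
  let ?B = "{min (us ! (v - 1)) (v - 1), Suc v} \<union> Suc ` ?N"
  have sub: "code_graph us `` {v} \<subseteq> ?B"
    by (auto simp: code_graph_def min_def)
  have fin: "finite ?B" by simp
  have "card ?B \<le> card {min (us ! (v - 1)) (v - 1), Suc v} + card (Suc ` ?N)"
    by (rule card_Un_le)
  also have "\<dots> \<le> 2 + card ?N"
    by (intro add_mono card_image_le) (auto simp: card_insert_if)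
  also have "card ?N = count_list us v"
    by (simp add: count_list_eq_length_filter length_filter_conv_card eq_commute)
  finally have "card ?B \<le> count_list us v + 2" by simp
  then show ?thesis using card_mono[OF fin sub] finite_subset[OF sub fin] by linarith
qed

subsection \<open>Functions of independent letters\<close>

definition mean :: "'b set \<Rightarrow> ('b \<Rightarrow> real) \<Rightarrow> real" where
  "mean S f = (\<Sum>x \<in> S. f x) / real (card S)"

lemma mean_add: "mean S (\<lambda>x. f x + g x) = mean S f + mean S g"
  and mean_diff: "mean S (\<lambda>x. f x - g x) = mean S f - mean S g"
  and mean_cmult: "mean S (\<lambda>x. c * f x) = c * mean S f"
  and mean_sum: "mean S (\<lambda>x. \<Sum>k \<in> I. F k x) = (\<Sum>k \<in> I. mean S (F k))"
  by (auto simp: mean_def sum.distrib sum_subtractf add_divide_distrib diff_divide_distrib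
      sum_distrib_left[symmetric] sum_divide_distrib[symmetric] intro: sum.swap)

lemma mean_const: "finite S \<Longrightarrow> S \<noteq> {} \<Longrightarrow> mean S (\<lambda>_. c) = c"
  by (simp add: mean_def)

lemma mean_mono: "(\<And>x. x \<in> S \<Longrightarrow> f x \<le> g x) \<Longrightarrow> mean S f \<le> mean S g"
  by (simp add: mean_def divide_right_mono sum_mono)

lemma mean_nonneg: "(\<And>x. x \<in> S \<Longrightarrow> 0 \<le> f x) \<Longrightarrow> 0 \<le> mean S f"
  by (simp add: mean_def sum_nonneg)

lemma mean_cong: "(\<And>x. x \<in> S \<Longrightarrow> f x = g x) \<Longrightarrow> mean S f = mean S g"
  by (simp add: mean_def)

lemma abs_mean_le: "\<bar>mean S f\<bar> \<le> mean S (\<lambda>x. \<bar>f x\<bar>)"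
  by (simp add: mean_def divide_right_mono)

lemma mean_bij:
  "bij_betw \<tau> S T \<Longrightarrow> mean T f = mean S (\<lambda>x. f (\<tau> x))"
  by (simp add: mean_def sum.reindex_bij_betw bij_betw_same_card)

lemma mean_square_ge: 
  assumes "finite S" "S \<noteq> {}"
  shows "(mean S f)\<^sup>2 \<le> mean S (\<lambda>x. (f x)\<^sup>2)"
proof -
  let ?m = "mean S f"
  have "0 \<le> mean S (\<lambda>x. (f x - ?m)\<^sup>2)" by (rule mean_nonneg) simp
  also have "\<dots> = mean S (\<lambda>x. (f x)\<^sup>2 - ?m * (2 * f x) + ?m\<^sup>2)"
    by (rule mean_cong) (simp add: power2_diff algebra_simps)
  also have "\<dots> = mean S (\<lambda>x. (f x)\<^sup>2) - ?m\<^sup>2"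
    using assms by (simp add: mean_add mean_diff mean_cmult mean_const power2_eq_square)
  finally show ?thesis by simp
qed

lemma mean_abs_le_sqrt:
  assumes "finite S" "S \<noteq> {}"
  shows "mean S (\<lambda>x. \<bar>f x\<bar>) \<le> sqrt (mean S (\<lambda>x. (f x)\<^sup>2))"
  using mean_square_ge[OF assms, of "\<lambda>x. \<bar>f x\<bar>"] by (intro real_le_rsqrt) simp

lemma mult_le_half_squares: "x * y \<le> (1/2) * (x\<^sup>2 + y\<^sup>2)" for x y :: real
  using sum_squares_bound[of x y] by simp

definition variance_on :: "'b set \<Rightarrow> ('b \<Rightarrow> real) \<Rightarrow> real" where
  "variance_on S f = mean S (\<lambda>x. (f x - mean S f)\<^sup>2)"

section \<open>Words paired with an independent copy\<close>

definition hybrid :: "nat \<Rightarrow> ('b \<times> 'b) list \<Rightarrow> 'b list" where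
  "hybrid k xs = map snd (take k xs) @ map fst (drop k xs)"

definition resample :: "nat \<Rightarrow> ('b \<times> 'b) list \<Rightarrow> 'b list" where
  "resample k xs = (map fst xs)[k := snd (xs ! k)]"

lemma length_hybrid [simp]: "length (hybrid k xs) = length xs"
  and length_resample [simp]: "length (resample k xs) = length xs"
  by (auto simp: hybrid_def resample_def)

lemma nth_hybrid: "i < length xs \<Longrightarrow> hybrid k xs ! i = (if i < k then snd (xs ! i) else fst (xs ! i))"
  by (auto simp: hybrid_def nth_append)

lemma nth_resample: "i < length xs \<Longrightarrow> resample k xs ! i = (if i = k then snd (xs ! i) else fst (xs ! i))"
  by (auto simp: resample_def nth_list_update)

lemma words_nth: "us \<in> words K m \<Longrightarrow> i < m \<Longrightarrow> us ! i \<in> K"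
  by (auto simp: words_def)

lemma wordsI: "length us = m \<Longrightarrow> (\<And>i. i < m \<Longrightarrow> us ! i \<in> K) \<Longrightarrow> us \<in> words K m"
  by (auto simp: words_def in_set_conv_nth)

lemma length_words: "us \<in> words K m \<Longrightarrow> length us = m"
  by (simp add: words_def)

lemma words_ne: "K \<noteq> {} \<Longrightarrow> words K m \<noteq> {}"
proof -
  assume "K \<noteq> {}"
  then obtain x where "x \<in> K" by auto
  then have "replicate m x \<in> words K m" by (auto simp: words_def)
  then show ?thesis by auto
qed

text \<open>Exchanging the two values of a coordinate, or of an initial segment, is a bijection on
  pairs of words and so preserves the uniform law. The symmetry arguments below rest on these two
  bijections.\<close>

definition swap_at :: "nat \<Rightarrow> ('b \<times> 'b) list \<Rightarrow> ('b \<times> 'b) list" where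
  "swap_at k xs = xs[k := prod.swap (xs ! k)]"

definition swap_upto :: "nat \<Rightarrow> ('b \<times> 'b) list \<Rightarrow> ('b \<times> 'b) list" where
  "swap_upto k xs = map prod.swap (take k xs) @ drop k xs"

lemma nth_swap_upto: "i < length xs \<Longrightarrow> swap_upto k xs ! i = (if i < k then prod.swap (xs ! i) else xs ! i)"
  by (auto simp: swap_upto_def nth_append)

lemma length_swap_upto [simp]: "length (swap_upto k xs) = length xs"
  by (simp add: swap_upto_def)

lemma involution_bij:
  assumes "\<And>x. x \<in> S \<Longrightarrow> \<tau> x \<in> S" "\<And>x. x \<in> S \<Longrightarrow> \<tau> (\<tau> x) = x"
  shows "bij_betw \<tau> S S"
  by (rule bij_betw_byWitness[where f' = \<tau>]) (use assms in auto)

lemma bij_swap_at: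
  assumes "k < m" shows "bij_betw (swap_at k) (words (K \<times> K) m) (words (K \<times> K) m)"
proof (rule involution_bij)
  fix xs assume xs: "xs \<in> words (K \<times> K) m"
  show "swap_at k xs \<in> words (K \<times> K) m"
  proof (rule wordsI)
    fix i assume i: "i < m"
    show "swap_at k xs ! i \<in> K \<times> K"
      using words_nth[OF xs i] length_words[OF xs] i assms by (cases "xs ! i") (auto simp: swap_at_def nth_list_update)
  qed (use length_words[OF xs] in \<open>simp add: swap_at_def\<close>)
  show "swap_at k (swap_at k xs) = xs"
    using length_words[OF xs] assms by (simp add: swap_at_def)
qed

lemma bij_swap_upto: "bij_betw (swap_upto k) (words (K \<times> K) m) (words (K \<times> K) m)"
proof (rule involution_bij)
  fix xs assume xs: "xs \<in> words (K \<times> K) m"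
  show "swap_upto k xs \<in> words (K \<times> K) m"
  proof (rule wordsI)
    fix i assume i: "i < m"
    show "swap_upto k xs ! i \<in> K \<times> K"
      using words_nth[OF xs i] length_words[OF xs] i by (cases "xs ! i") (auto simp: nth_swap_upto)
  qed (use length_words[OF xs] in simp)
  show "swap_upto k (swap_upto k xs) = xs"
    by (rule nth_equalityI) (auto simp: nth_swap_upto)
qed

lemma hybrid_swap_at:
  assumes "k < length xs"
  shows "hybrid k (swap_at k xs) = hybrid (Suc k) xs" "hybrid (Suc k) (swap_at k xs) = hybrid k xs"
    "map fst (swap_at k xs) = resample k xs" "resample k (swap_at k xs) = map fst xs"
  by (rule nth_equalityI; use assms in \<open>auto simp: nth_hybrid nth_resample swap_at_def nth_list_update less_Suc_eq\<close>)+

lemma hybrid_swap_upto: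
  "map fst (swap_upto k xs) = hybrid k xs"
  "k < length xs \<Longrightarrow> resample k (swap_upto k xs) = hybrid (Suc k) xs"
  by (rule nth_equalityI; auto simp: nth_hybrid nth_resample nth_swap_upto less_Suc_eq)+

lemma hybrid_0: "hybrid 0 xs = map fst xs"
  and hybrid_length: "hybrid (length xs) xs = map snd xs"
  by (auto simp: hybrid_def)

lemma bij_unzip:
  "bij_betw (\<lambda>xs. (map fst xs, map snd xs)) (words (K \<times> K) m) (words K m \<times> words K m)"
proof (rule bij_betw_byWitness[where f' = "\<lambda>(us, vs). zip us vs"])
  show "\<forall>xs \<in> words (K \<times> K) m. (\<lambda>(us, vs). zip us vs) (map fst xs, map snd xs) = xs"
    by (simp add: zip_map_fst_snd)
  show "(\<lambda>xs. (map fst xs, map snd xs)) ` words (K \<times> K) m \<subseteq> words K m \<times> words K m"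
    by (fastforce simp: words_def)
  show "(\<lambda>(us, vs). zip us vs) ` (words K m \<times> words K m) \<subseteq> words (K \<times> K) m"
    by (auto simp: words_def dest: set_zip_leftD set_zip_rightD)
qed (auto simp: words_def)

locale product_space =
  fixes K :: "'b set" and m :: nat
  assumes K: "finite K" "K \<noteq> {}"
begin

abbreviation "\<Omega> \<equiv> words K m"
abbreviation "\<Lambda> \<equiv> words (K \<times> K) m"

lemma fin: "finite \<Omega>" "finite \<Lambda>" "\<Omega> \<noteq> {}" "\<Lambda> \<noteq> {}"
  using K by (auto intro!: finite_words words_ne)

lemma len [simp]: "xs \<in> \<Lambda> \<Longrightarrow> length xs = m"
  by (rule length_words)

lemma mean_pair: "mean \<Lambda> (\<lambda>xs. f (map fst xs) * g (map snd xs)) = mean \<Omega> f * mean \<Omega> g"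
proof -
  have "mean \<Lambda> (\<lambda>xs. f (map fst xs) * g (map snd xs)) = mean (\<Omega> \<times> \<Omega>) (\<lambda>(us, vs). f us * g vs)"
    using mean_bij[OF bij_unzip[of K m], where f = "\<lambda>(us, vs). f us * g vs"] by simp
  also have "\<dots> = mean \<Omega> f * mean \<Omega> g"
    unfolding mean_def sum.cartesian_product[symmetric] sum_product[symmetric] by (simp add: card_cartesian_product)
  finally show ?thesis .
qed

lemma mean_fst: "mean \<Lambda> (\<lambda>xs. f (map fst xs)) = mean \<Omega> f"
  using mean_pair[of f "\<lambda>_. 1"] fin by (simp add: mean_const)

lemma mean_snd: "mean \<Lambda> (\<lambda>xs. f (map snd xs)) = mean \<Omega> f"
  using mean_pair[of "\<lambda>_. 1" f] fin by (simp add: mean_const)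

text \<open>
  Telescoping over the hybrids turns the covariance into a sum of increments; each increment is
  antisymmetric under exchanging the two values of its coordinate.
\<close>

lemma covariance_identity:
  "mean \<Omega> (\<lambda>u. F u * g u) - mean \<Omega> F * mean \<Omega> g
    = (\<Sum>k<m. mean \<Lambda> (\<lambda>xs. (F (hybrid k xs) - F (hybrid (Suc k) xs)) * (g (map fst xs) - g (resample k xs)))) / 2"
proof -
  let ?D = "\<lambda>k xs. F (hybrid k xs) - F (hybrid (Suc k) xs)"
  have tel: "(\<Sum>k<m. ?D k xs) = F (map fst xs) - F (map snd xs)" if "xs \<in> \<Lambda>" for xs
    using that hybrid_length[of xs] sum_lessThan_telescope'[of "\<lambda>k. F (hybrid k xs)" m]
    by (simp add: hybrid_0)
  have "mean \<Omega> (\<lambda>u. F u * g u) - mean \<Omega> F * mean \<Omega> g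
      = mean \<Lambda> (\<lambda>xs. F (map fst xs) * g (map fst xs)) - mean \<Lambda> (\<lambda>xs. g (map fst xs) * F (map snd xs))"
    by (simp add: mean_pair mean_fst[of "\<lambda>u. F u * g u"])
  also have "\<dots> = mean \<Lambda> (\<lambda>xs. (F (map fst xs) - F (map snd xs)) * g (map fst xs))"
    unfolding mean_diff[symmetric] by (simp add: algebra_simps)
  also have "\<dots> = mean \<Lambda> (\<lambda>xs. \<Sum>k<m. ?D k xs * g (map fst xs))"
    by (rule mean_cong) (simp add: tel sum_distrib_right[symmetric])
  also have "\<dots> = (\<Sum>k<m. mean \<Lambda> (\<lambda>xs. ?D k xs * g (map fst xs)))" by (rule mean_sum)
  also have "\<dots> = (\<Sum>k<m. mean \<Lambda> (\<lambda>xs. ?D k xs * (g (map fst xs) - g (resample k xs))) / 2)"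
  proof (rule sum.cong[OF refl])
    fix k assume "k \<in> {..<m}"
    then have k: "k < m" by simp
    have "mean \<Lambda> (\<lambda>xs. ?D k xs * g (map fst xs)) = mean \<Lambda> (\<lambda>xs. ?D k (swap_at k xs) * g (map fst (swap_at k xs)))"
      by (rule mean_bij[OF bij_swap_at[OF k]])
    also have "\<dots> = mean \<Lambda> (\<lambda>xs. (-1) * (?D k xs * g (resample k xs)))"
      by (rule mean_cong) (use k in \<open>simp add: hybrid_swap_at algebra_simps\<close>)
    also have "\<dots> = - mean \<Lambda> (\<lambda>xs. ?D k xs * g (resample k xs))" unfolding mean_cmult by simp
    finally show "mean \<Lambda> (\<lambda>xs. ?D k xs * g (map fst xs)) = mean \<Lambda> (\<lambda>xs. ?D k xs * (g (map fst xs) - g (resample k xs))) / 2"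
      by (simp add: right_diff_distrib mean_diff)
  qed
  finally show ?thesis by (simp add: sum_divide_distrib)
qed

lemma variance_on_eq: "variance_on \<Omega> F = mean \<Omega> (\<lambda>u. F u * F u) - mean \<Omega> F * mean \<Omega> F"
proof -
  let ?m = "mean \<Omega> F"
  have "variance_on \<Omega> F = mean \<Omega> (\<lambda>u. (F u * F u - 2 * ?m * F u) + ?m * ?m)"
    unfolding variance_on_def by (rule mean_cong) (simp add: power2_eq_square algebra_simps)
  also have "\<dots> = mean \<Omega> (\<lambda>u. F u * F u) - ?m * ?m"
    unfolding mean_add mean_diff mean_cmult using fin by (simp add: mean_const)
  finally show ?thesis .
qed

text \<open>The covariance identity with \<open>g = F\<close> has products of two different
  increments. The inequality \<open>mult_le_half_squares\<close> separates them, and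
  \<open>swap_upto\<close> carries a resampling increment into a hybrid increment, so both squares
  have the same mean.\<close>

lemma efron_stein:
  "variance_on \<Omega> F \<le> (\<Sum>k<m. mean \<Lambda> (\<lambda>xs. (F (map fst xs) - F (resample k xs))\<^sup>2)) / 2"
proof -
  have "variance_on \<Omega> F = (\<Sum>k<m. mean \<Lambda> (\<lambda>xs. (F (hybrid k xs) - F (hybrid (Suc k) xs)) * (F (map fst xs) - F (resample k xs)))) / 2"
    unfolding variance_on_eq by (rule covariance_identity)
  also have "\<dots> \<le> (\<Sum>k<m. mean \<Lambda> (\<lambda>xs. (F (map fst xs) - F (resample k xs))\<^sup>2)) / 2"
  proof (intro divide_right_mono sum_mono)
    fix k assume "k \<in> {..<m}"
    then have k: "k < m" by simp
    let ?A = "\<lambda>xs. F (hybrid k xs) - F (hybrid (Suc k) xs)" and ?B = "\<lambda>xs. F (map fst xs) - F (resample k xs)"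
    have "mean \<Lambda> (\<lambda>xs. (?B xs)\<^sup>2) = mean \<Lambda> (\<lambda>xs. (?B (swap_upto k xs))\<^sup>2)"
      by (rule mean_bij[OF bij_swap_upto])
    also have "\<dots> = mean \<Lambda> (\<lambda>xs. (?A xs)\<^sup>2)"
      by (rule mean_cong) (use k in \<open>simp add: hybrid_swap_upto\<close>)
    finally have eq: "mean \<Lambda> (\<lambda>xs. (?A xs)\<^sup>2) = mean \<Lambda> (\<lambda>xs. (?B xs)\<^sup>2)" by simp
    have "mean \<Lambda> (\<lambda>xs. ?A xs * ?B xs) \<le> mean \<Lambda> (\<lambda>xs. (1/2) * ((?A xs)\<^sup>2 + (?B xs)\<^sup>2))"
    proof (rule mean_mono)
      fix xs
      show "?A xs * ?B xs \<le> (1/2) * ((?A xs)\<^sup>2 + (?B xs)\<^sup>2)"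
        by (rule mult_le_half_squares)
    qed
    also have "\<dots> = (1/2) * (mean \<Lambda> (\<lambda>xs. (?A xs)\<^sup>2) + mean \<Lambda> (\<lambda>xs. (?B xs)\<^sup>2))"
      by (simp only: mean_cmult mean_add)
    also have "\<dots> = mean \<Lambda> (\<lambda>xs. (?B xs)\<^sup>2)" unfolding eq by simp
    finally show "mean \<Lambda> (\<lambda>xs. ?A xs * ?B xs) \<le> mean \<Lambda> (\<lambda>xs. (?B xs)\<^sup>2)" .
  qed simp
  finally show ?thesis .
qed

text \<open>The right-hand side of \<open>covariance_identity\<close> for \<open>g = F\<close>,
  before means are taken. In the Stein argument it stands in for the variance.\<close>

definition T :: "('b list \<Rightarrow> real) \<Rightarrow> ('b \<times> 'b) list \<Rightarrow> real" where
  "T F xs = (\<Sum>k<m. (F (hybrid k xs) - F (hybrid (Suc k) xs)) * (F (map fst xs) - F (resample k xs))) / 2"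

lemma mean_T: "mean \<Lambda> (T F) = variance_on \<Omega> F"
proof -
  have "mean \<Lambda> (T F) = mean \<Lambda> (\<lambda>xs. (1/2) * (\<Sum>k<m. (F (hybrid k xs) - F (hybrid (Suc k) xs)) * (F (map fst xs) - F (resample k xs))))"
    unfolding T_def by simp
  then show ?thesis
    unfolding variance_on_eq covariance_identity mean_cmult mean_sum by simp
qed

text \<open>\<open>covariance_identity\<close> with the Stein solution in place of \<open>g\<close>
  turns the mean of \<open>w * f w\<close> into a sum of products of increments. Replacing the
  increments of \<open>f\<close> by the derivative times increments of \<open>F\<close> produces
  \<open>T F\<close>, whose fluctuation gives the first error term; the Taylor remainders,
  multiplied by one more increment and thus cubic, give the second.\<close>

lemma stein_bound:
  fixes F :: "'b list \<Rightarrow> real"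
  defines "\<mu> \<equiv> mean \<Omega> F" and "\<sigma> \<equiv> sqrt (variance_on \<Omega> F)"
  assumes h: "stein_test h" and lip: "\<And>x y. \<bar>h x - h y\<bar> \<le> c * \<bar>x - y\<bar>" and pos: "variance_on \<Omega> F > 0"
    and B1: "\<And>xs k. xs \<in> \<Lambda> \<Longrightarrow> k < m \<Longrightarrow> \<bar>F (hybrid k xs) - F (hybrid (Suc k) xs)\<bar> \<le> B xs"
    and B2: "\<And>xs k. xs \<in> \<Lambda> \<Longrightarrow> k < m \<Longrightarrow> \<bar>F (map fst xs) - F (resample k xs)\<bar> \<le> B xs"
  shows "\<bar>mean \<Omega> (\<lambda>u. h ((F u - \<mu>) / \<sigma>)) - gauss_mean h\<bar>
    \<le> 2 / \<sigma>\<^sup>2 * sqrt (variance_on \<Lambda> (T F))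
      + real m / (2 * \<sigma> ^ 3) * mean \<Lambda> (\<lambda>xs. B xs ^ 3 * (2 * \<bar>(F (map fst xs) - \<mu>) / \<sigma>\<bar> + 5 + c))"
proof -
  interpret stein_test h by fact
  have \<sigma>: "\<sigma> > 0" "\<sigma>\<^sup>2 = variance_on \<Omega> F" using pos by (auto simp: \<sigma>_def)
  define w where "w = (\<lambda>u. (F u - \<mu>) / \<sigma>)"
  define f where "f = stein_sol h"
  define f' where "f' = (\<lambda>x. x * f x + h x - gauss_mean h)"
  define A where "A = (\<lambda>k xs. F (hybrid k xs) - F (hybrid (Suc k) xs))"
  define D where "D = (\<lambda>k xs. F (map fst xs) - F (resample k xs))"
  define R where "R = (\<lambda>k xs. f (w (map fst xs)) - f (w (resample k xs)) - D k xs / \<sigma> * f' (w (map fst xs)))"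
  have B0: "0 \<le> B xs" if "xs \<in> \<Lambda>" "k < m" for xs k
    using order_trans[OF abs_ge_zero B1[OF that]] .
  have R: "\<bar>R k xs\<bar> \<le> (B xs / \<sigma>)\<^sup>2 * (2 * \<bar>w (map fst xs)\<bar> + 5 + c)" if xs: "xs \<in> \<Lambda>" "k < m" for k xs
  proof -
    let ?w = "w (map fst xs)" and ?t = "- (D k xs / \<sigma>)"
    have "w (resample k xs) = ?w + ?t" by (simp add: w_def D_def diff_divide_distrib)
    then have "\<bar>R k xs\<bar> = \<bar>f (?w + ?t) - f ?w - ?t * f' ?w\<bar>"
      unfolding R_def by (simp add: abs_minus_commute)
    also have "\<dots> \<le> ?t\<^sup>2 * (2 * \<bar>?w\<bar> + 5 + c)"
      unfolding f_def f'_def using stein_sol_taylor[OF lip, of ?w ?t] by simp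
    also have "\<dots> \<le> (B xs / \<sigma>)\<^sup>2 * (2 * \<bar>?w\<bar> + 5 + c)"
    proof (rule mult_right_mono)
      have "\<bar>D k xs\<bar> \<le> B xs" unfolding D_def by (rule B2[OF xs])
      then show "?t\<^sup>2 \<le> (B xs / \<sigma>)\<^sup>2"
        using \<sigma>(1) by (intro power2_le_iff_abs_le[THEN iffD2]) (auto simp: divide_right_mono B0[OF xs])
      have "0 \<le> c * \<bar>1 - 0\<bar>" by (rule order_trans[OF abs_ge_zero lip])
      then show "0 \<le> 2 * \<bar>?w\<bar> + 5 + c" by simp
    qed
    finally show ?thesis .
  qed
  have AR: "\<bar>A k xs * R k xs\<bar> \<le> B xs ^ 3 / \<sigma>\<^sup>2 * (2 * \<bar>w (map fst xs)\<bar> + 5 + c)" if xs: "xs \<in> \<Lambda>" "k < m" for k xs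
  proof -
    have "\<bar>A k xs * R k xs\<bar> \<le> B xs * ((B xs / \<sigma>)\<^sup>2 * (2 * \<bar>w (map fst xs)\<bar> + 5 + c))"
      unfolding abs_mult by (rule mult_mono[OF _ R[OF xs]]) (use B1[OF xs] B0[OF xs] in \<open>auto simp: A_def\<close>)
    then show ?thesis by (simp add: power_divide power3_eq_cube power2_eq_square mult.assoc)
  qed
  have W: "mean \<Omega> (\<lambda>u. w u * f (w u)) = (\<Sum>k<m. mean \<Lambda> (\<lambda>xs. A k xs * (f (w (map fst xs)) - f (w (resample k xs))))) / 2 / \<sigma>"
  proof -
    have "mean \<Omega> (\<lambda>u. w u * f (w u)) = mean \<Omega> (\<lambda>u. (1/\<sigma>) * (F u * f (w u) - \<mu> * f (w u)))"
      by (rule mean_cong) (simp add: w_def left_diff_distrib diff_divide_distrib)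
    also have "\<dots> = (1/\<sigma>) * (mean \<Omega> (\<lambda>u. F u * f (w u)) - mean \<Omega> F * mean \<Omega> (\<lambda>u. f (w u)))"
      unfolding mean_cmult mean_diff \<mu>_def ..
    finally show ?thesis unfolding covariance_identity A_def by simp
  qed
  have "mean \<Omega> (\<lambda>u. h (w u)) - gauss_mean h = mean \<Omega> (\<lambda>u. f' (w u) - w u * f (w u))"
    using fin by (simp add: f'_def mean_diff mean_add mean_const)
  also have "\<dots> = mean \<Lambda> (\<lambda>xs. f' (w (map fst xs))) - mean \<Omega> (\<lambda>u. w u * f (w u))"
    unfolding mean_diff mean_fst[of "\<lambda>u. f' (w u)"] ..
  \<comment> \<open>The linear part of the increment of \<open>f\<close> sums to a multiple of
    \<open>T F\<close>, the factor 2 compensating the half in the definition of \<open>T\<close>;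
    what is left are the remainders \<open>R\<close>.\<close>
  also have "mean \<Omega> (\<lambda>u. w u * f (w u))
      = mean \<Lambda> (\<lambda>xs. T F xs / \<sigma>\<^sup>2 * f' (w (map fst xs))) + mean \<Lambda> (\<lambda>xs. \<Sum>k<m. A k xs * R k xs) / (2 * \<sigma>)"
  proof -
    have "(\<Sum>k<m. A k xs * (f (w (map fst xs)) - f (w (resample k xs)))) =
        2 * (T F xs / \<sigma> * f' (w (map fst xs))) + (\<Sum>k<m. A k xs * R k xs)" for xs
    proof -
      have "(\<Sum>k<m. A k xs * (f (w (map fst xs)) - f (w (resample k xs))))
          = (\<Sum>k<m. A k xs * D k xs * (f' (w (map fst xs)) / \<sigma>) + A k xs * R k xs)"
        by (rule sum.cong[OF refl]) (simp add: R_def algebra_simps)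
      also have "\<dots> = 2 * T F xs * (f' (w (map fst xs)) / \<sigma>) + (\<Sum>k<m. A k xs * R k xs)"
        unfolding sum.distrib sum_distrib_right[symmetric] by (simp add: T_def A_def D_def)
      finally show ?thesis by simp
    qed
    then have "(\<Sum>k<m. mean \<Lambda> (\<lambda>xs. A k xs * (f (w (map fst xs)) - f (w (resample k xs)))))
        = 2 * mean \<Lambda> (\<lambda>xs. T F xs / \<sigma> * f' (w (map fst xs))) + mean \<Lambda> (\<lambda>xs. \<Sum>k<m. A k xs * R k xs)"
      unfolding mean_sum[symmetric] by (simp only: mean_add mean_cmult)
    moreover have "mean \<Lambda> (\<lambda>xs. T F xs / \<sigma>\<^sup>2 * f' (w (map fst xs))) = (1 / \<sigma>) * mean \<Lambda> (\<lambda>xs. T F xs / \<sigma> * f' (w (map fst xs)))"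
      unfolding mean_cmult[symmetric] by (simp add: power2_eq_square)
    ultimately show ?thesis unfolding W using \<sigma>(1) by (simp add: field_simps)
  qed
  also have "mean \<Lambda> (\<lambda>xs. f' (w (map fst xs))) - (mean \<Lambda> (\<lambda>xs. T F xs / \<sigma>\<^sup>2 * f' (w (map fst xs))) + mean \<Lambda> (\<lambda>xs. \<Sum>k<m. A k xs * R k xs) / (2 * \<sigma>))
      = mean \<Lambda> (\<lambda>xs. f' (w (map fst xs)) - T F xs / \<sigma>\<^sup>2 * f' (w (map fst xs))) - mean \<Lambda> (\<lambda>xs. \<Sum>k<m. A k xs * R k xs) / (2 * \<sigma>)"
    unfolding mean_diff by simp
  finally have eq: "mean \<Omega> (\<lambda>u. h (w u)) - gauss_mean h
      = mean \<Lambda> (\<lambda>xs. f' (w (map fst xs)) - T F xs / \<sigma>\<^sup>2 * f' (w (map fst xs)))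
        - mean \<Lambda> (\<lambda>xs. \<Sum>k<m. A k xs * R k xs) / (2 * \<sigma>)" .
  have tri: "\<bar>p - q / (2 * \<sigma>)\<bar> \<le> \<bar>p\<bar> + \<bar>q\<bar> / (2 * \<sigma>)" for p q
    using abs_triangle_ineq4[of p "q / (2 * \<sigma>)"] \<sigma>(1) by (simp add: abs_divide)
  have "\<bar>mean \<Omega> (\<lambda>u. h (w u)) - gauss_mean h\<bar>
      \<le> \<bar>mean \<Lambda> (\<lambda>xs. f' (w (map fst xs)) - T F xs / \<sigma>\<^sup>2 * f' (w (map fst xs)))\<bar>
        + \<bar>mean \<Lambda> (\<lambda>xs. \<Sum>k<m. A k xs * R k xs)\<bar> / (2 * \<sigma>)"
    unfolding eq by (rule tri)
  also have "\<dots> \<le> 2 / \<sigma>\<^sup>2 * sqrt (variance_on \<Lambda> (T F))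
      + real m / (2 * \<sigma> ^ 3) * mean \<Lambda> (\<lambda>xs. B xs ^ 3 * (2 * \<bar>w (map fst xs)\<bar> + 5 + c))"
  proof (rule add_mono)
    have "\<bar>mean \<Lambda> (\<lambda>xs. f' (w (map fst xs)) - T F xs / \<sigma>\<^sup>2 * f' (w (map fst xs)))\<bar>
        \<le> mean \<Lambda> (\<lambda>xs. \<bar>f' (w (map fst xs)) - T F xs / \<sigma>\<^sup>2 * f' (w (map fst xs))\<bar>)"
      by (rule abs_mean_le)
    also have "\<dots> \<le> mean \<Lambda> (\<lambda>xs. 2 / \<sigma>\<^sup>2 * \<bar>T F xs - variance_on \<Omega> F\<bar>)"
    proof (rule mean_mono)
      fix xs
      have "\<bar>f' (w (map fst xs)) - T F xs / \<sigma>\<^sup>2 * f' (w (map fst xs))\<bar> = \<bar>f' (w (map fst xs))\<bar> * \<bar>(\<sigma>\<^sup>2 - T F xs) / \<sigma>\<^sup>2\<bar>"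
        unfolding abs_mult[symmetric] using \<sigma>(1) by (simp add: field_simps)
      also have "\<dots> \<le> 2 * \<bar>(\<sigma>\<^sup>2 - T F xs) / \<sigma>\<^sup>2\<bar>"
        using stein_sol_deriv_bound[of "w (map fst xs)"] by (intro mult_right_mono) (auto simp: f'_def f_def)
      also have "\<dots> = 2 / \<sigma>\<^sup>2 * \<bar>T F xs - variance_on \<Omega> F\<bar>"
        using \<sigma> pos by (simp add: abs_minus_commute)
      finally show "\<bar>f' (w (map fst xs)) - T F xs / \<sigma>\<^sup>2 * f' (w (map fst xs))\<bar> \<le> 2 / \<sigma>\<^sup>2 * \<bar>T F xs - variance_on \<Omega> F\<bar>" .
    qed
    also have "\<dots> \<le> 2 / \<sigma>\<^sup>2 * sqrt (variance_on \<Lambda> (T F))"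
      unfolding mean_cmult using mean_abs_le_sqrt[OF fin(2,4), of "\<lambda>xs. T F xs - variance_on \<Omega> F"]
      by (intro mult_left_mono) (auto simp: variance_on_def[of \<Lambda>] mean_T)
    finally show "\<bar>mean \<Lambda> (\<lambda>xs. f' (w (map fst xs)) - T F xs / \<sigma>\<^sup>2 * f' (w (map fst xs)))\<bar> \<le> 2 / \<sigma>\<^sup>2 * sqrt (variance_on \<Lambda> (T F))" .
    let ?Q = "\<lambda>xs. B xs ^ 3 * (2 * \<bar>w (map fst xs)\<bar> + 5 + c)"
    have "\<bar>mean \<Lambda> (\<lambda>xs. \<Sum>k<m. A k xs * R k xs)\<bar> \<le> mean \<Lambda> (\<lambda>xs. \<bar>\<Sum>k<m. A k xs * R k xs\<bar>)"
      by (rule abs_mean_le)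
    also have "\<dots> \<le> mean \<Lambda> (\<lambda>xs. (real m / \<sigma>\<^sup>2) * ?Q xs)"
    proof (rule mean_mono)
      fix xs assume xs: "xs \<in> \<Lambda>"
      have "\<bar>\<Sum>k<m. A k xs * R k xs\<bar> \<le> (\<Sum>k<m. \<bar>A k xs * R k xs\<bar>)" by (rule sum_abs)
      also have "\<dots> \<le> (\<Sum>k<m. B xs ^ 3 / \<sigma>\<^sup>2 * (2 * \<bar>w (map fst xs)\<bar> + 5 + c))"
        using AR[OF xs] by (intro sum_mono) simp
      also have "\<dots> = (real m / \<sigma>\<^sup>2) * ?Q xs" by simp
      finally show "\<bar>\<Sum>k<m. A k xs * R k xs\<bar> \<le> (real m / \<sigma>\<^sup>2) * ?Q xs" .
    qed
    also have "\<dots> = (real m / \<sigma>\<^sup>2) * mean \<Lambda> ?Q" by (rule mean_cmult)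
    finally have "\<bar>mean \<Lambda> (\<lambda>xs. \<Sum>k<m. A k xs * R k xs)\<bar> / (2 * \<sigma>) \<le> (real m / \<sigma>\<^sup>2) * mean \<Lambda> ?Q / (2 * \<sigma>)"
      using \<sigma>(1) by (intro divide_right_mono) auto
    also have "\<dots> = real m / (2 * \<sigma> ^ 3) * mean \<Lambda> ?Q"
      by (simp add: power3_eq_cube power2_eq_square)
    finally show "\<bar>mean \<Lambda> (\<lambda>xs. \<Sum>k<m. A k xs * R k xs)\<bar> / (2 * \<sigma>) \<le> real m / (2 * \<sigma> ^ 3) * mean \<Lambda> ?Q" .
  qed
  finally show ?thesis unfolding w_def .
qed

end

subsection \<open>Increments of the pattern count\<close>

lemma count_list_update: "count_list (us[j := a]) v \<le> Suc (count_list us v)"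
proof (induction us arbitrary: j)
  case (Cons u us)
  show ?case using Cons[of "j - 1"] by (cases j) auto
qed simp

definition max_mult :: "'b list \<Rightarrow> nat" where
  "max_mult us = Max (insert 0 (count_list us ` set us))"

lemma count_list_le_max_mult: "count_list us v \<le> max_mult us"
proof (cases "v \<in> set us")
  case True
  then show ?thesis unfolding max_mult_def by (intro Max_ge) auto
qed (simp add: count_list_0_iff)

text \<open>Contains the coded trees of all hybrids and resamplings of the pair, so that one degree
  bound and one notion of distance serve for all of them.\<close>

definition pair_graph_of :: "(nat \<times> nat) list \<Rightarrow> nat rel" where
  "pair_graph_of xs = code_graph (map fst xs) \<union> code_graph (map snd xs)"

text \<open>One more than the degree bound of \<open>near_graph_degree\<close>: each of the two
  words contributes at most \<open>2 * max_mult us + 5\<close>, its trees before and after an update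
  taken together.\<close>

definition crowding :: "(nat \<times> nat) list \<Rightarrow> nat" where
  "crowding xs = 2 * (max_mult (map fst xs) + max_mult (map snd xs)) + 11"

lemma code_graph_edge: "i < length us \<Longrightarrow> edge (Suc i) (min (us ! i) i) \<subseteq> code_graph us"
  by (auto simp: code_graph_def)

lemma code_graph_sub_pair:
  assumes "length w = length xs" "\<And>i. i < length xs \<Longrightarrow> w ! i = fst (xs ! i) \<or> w ! i = snd (xs ! i)"
  shows "code_graph w \<subseteq> pair_graph_of xs"
proof
  fix p assume "p \<in> code_graph w"
  then obtain i where i: "i < length w" "p \<in> edge (Suc i) (min (w ! i) i)" by (auto simp: code_graph_def)
  then have l: "i < length xs" using assms(1) by simp
  consider "w ! i = map fst xs ! i" | "w ! i = map snd xs ! i" using assms(2)[OF l] l by auto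
  then show "p \<in> pair_graph_of xs"
  proof cases
    case 1
    then show ?thesis using code_graph_edge[of i "map fst xs"] i l unfolding pair_graph_of_def by auto
  next
    case 2
    then show ?thesis using code_graph_edge[of i "map snd xs"] i l unfolding pair_graph_of_def by auto
  qed
qed

lemma hybrid_sub_pair: "code_graph (hybrid k xs) \<subseteq> pair_graph_of xs"
  by (rule code_graph_sub_pair) (auto simp: nth_hybrid)

lemma resample_sub_pair: "code_graph (resample k xs) \<subseteq> pair_graph_of xs"
  by (rule code_graph_sub_pair) (auto simp: nth_resample)

lemma fst_sub_pair: "code_graph (map fst xs) \<subseteq> pair_graph_of xs"
  by (simp add: pair_graph_of_def)

text \<open>Covers the trees before and after the pair at position \<open>j\<close> is replaced by
  \<open>y\<close>; far from \<open>Suc j\<close> in this graph the replacement is not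
  noticed.\<close>

definition near_graph :: "(nat \<times> nat) list \<Rightarrow> nat \<Rightarrow> nat \<times> nat \<Rightarrow> nat rel" where
  "near_graph xs j y = pair_graph_of xs \<union> pair_graph_of (xs[j := y])"

lemma near_graph_degree:
  "finite (near_graph xs j y `` {v})" "card (near_graph xs j y `` {v}) \<le> crowding xs - 1"
proof -
  let ?G = "\<lambda>us. code_graph us `` {v}"
  let ?f = "map fst xs" and ?s = "map snd xs"
  have eq: "near_graph xs j y `` {v} = (?G ?f \<union> ?G ?s) \<union> (?G (?f[j := fst y]) \<union> ?G (?s[j := snd y]))"
    by (simp add: near_graph_def pair_graph_of_def Un_Image map_update)
  have d: "finite (?G us)" "card (?G us) \<le> count_list us v + 2" for us
    using code_graph_degree[of us v] by auto
  show "finite (near_graph xs j y `` {v})" unfolding eq using d(1) by simp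
  have pair: "card (?G us) + card (?G (us[j := a])) \<le> 2 * max_mult us + 5" for us a
  proof -
    have "card (?G us) \<le> max_mult us + 2"
      using d(2)[of us] count_list_le_max_mult[of us v] by (rule order_trans[OF _ add_right_mono])
    moreover have "card (?G (us[j := a])) \<le> Suc (max_mult us) + 2"
      using d(2)[of "us[j := a]"] count_list_update[of us j a v] count_list_le_max_mult[of us v]
      by (meson add_right_mono le_trans Suc_le_mono)
    ultimately show ?thesis by linarith
  qed
  have "card (near_graph xs j y `` {v})
      \<le> (card (?G ?f) + card (?G ?s)) + (card (?G (?f[j := fst y])) + card (?G (?s[j := snd y])))"
    unfolding eq by (intro order_trans[OF card_Un_le] add_mono card_Un_le)
  also have "\<dots> = (card (?G ?f) + card (?G (?f[j := fst y]))) + (card (?G ?s) + card (?G (?s[j := snd y])))"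
    by (simp only: ac_simps)
  also have "\<dots> \<le> (2 * max_mult ?f + 5) + (2 * max_mult ?s + 5)"
    by (rule add_mono[OF pair pair])
  finally show "card (near_graph xs j y `` {v}) \<le> crowding xs - 1" by (simp add: crowding_def)
qed

lemma crowding_pos: "crowding xs \<ge> 11"
  by (simp add: crowding_def)

lemma pair_sub_near: "pair_graph_of xs \<subseteq> near_graph xs j y" "pair_graph_of (xs[j := y]) \<subseteq> near_graph xs j y"
  by (auto simp: near_graph_def)

lemma finite_code_graph: "finite (code_graph us)"
  by (rule finite_subset[OF code_graph_subset]) simp

context tree_pattern
begin

definition F :: "nat list \<Rightarrow> real" where
  "F us = real (card (occs (code_graph us)))"

definition expo :: nat where "expo = (radius + 1) * card VH"

text \<open>At most three vertices are affected and \<open>z\<close> is at least 3, so the three is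
  absorbed into one more power of \<open>z\<close>; this is the origin of \<open>radius + 1\<close>
  in \<open>expo\<close>.\<close>

lemma F_update_bound:
  assumes k: "k < length us" and sub: "code_graph us \<subseteq> \<Gamma>" "code_graph (us[k := a]) \<subseteq> \<Gamma>"
    and deg: "\<And>v. finite (\<Gamma> `` {v})" "\<And>v. card (\<Gamma> `` {v}) \<le> z - 1" and z: "z \<ge> 3"
  shows "\<bar>F us - F (us[k := a])\<bar> \<le> real (z ^ expo)"
proof -
  let ?X = "{Suc k, min (us ! k) k, min a k}"
  have "\<bar>F us - F (us[k := a])\<bar> \<le> real ((card ?X * (z - 1 + 1) ^ radius) ^ card VH)"
    unfolding F_def
    by (rule abs_diff_card_occs[OF finite_code_graph finite_code_graph code_graph_update_agree[OF k] sub deg]) simp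
  also have "(card ?X * (z - 1 + 1) ^ radius) ^ card VH \<le> z ^ expo"
  proof -
    have "card ?X \<le> 3" by (simp add: card_insert_if)
    then have "card ?X * (z - 1 + 1) ^ radius \<le> z * z ^ radius" using z by (intro mult_mono) auto
    then have "(card ?X * (z - 1 + 1) ^ radius) ^ card VH \<le> (z ^ Suc radius) ^ card VH"
      by (intro power_mono) simp_all
    then show ?thesis by (simp only: expo_def power_mult[symmetric] Suc_eq_plus1)
  qed
  finally show ?thesis by simp
qed

text \<open>The two extra steps in \<open>radius + 2\<close> lead from \<open>Suc j\<close> to any
  vertex affected by letter \<open>j\<close>, and from any vertex affected by letter
  \<open>k\<close> to \<open>Suc k\<close>.\<close>

lemma F_second_diff:
  assumes k: "k < length w" and j: "j < length w" and kj: "k \<noteq> j"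
    and sub: "code_graph w \<subseteq> \<Gamma>" "code_graph (w[k := a]) \<subseteq> \<Gamma>"
      "code_graph (w[j := b]) \<subseteq> \<Gamma>" "code_graph (w[j := b, k := a]) \<subseteq> \<Gamma>"
    and far: "Suc k \<notin> rball \<Gamma> (radius + 2) (Suc j)"
  shows "F w - F (w[k := a]) = F (w[j := b]) - F (w[j := b, k := a])"
proof -
  let ?X = "{Suc k, min (w ! k) k, min a k}" and ?Y = "{Suc j, min (w ! j) j, min b j}"
  have X1: "agree_off ?X (code_graph w) (code_graph (w[k := a]))"
    by (rule code_graph_update_agree[OF k])
  have X2: "agree_off ?X (code_graph (w[j := b])) (code_graph (w[j := b, k := a]))"
    using code_graph_update_agree[of k "w[j := b]" a] k kj by simp
  have Y1: "agree_off ?Y (code_graph w) (code_graph (w[j := b]))"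
    by (rule code_graph_update_agree[OF j])
  have Y2: "agree_off ?Y (code_graph (w[k := a])) (code_graph (w[j := b, k := a]))"
    using code_graph_update_agree[of j "w[k := a]" b] j kj by (simp add: list_update_swap)
  have eY: "(Suc j, y) \<in> \<Gamma>\<^sup>=" if "y \<in> ?Y" for y
    using that code_graph_edge[OF j] code_graph_edge[of j "w[j := b]"] j sub(1,3) by (auto simp: edge_def)
  have eX: "(x, Suc k) \<in> \<Gamma>\<^sup>=" if "x \<in> ?X" for x
    using that code_graph_edge[OF k] code_graph_edge[of k "w[k := a]"] k sub(1,2) by (auto simp: edge_def)
  have "x \<notin> rball \<Gamma> radius y" if "y \<in> ?Y" "x \<in> ?X" for x y
  proof
    assume "x \<in> rball \<Gamma> radius y"
    then have "(y, x) \<in> (\<Gamma>\<^sup>=) ^^ radius" by (simp add: rball_def)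
    then have "(Suc j, x) \<in> (\<Gamma>\<^sup>=) ^^ Suc radius" using eY[OF that(1)] by (rule relpow_Suc_I2[rotated])
    then have "(Suc j, Suc k) \<in> (\<Gamma>\<^sup>=) ^^ Suc (Suc radius)" using eX[OF that(2)] by (rule relpow_Suc_I)
    then show False using far by (simp add: rball_def)
  qed
  from second_diff_card_occs[OF finite_code_graph finite_code_graph finite_code_graph finite_code_graph
      Y1 Y2 X1 X2 sub(1,3,2,4) this]
  have "F w - F (w[j := b]) = F (w[k := a]) - F (w[j := b, k := a])" unfolding F_def .
  then show ?thesis by simp
qed

text \<open>The exponent allows for a product of two increments, \<open>2 * expo\<close>, summed
  over a ball of radius \<open>radius + 2\<close>.\<close>

definition B :: "(nat \<times> nat) list \<Rightarrow> real" where
  "B xs = real (crowding xs ^ (2 * expo + radius + 2))"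

lemma crowding_pow_le_B: "e \<le> 2 * expo + radius + 2 \<Longrightarrow> real (crowding xs ^ e) \<le> B xs"
  unfolding B_def using crowding_pos[of xs] by (intro of_nat_mono power_increasing) auto

lemma hybrid_Suc: "k < length xs \<Longrightarrow> hybrid (Suc k) xs = (hybrid k xs)[k := snd (xs ! k)]"
  by (rule nth_equalityI) (auto simp: nth_hybrid nth_list_update less_Suc_eq)

lemma increments_near:
  assumes k: "k < length xs" and xs': "xs' = xs \<or> xs' = xs[j := y]"
  shows "\<bar>F (hybrid k xs') - F (hybrid (Suc k) xs')\<bar> \<le> real (crowding xs ^ expo)"
    "\<bar>F (map fst xs') - F (resample k xs')\<bar> \<le> real (crowding xs ^ expo)"
proof -
  have k': "k < length xs'" using assms by auto
  have sub: "pair_graph_of xs' \<subseteq> near_graph xs j y" using xs' pair_sub_near[of xs j y] by auto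
  have z: "crowding xs \<ge> 3" using crowding_pos[of xs] by simp
  show "\<bar>F (hybrid k xs') - F (hybrid (Suc k) xs')\<bar> \<le> real (crowding xs ^ expo)"
    unfolding hybrid_Suc[OF k']
    by (rule F_update_bound[OF _ _ _ near_graph_degree z])
      (use k' sub hybrid_sub_pair[of k xs'] hybrid_sub_pair[of "Suc k" xs'] hybrid_Suc[OF k'] in auto)
  show "\<bar>F (map fst xs') - F (resample k xs')\<bar> \<le> real (crowding xs ^ expo)"
    unfolding resample_def
    by (rule F_update_bound[OF _ _ _ near_graph_degree z])
      (use k' sub fst_sub_pair[of xs'] resample_sub_pair[of k xs', unfolded resample_def] in auto)
qed

lemma increments_le_B:
  assumes "k < length xs"
  shows "\<bar>F (hybrid k xs) - F (hybrid (Suc k) xs)\<bar> \<le> B xs" "\<bar>F (map fst xs) - F (resample k xs)\<bar> \<le> B xs"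
  using increments_near[OF assms, of xs 0 "(0, 0)"] crowding_pow_le_B[of expo xs] by auto

lemma increments_far:
  assumes k: "k < length xs" and j: "j < length xs"
    and far: "Suc k \<notin> rball (near_graph xs j y) (radius + 2) (Suc j)"
  shows "F (hybrid k xs) - F (hybrid (Suc k) xs) = F (hybrid k (xs[j := y])) - F (hybrid (Suc k) (xs[j := y]))"
    "F (map fst xs) - F (resample k xs) = F (map fst (xs[j := y])) - F (resample k (xs[j := y]))"
proof -
  let ?G = "near_graph xs j y" and ?xs' = "xs[j := y]"
  have kj: "k \<noteq> j" using far rball_self[of "Suc j"] by auto
  have sub: "pair_graph_of xs \<subseteq> ?G" "pair_graph_of ?xs' \<subseteq> ?G" using pair_sub_near by auto
  \<comment> \<open>At position \<open>j\<close>, which differs from \<open>k\<close>, both hybrids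
    show the same component of the pair: the second one if \<open>j < k\<close>, else the
    first.\<close>
  define b where "b = (if j < k then snd y else fst y)"
  have h1: "hybrid k ?xs' = (hybrid k xs)[j := b]"
    by (rule nth_equalityI) (use j in \<open>auto simp: nth_hybrid nth_list_update b_def\<close>)
  have h2: "hybrid (Suc k) ?xs' = (hybrid k xs)[j := b, k := snd (xs ! k)]"
    using hybrid_Suc[of k ?xs'] k kj h1 by simp
  have "F (hybrid k xs) - F ((hybrid k xs)[k := snd (xs ! k)])
      = F ((hybrid k xs)[j := b]) - F ((hybrid k xs)[j := b, k := snd (xs ! k)])"
  proof (rule F_second_diff[OF _ _ kj _ _ _ _ far])
    show "code_graph (hybrid k xs) \<subseteq> ?G" using hybrid_sub_pair sub(1) by blast
    show "code_graph ((hybrid k xs)[k := snd (xs ! k)]) \<subseteq> ?G"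
      using hybrid_sub_pair[of "Suc k" xs] sub(1) hybrid_Suc[OF k] by auto
    show "code_graph ((hybrid k xs)[j := b]) \<subseteq> ?G"
      using hybrid_sub_pair[of k ?xs'] sub(2) h1 by auto
    show "code_graph ((hybrid k xs)[j := b, k := snd (xs ! k)]) \<subseteq> ?G"
      using hybrid_sub_pair[of "Suc k" ?xs'] sub(2) h2 by auto
  qed (use k j in simp_all)
  then show "F (hybrid k xs) - F (hybrid (Suc k) xs) = F (hybrid k ?xs') - F (hybrid (Suc k) ?xs')"
    using h1 h2 hybrid_Suc[OF k] by simp
  have f1: "map fst ?xs' = (map fst xs)[j := fst y]" by (simp add: map_update)
  have f2: "resample k ?xs' = (map fst xs)[j := fst y, k := snd (xs ! k)]"
    unfolding resample_def using kj by (simp add: map_update)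
  have "F (map fst xs) - F ((map fst xs)[k := snd (xs ! k)])
      = F ((map fst xs)[j := fst y]) - F ((map fst xs)[j := fst y, k := snd (xs ! k)])"
  proof (rule F_second_diff[OF _ _ kj _ _ _ _ far])
    show "code_graph (map fst xs) \<subseteq> ?G" using fst_sub_pair sub(1) by blast
    show "code_graph ((map fst xs)[k := snd (xs ! k)]) \<subseteq> ?G"
      using resample_sub_pair[of k xs] sub(1) unfolding resample_def by blast
    show "code_graph ((map fst xs)[j := fst y]) \<subseteq> ?G"
      using fst_sub_pair[of ?xs'] sub(2) f1 by auto
    show "code_graph ((map fst xs)[j := fst y, k := snd (xs ! k)]) \<subseteq> ?G"
      using resample_sub_pair[of k ?xs'] sub(2) f2 by auto
  qed (use k j in simp_all)
  then show "F (map fst xs) - F (resample k xs) = F (map fst ?xs') - F (resample k ?xs')"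
    unfolding f1 f2 resample_def[of k xs] .
qed

text \<open>Summands with \<open>Suc k\<close> outside the ball around \<open>Suc j\<close> do not
  change by \<open>increments_far\<close>. Each of the others changes by at most twice the square of
  an increment bound, and the half in \<open>T'\<close> cancels the two.\<close>

lemma T_update_bound:
  fixes xs :: "(nat \<times> nat) list"
  defines "T' \<equiv> \<lambda>xs. (\<Sum>k<length xs. (F (hybrid k xs) - F (hybrid (Suc k) xs)) * (F (map fst xs) - F (resample k xs))) / 2"
  assumes j: "j < length xs"
  shows "\<bar>T' xs - T' (xs[j := y])\<bar> \<le> B xs"
proof -
  let ?A = "\<lambda>k xs. F (hybrid k xs) - F (hybrid (Suc k) xs)" and ?D = "\<lambda>k xs. F (map fst xs) - F (resample k xs)"
  let ?xs' = "xs[j := y]" and ?z = "crowding xs"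
  let ?S = "{k. k < length xs \<and> Suc k \<in> rball (near_graph xs j y) (radius + 2) (Suc j)}"
  have z: "?z - 1 + 1 = ?z" using crowding_pos[of xs] by simp
  have ball: "finite (rball (near_graph xs j y) (radius + 2) (Suc j))"
    "card (rball (near_graph xs j y) (radius + 2) (Suc j)) \<le> ?z ^ (radius + 2)"
    using card_rball[OF near_graph_degree, of xs j y "radius + 2" "Suc j"] unfolding z by auto
  have "card ?S = card (Suc ` ?S)" by (rule card_image[symmetric]) simp
  also have "\<dots> \<le> card (rball (near_graph xs j y) (radius + 2) (Suc j))"
    using ball(1) by (intro card_mono) auto
  finally have S: "card ?S \<le> ?z ^ (radius + 2)" using ball(2) by simp
  have "\<bar>T' xs - T' ?xs'\<bar> = \<bar>\<Sum>k<length xs. ?A k xs * ?D k xs - ?A k ?xs' * ?D k ?xs'\<bar> / 2"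
    unfolding T'_def by (simp add: sum_subtractf diff_divide_distrib[symmetric])
  also have "\<dots> \<le> (\<Sum>k<length xs. \<bar>?A k xs * ?D k xs - ?A k ?xs' * ?D k ?xs'\<bar>) / 2"
    by (intro divide_right_mono sum_abs) simp
  also have "(\<Sum>k<length xs. \<bar>?A k xs * ?D k xs - ?A k ?xs' * ?D k ?xs'\<bar>)
      = (\<Sum>k\<in>?S. \<bar>?A k xs * ?D k xs - ?A k ?xs' * ?D k ?xs'\<bar>)"
  proof (rule sum.mono_neutral_right)
    show "\<forall>k \<in> {..<length xs} - ?S. \<bar>?A k xs * ?D k xs - ?A k ?xs' * ?D k ?xs'\<bar> = 0"
    proof
      fix k assume "k \<in> {..<length xs} - ?S"
      then have k: "k < length xs" "Suc k \<notin> rball (near_graph xs j y) (radius + 2) (Suc j)" by auto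
      show "\<bar>?A k xs * ?D k xs - ?A k ?xs' * ?D k ?xs'\<bar> = 0"
        unfolding increments_far[OF k(1) j k(2)] by simp
    qed
  qed auto
  also have "\<dots> \<le> (\<Sum>k\<in>?S. 2 * real (?z ^ (2 * expo)))"
  proof (rule sum_mono)
    fix k assume "k \<in> ?S"
    then have k: "k < length xs" by simp
    have *: "\<bar>?A k zs * ?D k zs\<bar> \<le> real (?z ^ (2 * expo))" if "zs = xs \<or> zs = ?xs'" for zs
    proof -
      have "\<bar>?A k zs * ?D k zs\<bar> \<le> real (?z ^ expo) * real (?z ^ expo)"
        unfolding abs_mult using increments_near[OF k that] by (intro mult_mono) auto
      also have "\<dots> = real (?z ^ (2 * expo))" by (simp add: mult_2 power_add)
      finally show ?thesis .
    qed
    show "\<bar>?A k xs * ?D k xs - ?A k ?xs' * ?D k ?xs'\<bar> \<le> 2 * real (?z ^ (2 * expo))"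
      using *[OF disjI1[OF refl]] *[OF disjI2[OF refl]] abs_triangle_ineq4[of "?A k xs * ?D k xs" "?A k ?xs' * ?D k ?xs'"] by linarith
  qed
  also have "\<dots> = 2 * (real (card ?S) * real (?z ^ (2 * expo)))" by simp
  also have "\<dots> / 2 = real (card ?S) * real (?z ^ (2 * expo))" by simp
  also have "\<dots> \<le> real (?z ^ (radius + 2)) * real (?z ^ (2 * expo))"
    by (rule mult_right_mono[OF of_nat_mono[OF S]]) simp
  also have "\<dots> = B xs" unfolding B_def by (simp add: power_add mult_ac)
  finally show ?thesis by simp
qed

end

subsection \<open>The rate of convergence\<close>

context product_space
begin

text \<open>The Efron-Stein inequality one level up: \<open>T F\<close> is a function of a word
  whose letters are the pairs, so a letter with its independent copy is a pair of pairs.\<close>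

lemma variance_T_bound:
  assumes BT: "\<And>xs j y. xs \<in> \<Lambda> \<Longrightarrow> j < m \<Longrightarrow> y \<in> K \<times> K \<Longrightarrow> \<bar>T F xs - T F (xs[j := y])\<bar> \<le> B xs"
  shows "variance_on \<Lambda> (T F) \<le> real m * mean \<Lambda> (\<lambda>xs. (B xs)\<^sup>2)"
proof -
  interpret P2: product_space "K \<times> K" m by unfold_locales (use K in auto)
  have "variance_on \<Lambda> (T F) \<le> (\<Sum>k<m. mean P2.\<Lambda> (\<lambda>zs. (T F (map fst zs) - T F (resample k zs))\<^sup>2)) / 2"
    by (rule P2.efron_stein)
  also have "\<dots> \<le> (\<Sum>k<m. mean \<Lambda> (\<lambda>xs. (B xs)\<^sup>2)) / 2"
  proof (intro divide_right_mono sum_mono)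
    fix k assume "k \<in> {..<m}"
    then have k: "k < m" by simp
    have "mean P2.\<Lambda> (\<lambda>zs. (T F (map fst zs) - T F (resample k zs))\<^sup>2) \<le> mean P2.\<Lambda> (\<lambda>zs. (B (map fst zs))\<^sup>2)"
    proof (rule mean_mono)
      fix zs assume zs: "zs \<in> P2.\<Lambda>"
      have 1: "map fst zs \<in> \<Lambda>" using bij_betw_apply[OF bij_unzip zs] by simp
      have 2: "snd (zs ! k) \<in> K \<times> K" using words_nth[OF zs k] by (cases "zs ! k") auto
      have "\<bar>T F (map fst zs) - T F (resample k zs)\<bar> \<le> B (map fst zs)"
        unfolding resample_def by (rule BT[OF 1 k 2])
      then show "(T F (map fst zs) - T F (resample k zs))\<^sup>2 \<le> (B (map fst zs))\<^sup>2"
        by (rule abs_le_square_iff[THEN iffD1, OF order_trans[OF _ abs_ge_self]])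
    qed
    also have "\<dots> = mean \<Lambda> (\<lambda>xs. (B xs)\<^sup>2)" by (rule P2.mean_fst)
    finally show "mean P2.\<Lambda> (\<lambda>zs. (T F (map fst zs) - T F (resample k zs))\<^sup>2) \<le> mean \<Lambda> (\<lambda>xs. (B xs)\<^sup>2)" .
  qed simp
  also have "\<dots> = real m * mean \<Lambda> (\<lambda>xs. (B xs)\<^sup>2) / 2" by simp
  also have "\<dots> \<le> real m * mean \<Lambda> (\<lambda>xs. (B xs)\<^sup>2)"
    using mean_nonneg[of \<Lambda> "\<lambda>xs. (B xs)\<^sup>2"] by simp
  finally show ?thesis .
qed

text \<open>A single moment of \<open>B\<close> controls both errors. In the cubic term, twice
  \<open>B xs ^ 3\<close> times the standardised value is split into \<open>B xs ^ 6\<close> and the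
  square of that value, whose mean is 1. Since \<open>\<beta>\<close> and \<open>1 / d\<close> are
  at least 1, the constants add up to \<open>8 / d\<close>.\<close>

lemma smooth_bound:
  fixes F :: "'b list \<Rightarrow> real" and B :: "('b \<times> 'b) list \<Rightarrow> real"
  defines "V \<equiv> variance_on \<Omega> F" and "\<beta> \<equiv> mean \<Lambda> (\<lambda>xs. B xs ^ 6)"
  assumes pos: "V > 0" and d: "0 < d" "d \<le> 1" and B: "\<And>xs. 1 \<le> B xs"
    and B1: "\<And>xs k. xs \<in> \<Lambda> \<Longrightarrow> k < m \<Longrightarrow> \<bar>F (hybrid k xs) - F (hybrid (Suc k) xs)\<bar> \<le> B xs"
    and B2: "\<And>xs k. xs \<in> \<Lambda> \<Longrightarrow> k < m \<Longrightarrow> \<bar>F (map fst xs) - F (resample k xs)\<bar> \<le> B xs"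
    and BT: "\<And>xs j y. xs \<in> \<Lambda> \<Longrightarrow> j < m \<Longrightarrow> y \<in> K \<times> K \<Longrightarrow> \<bar>T F xs - T F (xs[j := y])\<bar> \<le> B xs"
  shows "\<bar>mean \<Omega> (\<lambda>u. ramp z d ((F u - mean \<Omega> F) / sqrt V)) - gauss_mean (ramp z d)\<bar>
    \<le> 2 / V * sqrt (real m * \<beta>) + real m / (2 * sqrt V ^ 3) * (8 / d * \<beta>)"
proof -
  have B6: "B xs ^ k \<le> B xs ^ 6" if "k \<le> 6" for xs k using B that by (rule power_increasing[rotated])
  have B0: "0 \<le> B xs" for xs using B[of xs] by simp
  have b1: "1 \<le> \<beta>"
  proof -
    have "mean \<Lambda> (\<lambda>_. 1) \<le> \<beta>" unfolding \<beta>_def by (rule mean_mono) (simp add: B one_le_power)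
    then show ?thesis using fin by (simp add: mean_const)
  qed
  let ?w = "\<lambda>u. (F u - mean \<Omega> F) / sqrt V"
  have w2: "mean \<Lambda> (\<lambda>xs. (?w (map fst xs))\<^sup>2) = 1"
  proof -
    have "mean \<Lambda> (\<lambda>xs. (?w (map fst xs))\<^sup>2) = mean \<Omega> (\<lambda>u. (1 / V) * (F u - mean \<Omega> F)\<^sup>2)"
      unfolding mean_fst[of "\<lambda>u. (?w u)\<^sup>2"] using pos by (simp add: power_divide)
    also have "\<dots> = (1 / V) * V" unfolding mean_cmult V_def variance_on_def ..
    finally show ?thesis using pos by simp
  qed
  have lip: "\<bar>ramp z d x - ramp z d y\<bar> \<le> 1 / d * \<bar>x - y\<bar>" for x y
    using ramp_lipschitz[OF d(1), of z x y] by simp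
  have "\<bar>mean \<Omega> (\<lambda>u. ramp z d (?w u)) - gauss_mean (ramp z d)\<bar>
    \<le> 2 / (sqrt V)\<^sup>2 * sqrt (variance_on \<Lambda> (T F))
      + real m / (2 * sqrt V ^ 3) * mean \<Lambda> (\<lambda>xs. B xs ^ 3 * (2 * \<bar>?w (map fst xs)\<bar> + 5 + 1 / d))"
    unfolding V_def by (rule stein_bound[OF stein_test_ramp[OF d(1)] lip pos[unfolded V_def] B1 B2])
  also have "\<dots> \<le> 2 / V * sqrt (real m * \<beta>) + real m / (2 * sqrt V ^ 3) * (8 / d * \<beta>)"
  proof (intro add_mono mult_mono order_refl)
    show "2 / (sqrt V)\<^sup>2 \<le> 2 / V" using pos by simp
    have "variance_on \<Lambda> (T F) \<le> real m * mean \<Lambda> (\<lambda>xs. (B xs)\<^sup>2)" by (rule variance_T_bound[OF BT])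
    also have "\<dots> \<le> real m * \<beta>" unfolding \<beta>_def
      by (intro mult_left_mono mean_mono B6) simp_all
    finally show "sqrt (variance_on \<Lambda> (T F)) \<le> sqrt (real m * \<beta>)" by simp
    have "mean \<Lambda> (\<lambda>xs. B xs ^ 3 * (2 * \<bar>?w (map fst xs)\<bar> + 5 + 1 / d))
        \<le> mean \<Lambda> (\<lambda>xs. ((?w (map fst xs))\<^sup>2 + (6 + 1 / d) * B xs ^ 6))"
    proof (rule mean_mono)
      fix xs
      have p: "(B xs ^ 3)\<^sup>2 = B xs ^ 6" by (simp add: power_mult[symmetric])
      have sq: "2 * (B xs ^ 3) * \<bar>?w (map fst xs)\<bar> \<le> B xs ^ 6 + (?w (map fst xs))\<^sup>2"
        using sum_squares_bound[of "B xs ^ 3" "\<bar>?w (map fst xs)\<bar>"] unfolding p power2_abs .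
      have "(5 + 1 / d) * B xs ^ 3 \<le> (5 + 1 / d) * B xs ^ 6"
        using d by (intro mult_left_mono B6) simp_all
      then have "2 * (B xs ^ 3) * \<bar>?w (map fst xs)\<bar> + (5 + 1 / d) * B xs ^ 3
          \<le> B xs ^ 6 + (?w (map fst xs))\<^sup>2 + (5 + 1 / d) * B xs ^ 6"
        using sq by linarith
      moreover have "B xs ^ 3 * (2 * \<bar>?w (map fst xs)\<bar> + 5 + 1 / d)
          = 2 * (B xs ^ 3) * \<bar>?w (map fst xs)\<bar> + (5 + 1 / d) * B xs ^ 3"
        by (simp only: distrib_left distrib_right mult_ac)
      moreover have "B xs ^ 6 + (?w (map fst xs))\<^sup>2 + (5 + 1 / d) * B xs ^ 6 = (?w (map fst xs))\<^sup>2 + (6 + 1 / d) * B xs ^ 6"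
        by (simp add: distrib_right)
      ultimately show "B xs ^ 3 * (2 * \<bar>?w (map fst xs)\<bar> + 5 + 1 / d)
          \<le> (?w (map fst xs))\<^sup>2 + (6 + 1 / d) * B xs ^ 6" by linarith
    qed
    also have "\<dots> = 1 + (6 + 1 / d) * \<beta>" unfolding mean_add mean_cmult w2 \<beta>_def ..
    also have "\<dots> \<le> (7 + 1 / d) * \<beta>" using b1 by (simp add: distrib_right)
    also have "\<dots> \<le> 8 / d * \<beta>" using b1 d by (intro mult_right_mono) (simp_all add: field_simps)
    finally show "mean \<Lambda> (\<lambda>xs. B xs ^ 3 * (2 * \<bar>?w (map fst xs)\<bar> + 5 + 1 / d)) \<le> 8 / d * \<beta>" .
    show "0 \<le> sqrt (variance_on \<Lambda> (T F))" "0 \<le> 2 / V" "0 \<le> real m / (2 * sqrt V ^ 3)"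
      using pos by (auto simp: variance_on_def intro: mean_nonneg)
    show "0 \<le> mean \<Lambda> (\<lambda>xs. B xs ^ 3 * (2 * \<bar>?w (map fst xs)\<bar> + 5 + 1 / d))"
      using B0 d by (intro mean_nonneg mult_nonneg_nonneg) simp_all
  qed
  finally show ?thesis .
qed

text \<open>The indicator of the half-line up to \<open>t\<close> lies between the ramps that
  descend on [t - d, t] and on [t, t + d]; the normal distribution function changes by at most
  \<open>d\<close> over either interval.\<close>

lemma kolmogorov_bound:
  assumes d: "d > 0"
    and E: "\<And>z. \<bar>mean \<Omega> (\<lambda>u. ramp z d (w u)) - gauss_mean (ramp z d)\<bar> \<le> e"
  shows "\<bar>mean \<Omega> (\<lambda>u. of_bool (w u \<le> t)) - cdf std_normal_distribution t\<bar> \<le> d + e"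
proof -
  have "mean \<Omega> (\<lambda>u. of_bool (w u \<le> t)) \<le> mean \<Omega> (\<lambda>u. ramp t d (w u))"
    using ramp_eq_1[OF d] ramp_bounds by (intro mean_mono) auto
  moreover have "mean \<Omega> (\<lambda>u. ramp (t - d) d (w u)) \<le> mean \<Omega> (\<lambda>u. of_bool (w u \<le> t))"
    using ramp_eq_0[OF d, of "t - d"] ramp_bounds by (intro mean_mono) (auto simp: not_le)
  moreover have "gauss_mean (ramp t d) \<le> cdf std_normal_distribution t + d"
    using gauss_mean_ramp(2)[OF d, of t] cdf_std_normal_lipschitz[of d t] d by linarith
  moreover have "cdf std_normal_distribution t - d \<le> gauss_mean (ramp (t - d) d)"
    using gauss_mean_ramp(1)[OF d, of "t - d"] cdf_std_normal_lipschitz[of d "t - d"] d by simp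
  ultimately show ?thesis using E[of t] E[of "t - d"] unfolding abs_le_iff by linarith
qed

section \<open>Moments of the maximal multiplicity of a letter\<close>

lemma sum_power_count_list:
  assumes "v \<in> K"
  shows "(\<Sum>us \<in> words K k. 2 ^ count_list us v) = (real (card K) + 1) ^ k"
proof (induction k)
  case 0
  have "words K 0 = {[]}" by (auto simp: words_def)
  then show ?case by simp
next
  case (Suc k)
  have eq: "words K (Suc k) = (\<lambda>(u, us). u # us) ` (K \<times> words K k)"
    by (auto simp: words_def image_iff length_Suc_conv)
  have "(\<Sum>us \<in> words K (Suc k). 2 ^ count_list us v)
      = (\<Sum>(u, us) \<in> K \<times> words K k. (if u = v then 2 else 1) * 2 ^ count_list us v :: real)"
    unfolding eq by (subst sum.reindex) (auto simp: inj_on_def intro!: sum.cong)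
  also have "\<dots> = (\<Sum>u \<in> K. if u = v then 2 else 1) * (\<Sum>us \<in> words K k. 2 ^ count_list us v)"
    by (simp add: sum_product sum.cartesian_product)
  also have "(\<Sum>u \<in> K. if u = v then 2 else 1 :: real) = (\<Sum>u \<in> K. 1 + (if u = v then 1 else 0))"
    by (intro sum.cong) auto
  also have "\<dots> = real (card K) + 1" using assms K by (simp add: sum.distrib)
  finally show ?case using Suc by simp
qed

text \<open>A union bound over the letters costs the factor \<open>card K\<close>; for one letter
  the multiplicity is binomial and its exponential moment is (1 + 1/n)^m with n =
  \<open>card K\<close>, at most e.\<close>

lemma mean_power_max_mult:
  assumes "m < card K"
  shows "mean \<Omega> (\<lambda>us. 2 ^ max_mult us) \<le> 3 * real (card K)"
proof -
  let ?n = "real (card K)"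
  have n: "?n > 0" using K by (simp add: card_gt_0_iff)
  have "mean \<Omega> (\<lambda>us. 2 ^ max_mult us) \<le> mean \<Omega> (\<lambda>us. \<Sum>v\<in>K. 2 ^ count_list us v)"
  proof (rule mean_mono)
    fix us assume us: "us \<in> \<Omega>"
    have "max_mult us \<in> insert 0 (count_list us ` set us)"
      unfolding max_mult_def by (rule Max_in) auto
    moreover obtain v0 where "v0 \<in> K" using K by auto
    ultimately obtain v where v: "v \<in> K" "max_mult us \<le> count_list us v"
      using us by (auto simp: words_def)
    have "(2::real) ^ max_mult us \<le> 2 ^ count_list us v" using v(2) by (rule power_increasing) simp
    also have "\<dots> \<le> (\<Sum>v\<in>K. 2 ^ count_list us v)"
      by (rule member_le_sum[OF v(1)]) (use K in auto)
    finally show "(2::real) ^ max_mult us \<le> (\<Sum>v\<in>K. 2 ^ count_list us v)" .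
  qed
  also have "\<dots> = (\<Sum>v\<in>K. (?n + 1) ^ m / ?n ^ m)"
    unfolding mean_sum by (intro sum.cong refl) (simp add: mean_def sum_power_count_list card_words K)
  also have "\<dots> = ?n * ((?n + 1) / ?n) ^ m" by (simp add: power_divide)
  also have "((?n + 1) / ?n) ^ m \<le> ((?n + 1) / ?n) ^ card K"
    using assms n by (intro power_increasing) auto
  also have "\<dots> \<le> exp (1 / ?n) ^ card K"
    using n exp_ge_add_one_self[of "1 / ?n"] by (intro power_mono) (auto simp: field_simps)
  also have "\<dots> = exp 1" using n by (simp add: exp_of_nat_mult[symmetric])
  also have "\<dots> \<le> 3" by (rule exp_le)
  finally show ?thesis using n by (simp add: mult.commute)
qed

end

lemma poly_le_exponential: "\<exists>C > 0. \<forall>M :: nat. (4 * real M + 11) ^ p \<le> C * 2 ^ M"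
proof -
  have "(\<lambda>M. (4 * real M + 11) ^ p / 2 ^ M) \<longlonglongrightarrow> 0" by real_asymp
  then have "Bseq (\<lambda>M. (4 * real M + 11) ^ p / 2 ^ M)" by (intro convergent_imp_Bseq convergentI)
  then obtain C where C: "C > 0" "\<And>M. norm ((4 * real M + 11) ^ p / 2 ^ M) \<le> C"
    by (auto simp: Bseq_def)
  have "(4 * real M + 11) ^ p \<le> C * 2 ^ M" for M
  proof -
    have "(4 * real M + 11) ^ p / 2 ^ M \<le> C" using C(2)[of M] by (auto simp: abs_le_iff)
    then show ?thesis by (simp add: field_simps)
  qed
  then show ?thesis using C(1) by blast
qed

text \<open>If the power exceeds n^\<epsilon>, then n is at most the \<open>q\<close>-th power of
  the base, so the exponential dominates even after multiplication by n. The division by n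
  compensates the union bound of \<open>mean_power_max_mult\<close>.\<close>

lemma poly_le_small_power:
  assumes "\<epsilon> > 0"
  shows "\<exists>C > 0. \<forall>(M :: nat) (n :: nat). n \<ge> 1 \<longrightarrow> (4 * real M + 11) ^ c \<le> real n powr \<epsilon> + C * 2 ^ M / real n"
proof -
  define q where "q = nat \<lceil>real c / \<epsilon>\<rceil>"
  obtain C where C: "C > 0" "\<And>M :: nat. (4 * real M + 11) ^ (q + c) \<le> C * 2 ^ M"
    using poly_le_exponential by blast
  have "(4 * real M + 11) ^ c \<le> real n powr \<epsilon> + C * 2 ^ M / real n" if n: "n \<ge> 1" for M n :: nat
  proof (cases "(4 * real M + 11) ^ c \<le> real n powr \<epsilon>")
    case True
    moreover have "0 \<le> C * 2 ^ M / real n" using C(1) by simp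
    ultimately show ?thesis by linarith
  next
    case False
    let ?Y = "4 * real M + 11"
    have "real n = (real n powr \<epsilon>) powr (1 / \<epsilon>)" using assms n by (simp add: powr_powr)
    also have "\<dots> \<le> (?Y ^ c) powr (1 / \<epsilon>)" using False assms by (intro powr_mono2) auto
    also have "\<dots> = ?Y powr (real c / \<epsilon>)" by (simp add: powr_realpow[symmetric] powr_powr)
    also have "\<dots> \<le> ?Y powr real q" unfolding q_def by (intro powr_mono) linarith+
    also have "\<dots> = ?Y ^ q" by (simp add: powr_realpow)
    finally have "real n * ?Y ^ c \<le> ?Y ^ q * ?Y ^ c" by (intro mult_right_mono) auto
    also have "\<dots> \<le> C * 2 ^ M" using C(2)[of M] by (simp add: power_add)
    finally have "?Y ^ c \<le> C * 2 ^ M / real n" using n by (simp add: field_simps)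
    moreover have "0 \<le> real n powr \<epsilon>" by simp
    ultimately show ?thesis by linarith
  qed
  then show ?thesis using C(1) by blast
qed

lemma mean_crowding_power:
  assumes "\<epsilon> > 0"
  shows "\<exists>C > 0. \<forall>n \<ge> 1. mean (words ({..<n} \<times> {..<n}) (n - 1)) (\<lambda>xs. real (crowding xs) ^ c) \<le> C * real n powr \<epsilon>"
proof -
  obtain C where C: "C > 0" "\<And>(M :: nat) (n :: nat). n \<ge> 1 \<Longrightarrow> (4 * real M + 11) ^ c \<le> real n powr \<epsilon> + C * 2 ^ M / real n"
    using poly_le_small_power[OF assms, of c] by blast
  have "mean (words ({..<n} \<times> {..<n}) (n - 1)) (\<lambda>xs. real (crowding xs) ^ c) \<le> (1 + 6 * C) * real n powr \<epsilon>"
    if n: "n \<ge> 1" for n :: nat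
  proof -
    interpret product_space "{..<n}" "n - 1"
      by unfold_locales (use n in \<open>auto simp: lessThan_empty_iff\<close>)
    let ?a = "\<lambda>xs. (2::real) ^ max_mult (map fst xs)" and ?b = "\<lambda>xs. (2::real) ^ max_mult (map snd xs)"
    have "mean \<Lambda> (\<lambda>xs. real (crowding xs) ^ c) \<le> mean \<Lambda> (\<lambda>xs. real n powr \<epsilon> + C / real n * (?a xs + ?b xs))"
    proof (rule mean_mono)
      fix xs :: "(nat \<times> nat) list"
      define M where "M = max (max_mult (map fst xs)) (max_mult (map snd xs))"
      have "real (crowding xs) ^ c \<le> (4 * real M + 11) ^ c"
        unfolding crowding_def M_def by (intro power_mono) auto
      also have "\<dots> \<le> real n powr \<epsilon> + C * 2 ^ M / real n" by (rule C(2)[OF n])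
      also have "(2::real) ^ M \<le> ?a xs + ?b xs" unfolding M_def by (simp add: max_def)
      finally show "real (crowding xs) ^ c \<le> real n powr \<epsilon> + C / real n * (?a xs + ?b xs)"
        using C(1) by (simp add: divide_right_mono)
    qed
    also have "\<dots> = real n powr \<epsilon> + C / real n * (mean \<Omega> (\<lambda>us. 2 ^ max_mult us) + mean \<Omega> (\<lambda>us. 2 ^ max_mult us))"
      unfolding mean_add mean_cmult mean_fst[of "\<lambda>us. 2 ^ max_mult us"] mean_snd[of "\<lambda>us. 2 ^ max_mult us"]
      using fin by (simp add: mean_const)
    also have "\<dots> \<le> real n powr \<epsilon> + C / real n * (3 * real n + 3 * real n)"
      using mean_power_max_mult n C(1) by (intro add_left_mono mult_left_mono add_mono) auto
    also have "\<dots> = real n powr \<epsilon> + 6 * C * 1" using n by simp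
    also have "\<dots> \<le> real n powr \<epsilon> + 6 * C * real n powr \<epsilon>"
      using C(1) n assms by (intro add_left_mono mult_left_mono) (auto simp: ge_one_powr_ge_zero)
    finally show ?thesis by (simp add: distrib_right)
  qed
  moreover have "1 + 6 * C > 0" using C(1) by simp
  ultimately show ?thesis by blast
qed

context tree_pattern
begin

lemma kolmogorov_rate:
  assumes c0: "c0 > 0" and var: "\<And>n. n \<ge> N \<Longrightarrow> variance_on (words {..<n} (n - 1)) F \<ge> c0 * real n"
    and eps: "\<epsilon> > 0"
  shows "\<exists>C. \<forall>n \<ge> max 1 N. \<forall>t.
    \<bar>mean (words {..<n} (n - 1)) (\<lambda>u. of_bool ((F u - mean (words {..<n} (n - 1)) F) / sqrt (variance_on (words {..<n} (n - 1)) F) \<le> t))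
      - cdf std_normal_distribution t\<bar> \<le> C * real n powr (- (1 / 4) + \<epsilon>)"
proof -
  let ?e = "(2 * expo + radius + 2) * 6"
  obtain C where C: "C > 0" "\<And>n. n \<ge> 1 \<Longrightarrow>
      mean (words ({..<n} \<times> {..<n}) (n - 1)) (\<lambda>xs. real (crowding xs) ^ ?e) \<le> C * real n powr \<epsilon>"
    using mean_crowding_power[OF eps, of ?e] by blast
  define C' where "C' = 1 + 2 / c0 * C + 4 / sqrt c0 ^ 3 * C + 2 / c0"
  show ?thesis
  proof (intro exI[of _ C'] allI impI)
    fix n :: nat and t :: real assume n: "max 1 N \<le> n"
    then have n1: "n \<ge> 1" and nN: "n \<ge> N" by auto
    interpret product_space "{..<n}" "n - 1"
      by unfold_locales (use n1 in \<open>auto simp: lessThan_empty_iff\<close>)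
    define V where "V = variance_on \<Omega> F"
    define \<beta> where "\<beta> = mean \<Lambda> (\<lambda>xs. B xs ^ 6)"
    define x where "x = real n"
    define d where "d = x powr (- (1/4))"
    have x: "x \<ge> 1" using n1 by (simp add: x_def)
    have V: "V \<ge> c0 * x" "V > 0"
    proof -
      show "V \<ge> c0 * x" using var[OF nN] by (simp add: V_def x_def)
      moreover have "c0 * x > 0" using c0 x by simp
      ultimately show "V > 0" by linarith
    qed
    have d: "0 < d" "d \<le> 1" using x powr_mono[of "- (1/4)" 0 x] by (auto simp: d_def)
    have \<beta>: "\<beta> \<le> C * x powr \<epsilon>"
    proof -
      have "B xs ^ 6 = real (crowding xs) ^ ?e" for xs by (simp only: B_def of_nat_power power_mult)
      then show ?thesis using C(2)[OF n1] by (simp only: \<beta>_def x_def)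
    qed
    have b1: "1 \<le> \<beta>"
    proof -
      have "mean \<Lambda> (\<lambda>_. 1) \<le> \<beta>" unfolding \<beta>_def B_def
        using crowding_pos by (intro mean_mono one_le_power) (metis of_nat_1 of_nat_mono one_le_power le_trans one_le_numeral)
      then show ?thesis using fin by (simp add: mean_const)
    qed
    have B1: "1 \<le> B xs" for xs using crowding_pow_le_B[of 0 xs] by simp
    define e where "e = 2 / V * sqrt (real (n - 1) * \<beta>) + real (n - 1) / (2 * sqrt V ^ 3) * (8 / d * \<beta>)"
    have E: "\<bar>mean \<Omega> (\<lambda>u. ramp z d ((F u - mean \<Omega> F) / sqrt V)) - gauss_mean (ramp z d)\<bar> \<le> e" for z
      unfolding e_def \<beta>_def V_def
    proof (rule smooth_bound[OF V(2)[unfolded V_def] d B1])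
      fix xs k assume "xs \<in> \<Lambda>" "k < n - 1"
      then have k: "k < length xs" by simp
      show "\<bar>F (hybrid k xs) - F (hybrid (Suc k) xs)\<bar> \<le> B xs" "\<bar>F (map fst xs) - F (resample k xs)\<bar> \<le> B xs"
        by (rule increments_le_B[OF k])+
    next
      fix xs j y assume xs: "xs \<in> \<Lambda>" and "j < n - 1"
      then have "j < length xs" by simp
      from T_update_bound[OF this, of y] show "\<bar>T F xs - T F (xs[j := y])\<bar> \<le> B xs"
        unfolding T_def using xs by simp
    qed
    have "\<bar>mean \<Omega> (\<lambda>u. of_bool ((F u - mean \<Omega> F) / sqrt V \<le> t)) - cdf std_normal_distribution t\<bar> \<le> d + e"
      by (rule kolmogorov_bound[OF d(1) E])
    also have "d + e \<le> C' * x powr (- (1/4) + \<epsilon>)"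
    proof -
      have sx: "sqrt x = x powr (1/2)" by (simp add: powr_half_sqrt x_def)
      \<comment> \<open>As \<open>\<beta>\<close> is at least 1 its root may be replaced by
        \<open>\<beta>\<close>, so that both errors carry a single factor n^\<epsilon>.\<close>
      have "sqrt (real (n - 1) * \<beta>) \<le> sqrt (x * \<beta>\<^sup>2)"
        using b1 by (intro real_sqrt_le_mono mult_mono) (auto simp: x_def power2_eq_square)
      also have "\<dots> = sqrt x * \<beta>" using b1 by (simp add: real_sqrt_mult)
      finally have s: "sqrt (real (n - 1) * \<beta>) \<le> sqrt x * \<beta>" .
      have "2 / V * sqrt (real (n - 1) * \<beta>) \<le> 2 / (c0 * x) * (sqrt x * \<beta>)"
        using V c0 x b1 s by (intro mult_mono divide_left_mono) auto
      also have "\<dots> = 2 / c0 * \<beta> * (sqrt x / x)" by simp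
      also have "sqrt x / x = x powr (1/2) / x powr 1" using x by (simp add: sx)
      also have "\<dots> = x powr (- (1/2))" by (simp only: powr_diff[symmetric]) simp
      \<comment> \<open>This error decays faster than required; the rate is set by the ramp width
        and the second error, which balance at \<open>x powr (- (1/4))\<close>.\<close>
      also have "2 / c0 * \<beta> * x powr (- (1/2)) \<le> 2 / c0 * \<beta> * x powr (- (1/4))"
        using x c0 b1 by (intro mult_left_mono powr_mono) auto
      finally have e1: "2 / V * sqrt (real (n - 1) * \<beta>) \<le> 2 / c0 * \<beta> * x powr (- (1/4))" .
      have sV: "sqrt V ^ 3 \<ge> sqrt c0 ^ 3 * (x * sqrt x)"
      proof -
        have "sqrt x ^ 3 = x * sqrt x" using x by (simp add: power3_eq_cube)
        then have "sqrt c0 ^ 3 * (x * sqrt x) = (sqrt (c0 * x)) ^ 3"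
          by (simp only: real_sqrt_mult power_mult_distrib)
        also have "\<dots> \<le> sqrt V ^ 3" using V(1) c0 x by (intro power_mono) auto
        finally show ?thesis .
      qed
      have pos3: "sqrt c0 ^ 3 * (x * sqrt x) > 0" using c0 x by simp
      have "real (n - 1) / (2 * sqrt V ^ 3) * (8 / d * \<beta>) \<le> x / (2 * (sqrt c0 ^ 3 * (x * sqrt x))) * (8 / d * \<beta>)"
      proof (rule mult_right_mono)
        show "real (n - 1) / (2 * sqrt V ^ 3) \<le> x / (2 * (sqrt c0 ^ 3 * (x * sqrt x)))"
          using sV pos3 x by (intro frac_le) (auto simp: x_def)
        show "0 \<le> 8 / d * \<beta>" using d b1 by simp
      qed
      also have "\<dots> = 4 / sqrt c0 ^ 3 * \<beta> * (1 / (d * sqrt x))" using x by simp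
      also have "d * sqrt x = x powr (1/4)" by (simp add: d_def sx powr_add[symmetric])
      also have "1 / x powr (1/4) = x powr (- (1/4))" by (simp add: powr_minus_divide)
      finally have e2: "real (n - 1) / (2 * sqrt V ^ 3) * (8 / d * \<beta>) \<le> 4 / sqrt c0 ^ 3 * \<beta> * x powr (- (1/4))" .
      let ?p = "x powr (- (1/4))" and ?q = "x powr \<epsilon>"
      have q: "?q \<ge> 1" using x eps by (simp add: ge_one_powr_ge_zero)
      have "d + e \<le> ?p + 2 / c0 * \<beta> * ?p + 4 / sqrt c0 ^ 3 * \<beta> * ?p"
        unfolding e_def d_def[symmetric] using e1 e2 by (simp add: d_def)
      also have "\<dots> \<le> ?q * ?p + 2 / c0 * (C * ?q) * ?p + 4 / sqrt c0 ^ 3 * (C * ?q) * ?p"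
      proof (intro add_mono mult_right_mono mult_left_mono \<beta>)
        show "?p \<le> ?q * ?p" using mult_right_mono[OF q, of ?p] by simp
      qed (use c0 in auto)
      also have "\<dots> = (1 + 2 / c0 * C + 4 / sqrt c0 ^ 3 * C) * (?p * ?q)"
        by (simp add: algebra_simps)
      also have "\<dots> \<le> C' * (?p * ?q)" unfolding C'_def using c0 by (intro mult_right_mono) auto
      finally show ?thesis by (simp only: powr_add)
    qed
    finally show "\<bar>mean \<Omega> (\<lambda>u. of_bool ((F u - mean \<Omega> F) / sqrt (variance_on \<Omega> F) \<le> t)) - cdf std_normal_distribution t\<bar>
        \<le> C' * real n powr (- (1/4) + \<epsilon>)"
      unfolding V_def x_def .
  qed
qed

end

subsection \<open>Switching fringe subtrees\<close>

definition enum :: "nat set \<Rightarrow> nat \<Rightarrow> nat" where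
  "enum V i = sorted_list_of_set V ! i"

lemma enum_bij: "finite V \<Longrightarrow> bij_betw (enum V) {..<card V} V"
  unfolding enum_def by (rule bij_betw_nth) auto

definition place :: "nat set \<Rightarrow> nat rel \<Rightarrow> nat rel" where
  "place V A = map_prod (enum V) (enum V) ` A"

definition attach :: "nat rel \<Rightarrow> nat set \<Rightarrow> nat \<Rightarrow> nat rel \<Rightarrow> nat rel" where
  "attach A V p R = R \<union> edge p (enum V 0) \<union> place V A"

definition touching :: "nat rel \<Rightarrow> nat set \<Rightarrow> nat rel" where
  "touching T V = {a \<in> T. fst a \<in> V \<or> snd a \<in> V}"

text \<open>A fringe must carry the order-preserving copy of \<open>A\<close>, hung on by its
  smallest vertex. Prescribing the labelling avoids counting automorphisms, and the expected number
  of fringes remains linear.\<close>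

definition fringe :: "nat set \<Rightarrow> nat rel \<Rightarrow> nat set \<Rightarrow> nat rel \<Rightarrow> bool" where
  "fringe V0 A V T \<longleftrightarrow> (\<exists>p \<in> V0 - V. touching T V = place V A \<union> edge p (enum V 0))"

lemma place_tree:
  assumes "finite V" "card V = s" "is_tree {..<s} A" shows "is_tree V (place V A)"
proof -
  have b: "bij_betw (enum V) {..<s} V" using enum_bij[OF assms(1)] assms(2) by simp
  show ?thesis
    using is_tree_image[OF assms(3) bij_betw_imp_inj_on[OF b]] bij_betw_imp_surj_on[OF b]
    unfolding place_def by simp
qed

lemma place_inj:
  assumes "finite V" "card V = s" "A \<subseteq> {..<s} \<times> {..<s}" "B \<subseteq> {..<s} \<times> {..<s}" "place V A = place V B"
  shows "A = B"
proof -
  have "inj_on (enum V) {..<s}"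
    using bij_betw_imp_inj_on[OF enum_bij[OF assms(1)]] unfolding assms(2) .
  from map_prod_inj_on[OF this this]
  have "inj_on (map_prod (enum V) (enum V)) ({..<s} \<times> {..<s})" .
  then show ?thesis using assms(3-5) inj_on_image_eq_iff unfolding place_def by metis
qed

locale fringe_setting =
  fixes V0 :: "nat set" and s :: nat
  assumes V0: "finite V0" and s: "0 < s" "2 * s < card V0"
begin

abbreviation "\<V> \<equiv> {V. V \<subseteq> V0 \<and> card V = s}"
abbreviation "slots V \<equiv> (V0 - V) \<times> trees (V0 - V)"

lemma finV: "V \<in> \<V> \<Longrightarrow> finite V" using V0 finite_subset by auto

lemma root_in: "V \<in> \<V> \<Longrightarrow> enum V 0 \<in> V"
  using bij_betw_apply[OF enum_bij[OF finV], of V 0] s by auto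

lemma attach_tree:
  assumes V: "V \<in> \<V>" and A: "is_tree {..<s} A" and p: "p \<in> V0 - V" and R: "R \<in> trees (V0 - V)"
  shows "attach A V p R \<in> trees V0"
proof -
  have "is_tree ((V0 - V) \<union> V) (R \<union> edge p (enum V 0) \<union> place V A)"
    by (rule is_tree_glue[OF place_tree[OF finV[OF V] _ A]]) (use V R p root_in[OF V] in \<open>auto simp: trees_def\<close>)
  moreover have "(V0 - V) \<union> V = V0" using V by auto
  ultimately show ?thesis by (simp add: trees_def attach_def)
qed

lemma touching_attach:
  assumes V: "V \<in> \<V>" and A: "is_tree {..<s} A" and p: "p \<in> V0 - V" and R: "R \<in> trees (V0 - V)"
  shows "touching (attach A V p R) V = place V A \<union> edge p (enum V 0)"
    and "attach A V p R - touching (attach A V p R) V = R"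
proof -
  have R': "fst a \<notin> V" "snd a \<notin> V" if "a \<in> R" for a
    using is_tree_subset[of "V0 - V" R] R that by (auto simp: trees_def)
  have P: "fst a \<in> V" if "a \<in> place V A" for a
    using is_tree_subset[OF place_tree[OF finV[OF V] _ A]] V that by auto
  have E: "fst a \<in> V \<or> snd a \<in> V" if "a \<in> edge p (enum V 0)" for a
    using that root_in[OF V] by (auto simp: edge_def)
  show "touching (attach A V p R) V = place V A \<union> edge p (enum V 0)"
    unfolding touching_def attach_def using R' P E by blast
  show "attach A V p R - touching (attach A V p R) V = R"
    unfolding touching_def attach_def using R' P E by blast
qed

text \<open>The tree outside the fringe and the attachment vertex can be chosen freely and do not
  depend on \<open>A\<close>. Together with \<open>attach_inj\<close> this makes replacing
  \<open>A\<close> by \<open>B\<close> a bijection.\<close>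

lemma fringe_iff:
  assumes V: "V \<in> \<V>" and A: "is_tree {..<s} A"
  shows "{T \<in> trees V0. fringe V0 A V T} = (\<lambda>(p, R). attach A V p R) ` slots V"
proof
  show "(\<lambda>(p, R). attach A V p R) ` slots V \<subseteq> {T \<in> trees V0. fringe V0 A V T}"
    using attach_tree[OF V A] touching_attach(1)[OF V A] by (auto simp: fringe_def)
  show "{T \<in> trees V0. fringe V0 A V T} \<subseteq> (\<lambda>(p, R). attach A V p R) ` slots V"
  proof
    fix T assume T: "T \<in> {T \<in> trees V0. fringe V0 A V T}"
    then obtain p where p: "p \<in> V0 - V" "touching T V = place V A \<union> edge p (enum V 0)"
      by (auto simp: fringe_def)
    have t: "is_tree V0 T" using T by (simp add: trees_def)
    define R where "R = T - touching T V"
    have "touching T V \<subseteq> T" by (auto simp: touching_def)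
    then have eq: "T = R \<union> edge p (enum V 0) \<union> place V A" using p(2) unfolding R_def by blast
    have "R \<subseteq> (V0 - V) \<times> (V0 - V)"
      using is_tree_subset[OF t] unfolding R_def touching_def by fastforce
    moreover have "is_tree ((V0 - V) \<union> V) (R \<union> edge p (enum V 0) \<union> place V A)"
      using t eq V by (simp add: Un_absorb2)
    ultimately have "is_tree (V0 - V) R"
      using is_tree_unglue[OF place_tree[OF finV[OF V] _ A]] V p(1) root_in[OF V] by blast
    then have "(p, R) \<in> slots V" using p(1) by (simp add: trees_def)
    moreover have "T = (\<lambda>(p, R). attach A V p R) (p, R)" using eq by (simp add: attach_def)
    ultimately show "T \<in> (\<lambda>(p, R). attach A V p R) ` slots V" by (rule rev_image_eqI)
  qed
qed

lemma attach_inj: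
  assumes V: "V \<in> \<V>" and A: "is_tree {..<s} A"
  shows "inj_on (\<lambda>(p, R). attach A V p R) (slots V)"
proof (rule inj_onI)
  fix x y assume x: "x \<in> slots V" and y: "y \<in> slots V"
    and eq: "(\<lambda>(p, R). attach A V p R) x = (\<lambda>(p, R). attach A V p R) y"
  obtain p R q S where xy: "x = (p, R)" "y = (q, S)" by (metis surj_pair)
  have h: "p \<in> V0 - V" "R \<in> trees (V0 - V)" "q \<in> V0 - V" "S \<in> trees (V0 - V)" using x y xy by auto
  have e: "attach A V p R = attach A V q S" using eq xy by simp
  have "R = S" using touching_attach(2)[OF V A h(1,2)] touching_attach(2)[OF V A h(3,4)] e by simp
  have sub: "place V A \<subseteq> V \<times> V" using is_tree_subset[OF place_tree[OF finV[OF V] _ A]] V by auto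
  have "place V A \<union> edge p (enum V 0) = place V A \<union> edge q (enum V 0)"
    using touching_attach(1)[OF V A h(1,2)] touching_attach(1)[OF V A h(3,4)] e by simp
  then have "(p, enum V 0) \<in> place V A \<union> edge q (enum V 0)" by auto
  then have "p = q" using sub h(1) root_in[OF V] by auto
  then show "x = y" using \<open>R = S\<close> xy by simp
qed

lemma finite_trees_V0: "finite (trees V0)" using V0 by (rule finite_trees)

text \<open>Arcs leaving a fringe all end in its attachment vertex. If two different fringes of the
  same size overlap, each contains the attachment vertex of the other, so their union has no
  outgoing arc. By connectivity it would be all of \<open>V0\<close>, which
  \<open>2 * s < card V0\<close> rules out.\<close>

lemma fringe_overlap:
  assumes V: "V \<in> \<V>" and V': "V' \<in> \<V>" and A: "is_tree {..<s} A" and A': "is_tree {..<s} A'"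
    and T: "T \<in> trees V0" and f: "fringe V0 A V T" and f': "fringe V0 A' V' T" and ov: "V \<inter> V' \<noteq> {}"
  shows "V = V'"
proof (rule ccontr)
  assume ne: "V \<noteq> V'"
  obtain p where p: "p \<in> V0 - V" "touching T V = place V A \<union> edge p (enum V 0)" using f by (auto simp: fringe_def)
  obtain p' where p': "p' \<in> V0 - V'" "touching T V' = place V' A' \<union> edge p' (enum V' 0)" using f' by (auto simp: fringe_def)
  have t: "is_tree V0 T" using T by (simp add: trees_def)
  have leave: "b = q" if h: "W \<in> \<V>" "is_tree {..<s} D" "touching T W = place W D \<union> edge q (enum W 0)"
    "(a, b) \<in> T" "a \<in> W" "b \<notin> W" for W D q a b
  proof -
    have "(a, b) \<in> place W D \<union> edge q (enum W 0)" using h(3-5) by (auto simp: touching_def)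
    moreover have "place W D \<subseteq> W \<times> W" using is_tree_subset[OF place_tree[OF finV[OF h(1)] _ h(2)]] h(1) by auto
    ultimately show "b = q" using h(6) root_in[OF h(1)] by auto
  qed
  have cross: "q \<in> W'" if h: "W \<in> \<V>" "is_tree {..<s} D" "touching T W = place W D \<union> edge q (enum W 0)"
    "W' \<in> \<V>" "is_tree {..<s} D'" "touching T W' = place W' D' \<union> edge q' (enum W' 0)" "W \<inter> W' \<noteq> {}" "W \<noteq> W'"
    for W W' D D' q q'
  proof -
    have t': "is_tree W' (place W' D')" using place_tree[OF finV[OF h(4)] _ h(5)] h(4) by auto
    have "\<not> W' \<subseteq> W" using card_subset_eq[OF finV[OF h(1)], of W'] h(1,4,8) by auto
    then obtain v where v: "v \<in> W'" "v \<notin> W" by blast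
    obtain u where u: "u \<in> W" "u \<in> W'" using h(7) by blast
    have "(u, v) \<in> (place W' D')\<^sup>*" by (rule is_tree_connected[OF t' u(2) v(1)])
    then have "\<exists>a b. (a, b) \<in> place W' D' \<and> a \<in> W \<and> b \<notin> W" using u(1) v(2)
      by (induction rule: rtrancl_induct) auto
    then obtain a b where ab: "(a, b) \<in> place W' D'" "a \<in> W" "b \<notin> W" by blast
    have "(a, b) \<in> T" using ab(1) h(6) by (auto simp: touching_def)
    then have "b = q" by (rule leave[OF h(1,2,3) _ ab(2,3)])
    then show "q \<in> W'" using ab(1) is_tree_subset[OF t'] by auto
  qed
  have pV': "p \<in> V'" by (rule cross[OF V A p(2) V' A' p'(2) ov ne])
  have p'V: "p' \<in> V" using cross[OF V' A' p'(2) V A p(2)] ov ne by blast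
  have "card (V \<union> V') \<le> 2 * s" using card_Un_le[of V V'] V V' by simp
  then have "V \<union> V' \<noteq> V0" using s by auto
  then obtain v where v: "v \<in> V0" "v \<notin> V \<union> V'" using V V' by blast
  obtain u where u: "u \<in> V" "u \<in> V0" using ov V by blast
  have "(u, v) \<in> T\<^sup>*" by (rule is_tree_connected[OF t u(2) v(1)])
  then have "\<exists>a b. (a, b) \<in> T \<and> a \<in> V \<union> V' \<and> b \<notin> V \<union> V'" using u(1) v(2)
    by (induction rule: rtrancl_induct) auto
  then obtain a b where ab: "(a, b) \<in> T" "a \<in> V \<union> V'" "b \<notin> V" "b \<notin> V'" by blast
  show False
  proof (cases "a \<in> V")
    case True
    then show False using leave[OF V A p(2) ab(1) _ ab(3)] pV' ab(4) by simp
  next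
    case False
    then have "a \<in> V'" using ab(2) by simp
    then show False using leave[OF V' A' p'(2) ab(1) _ ab(4)] p'V ab(3) by simp
  qed
qed

section \<open>The score of a tree and the Cauchy-Schwarz bound\<close>

context
  fixes A B :: "nat rel"
  assumes A: "is_tree {..<s} A" and B: "is_tree {..<s} B" and AB: "A \<noteq> B"
begin

definition y :: "nat set \<Rightarrow> nat rel \<Rightarrow> real" where
  "y V T = of_bool (fringe V0 A V T) - of_bool (fringe V0 B V T)"

definition Y :: "nat rel \<Rightarrow> real" where
  "Y T = (\<Sum>V \<in> \<V>. y V T)"

text \<open>The number of pairs of a vertex set and a tree with an \<open>A\<close>-fringe there; it
  is the same for \<open>B\<close>.\<close>

definition Q :: real where "Q = (\<Sum>V \<in> \<V>. real (card (slots V)))"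

lemma finite_\<V>: "finite \<V>" using V0 by simp

lemma sum_y:
  assumes V: "V \<in> \<V>"
  shows "(\<Sum>T \<in> trees V0. y V T * g T) = (\<Sum>(p, R) \<in> slots V. g (attach A V p R) - g (attach B V p R))"
proof -
  have one: "(\<Sum>T \<in> trees V0. of_bool (fringe V0 D V T) * g T) = (\<Sum>(p, R) \<in> slots V. g (attach D V p R))"
    if D: "is_tree {..<s} D" for D
  proof -
    have "(\<Sum>T \<in> trees V0. of_bool (fringe V0 D V T) * g T) = (\<Sum>T \<in> {T \<in> trees V0. fringe V0 D V T}. g T)"
      using finite_trees_V0 by (intro sum.mono_neutral_cong_right) auto
    also have "\<dots> = (\<Sum>(p, R) \<in> slots V. g (attach D V p R))"
      unfolding fringe_iff[OF V D] by (subst sum.reindex[OF attach_inj[OF V D]]) (simp add: case_prod_beta o_def)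
    finally show ?thesis .
  qed
  have "(\<Sum>T \<in> trees V0. y V T * g T)
      = (\<Sum>T \<in> trees V0. of_bool (fringe V0 A V T) * g T) - (\<Sum>T \<in> trees V0. of_bool (fringe V0 B V T) * g T)"
    unfolding y_def left_diff_distrib by (rule sum_subtractf)
  then show ?thesis unfolding one[OF A] one[OF B] by (simp add: sum_subtractf case_prod_beta)
qed

lemma sum_Y:
  "(\<Sum>T \<in> trees V0. Y T * g T) = (\<Sum>V \<in> \<V>. \<Sum>(p, R) \<in> slots V. g (attach A V p R) - g (attach B V p R))"
proof -
  have "(\<Sum>T \<in> trees V0. Y T * g T) = (\<Sum>V \<in> \<V>. \<Sum>T \<in> trees V0. y V T * g T)"
    unfolding Y_def sum_distrib_right by (rule sum.swap)
  also have "\<dots> = (\<Sum>V \<in> \<V>. \<Sum>(p, R) \<in> slots V. g (attach A V p R) - g (attach B V p R))"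
    by (rule sum.cong[OF refl sum_y])
  finally show ?thesis .
qed

lemma fringe_attach_same:
  assumes V: "V \<in> \<V>" and D: "is_tree {..<s} D" "is_tree {..<s} D'" and p: "p \<in> V0 - V" and R: "R \<in> trees (V0 - V)"
  shows "fringe V0 D' V (attach D V p R) \<longleftrightarrow> D' = D"
proof
  assume "D' = D"
  then show "fringe V0 D' V (attach D V p R)"
    unfolding fringe_def using touching_attach(1)[OF V D(1) p R] p by blast
next
  assume "fringe V0 D' V (attach D V p R)"
  then obtain q where q: "q \<in> V0 - V" "place V D \<union> edge p (enum V 0) = place V D' \<union> edge q (enum V 0)"
    unfolding fringe_def touching_attach(1)[OF V D(1) p R] by blast
  have sub: "place V E \<subseteq> V \<times> V" if "is_tree {..<s} E" for E
    using is_tree_subset[OF place_tree[OF finV[OF V] _ that]] V by auto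
  have cut: "(place V E \<union> edge u (enum V 0)) \<inter> V \<times> V = place V E" if "is_tree {..<s} E" "u \<in> V0 - V" for E u
    using sub[OF that(1)] that(2) by (auto simp: edge_def)
  have "place V D = place V D'" using cut[OF D(1) p] cut[OF D(2) q(1)] q(2) by simp
  then show "D' = D"
    using place_inj[OF finV[OF V] _ is_tree_subset[OF D(1)] is_tree_subset[OF D(2)]] V by auto
qed

text \<open>If \<open>V'\<close> is disjoint from \<open>V\<close>, the arcs touching it are the
  same in both trees; if it overlaps \<open>V\<close>, neither tree has a fringe at
  \<open>V'\<close> by \<open>fringe_overlap\<close>.\<close>

lemma y_attach_other:
  assumes V: "V \<in> \<V>" and V': "V' \<in> \<V>" "V' \<noteq> V" and p: "p \<in> V0 - V" and R: "R \<in> trees (V0 - V)"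
  shows "y V' (attach A V p R) = y V' (attach B V p R)"
proof (cases "V \<inter> V' = {}")
  case True
  have eq: "touching (attach D V p R) V' = touching (R \<union> edge p (enum V 0)) V'" if D: "is_tree {..<s} D" for D
  proof -
    have "fst a \<notin> V' \<and> snd a \<notin> V'" if "a \<in> place V D" for a
    proof -
      have "a \<in> V \<times> V" using is_tree_subset[OF place_tree[OF finV[OF V] _ D]] V that by auto
      then show ?thesis using True by auto
    qed
    then show ?thesis unfolding touching_def attach_def by blast
  qed
  show ?thesis unfolding y_def fringe_def eq[OF A] eq[OF B] ..
next
  case False
  have no: "\<not> fringe V0 E V' (attach D V p R)" if "is_tree {..<s} D" "is_tree {..<s} E" for D E
  proof
    assume "fringe V0 E V' (attach D V p R)"
    moreover have "fringe V0 D V (attach D V p R)" using fringe_attach_same[OF V that(1) that(1) p R] by simp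
    ultimately have "V = V'"
      by (intro fringe_overlap[OF V V'(1) that attach_tree[OF V that(1) p R] _ _ False])
    then show False using V'(2) by simp
  qed
  show ?thesis unfolding y_def using no A B by simp
qed

lemma Y_attach:
  assumes V: "V \<in> \<V>" and p: "p \<in> V0 - V" and R: "R \<in> trees (V0 - V)"
  shows "Y (attach A V p R) - Y (attach B V p R) = 2"
proof -
  have "Y (attach A V p R) - Y (attach B V p R) = (\<Sum>V' \<in> \<V>. y V' (attach A V p R) - y V' (attach B V p R))"
    unfolding Y_def by (rule sum_subtractf[symmetric])
  also have "\<dots> = (\<Sum>V' \<in> {V}. y V' (attach A V p R) - y V' (attach B V p R))"
    by (rule sum.mono_neutral_right[OF finite_\<V>]) (use V y_attach_other[OF V _ _ p R] in auto)
  also have "\<dots> = 2"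
    using AB fringe_attach_same[OF V A A p R] fringe_attach_same[OF V A B p R]
      fringe_attach_same[OF V B A p R] fringe_attach_same[OF V B B p R] by (simp add: y_def)
  finally show ?thesis .
qed

text \<open>\<open>sum_Y\<close> is applied twice: with \<open>f\<close> shifted by a constant it
  gives \<open>D * Q\<close>, and with \<open>Y\<close> itself it gives \<open>2 * Q\<close> because
  a switch changes \<open>Y\<close> by 2. The Cauchy-Schwarz inequality compares the two.\<close>

lemma variance_lower_bound:
  assumes f: "\<And>V p R. V \<in> \<V> \<Longrightarrow> p \<in> V0 - V \<Longrightarrow> R \<in> trees (V0 - V) \<Longrightarrow> f (attach A V p R) - f (attach B V p R) = D"
  shows "D\<^sup>2 * Q \<le> 2 * (\<Sum>T \<in> trees V0. (f T - c)\<^sup>2)"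
proof -
  have const: "(\<Sum>V \<in> \<V>. \<Sum>(p, R) \<in> slots V. g (attach A V p R) - g (attach B V p R)) = d * Q"
    if "\<And>V p R. V \<in> \<V> \<Longrightarrow> p \<in> V0 - V \<Longrightarrow> R \<in> trees (V0 - V) \<Longrightarrow> g (attach A V p R) - g (attach B V p R) = d"
    for g :: "nat rel \<Rightarrow> real" and d
  proof -
    have "(\<Sum>V \<in> \<V>. \<Sum>(p, R) \<in> slots V. g (attach A V p R) - g (attach B V p R)) = (\<Sum>V \<in> \<V>. \<Sum>x \<in> slots V. d)"
      by (intro sum.cong refl) (use that in auto)
    then show ?thesis by (simp add: Q_def sum_distrib_left mult.commute)
  qed
  have fY: "(\<Sum>T \<in> trees V0. Y T * (f T - c)) = D * Q"
    unfolding sum_Y by (rule const) (use f in simp)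
  have YY: "(\<Sum>T \<in> trees V0. Y T * Y T) = 2 * Q"
    unfolding sum_Y by (rule const) (use Y_attach in simp)
  have "(D * Q)\<^sup>2 \<le> (\<Sum>T \<in> trees V0. (Y T)\<^sup>2) * (\<Sum>T \<in> trees V0. (f T - c)\<^sup>2)"
    unfolding fY[symmetric] by (rule Cauchy_Schwarz_ineq_sum)
  also have "(\<Sum>T \<in> trees V0. (Y T)\<^sup>2) = 2 * Q" unfolding power2_eq_square YY ..
  finally have *: "Q * (D\<^sup>2 * Q) \<le> Q * (2 * (\<Sum>T \<in> trees V0. (f T - c)\<^sup>2))"
    by (simp add: power2_eq_square mult_ac)
  have Q0: "Q \<ge> 0" unfolding Q_def by (simp add: sum_nonneg)
  show ?thesis
  proof (cases "Q = 0")
    case True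
    then show ?thesis by (simp add: sum_nonneg)
  next
    case False
    then have "Q > 0" using Q0 by simp
    then show ?thesis using * by simp
  qed
qed

end

lemma card_slots:
  assumes V: "V \<in> \<V>"
  shows "real (card (slots V)) = real (card V0 - s) ^ (card V0 - s - 1)"
proof -
  have c: "card (V0 - V) = card V0 - s" using V finV[OF V] by (simp add: card_Diff_subset)
  have "card V0 - s \<noteq> 0" using s by simp
  then obtain j where j: "card V0 - s = Suc j" using not0_implies_Suc by blast
  have "finite (V0 - V)" using V0 by simp
  from cayley[OF this, of j] have "card (slots V) = Suc j ^ j"
    unfolding card_cartesian_product c j by simp
  then show ?thesis unfolding j by simp
qed

text \<open>Three estimates, with k = n - s: the binomial coefficient is at least (n / s)^s;
  Cayley's formula gives k^(k-1) slots for each vertex set; and n / k = 1 + s / k is at most exp (s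
  / k), so replacing k by n costs no more than the factor exp s.\<close>

lemma sum_card_slots_lower:
  "(\<Sum>V \<in> \<V>. real (card (slots V))) \<ge> real (card (trees V0)) * (real (card V0) * (exp (- real s) / real s ^ s))"
proof -
  define n where "n = card V0"
  have n: "2 * s < n" "n > 0" "s > 0" using s by (auto simp: n_def)
  have t: "real (card (trees V0)) * real n = real n ^ (n - 1)"
  proof -
    have "card V0 = Suc (n - 1)" using n by (simp add: n_def)
    from cayley[OF V0 this] have "n * card (trees V0) = n ^ (n - 1)" using n by simp
    then show ?thesis by (metis mult.commute of_nat_mult of_nat_power)
  qed
  define k where "k = n - s"
  have k: "k > 0" "n = k + s" using n by (auto simp: k_def)
  have sum: "(\<Sum>V \<in> \<V>. real (card (slots V))) = real (n choose s) * real k ^ (k - 1)"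
    using card_slots n_subsets[OF V0, of s] by (simp add: n_def k_def)
  have bin: "(real n / real s) ^ s \<le> real (n choose s)"
    using binomial_ge_n_over_k_pow_k[of s n, where 'a = real] n by simp
  have pow: "real n ^ (k - 1) * exp (- real s) \<le> real k ^ (k - 1)"
  proof -
    let ?r = "real n / real k"
    have "?r = 1 + real s / real k" using k by (simp add: add_divide_distrib)
    also have "\<dots> \<le> exp (real s / real k)" by (rule exp_ge_add_one_self)
    finally have "?r ^ (k - 1) \<le> exp (real s / real k) ^ (k - 1)" by (rule power_mono) simp
    also have "\<dots> = exp (real (k - 1) * (real s / real k))" by (simp only: exp_of_nat_mult)
    also have "\<dots> \<le> exp (real s)"
    proof -
      have "real (k - 1) * real s \<le> real k * real s" by (intro mult_right_mono) auto
      then have "real (k - 1) * (real s / real k) \<le> real s"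
        using k(1) by (simp only: times_divide_eq_right pos_divide_le_eq of_nat_0_less_iff mult.commute)
      then show ?thesis by simp
    qed
    finally have "?r ^ (k - 1) * exp (- real s) \<le> exp (real s) * exp (- real s)" by (intro mult_right_mono) auto
    also have "\<dots> = 1" by (simp add: exp_minus)
    finally have "real n ^ (k - 1) / real k ^ (k - 1) * exp (- real s) \<le> 1" by (simp only: power_divide)
    then show ?thesis using k(1) by (simp add: field_simps)
  qed
  have "(real n / real s) ^ s * (real n ^ (k - 1) * exp (- real s)) \<le> (\<Sum>V \<in> \<V>. real (card (slots V)))"
    unfolding sum by (rule mult_mono[OF bin pow]) simp_all
  moreover have "(real n / real s) ^ s * (real n ^ (k - 1) * exp (- real s))
      = real n ^ (n - 1) * (exp (- real s) / real s ^ s)"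
  proof -
    have "s + (k - 1) = n - 1" using k by simp
    then have "real n ^ s * real n ^ (k - 1) = real n ^ (n - 1)"
      by (simp only: power_add[symmetric])
    then show ?thesis by (simp add: power_divide mult_ac)
  qed
  ultimately show ?thesis unfolding n_def[symmetric] t[symmetric] by (simp add: mult.assoc)
qed

end

section \<open>Handles that shield a fringe from its surroundings\<close>

context tree_pattern
begin

text \<open>One more than the diameter bound, so an occurrence that meets the far end of the handle
  or anything beyond it stays clear of vertex 0.\<close>

definition hl :: nat where "hl = radius + 1"

definition handle :: "nat rel" where "handle = (\<Union>i < hl. edge i (Suc i))"

lemma handle_tree:
  assumes "hl < s" "is_tree {hl..<s} C"
  shows "is_tree {..<s} (handle \<union> C)"
proof -
  have "is_tree {j..<s} (C \<union> (\<Union>i \<in> {j..<hl}. edge i (Suc i)))" if "j \<le> hl" for j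
    using that
  proof (induction rule: inc_induct)
    case base
    show ?case using assms(2) by simp
  next
    case (step j)
    have "is_tree (insert j {Suc j..<s}) ((C \<union> (\<Union>i \<in> {Suc j..<hl}. edge i (Suc i))) \<union> edge (Suc j) j)"
      by (rule is_tree.leaf[OF step.IH]) (use step.hyps assms(1) in auto)
    moreover have "insert j {Suc j..<s} = {j..<s}" using step.hyps assms(1) by auto
    moreover have "{j..<hl} = insert j {Suc j..<hl}" using step.hyps by auto
    ultimately show ?case by (simp add: edge_commute[of "Suc j" j] Un_ac)
  qed
  from this[of 0] show ?thesis by (simp add: handle_def atLeast0LessThan Un_commute)
qed

lemma depth_rball:
  fixes D :: "'b \<Rightarrow> nat"
  assumes lip: "\<And>u v. (u, v) \<in> \<Gamma> \<Longrightarrow> D u \<le> D v + 1" and "z \<in> rball \<Gamma> k x"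
  shows "D x \<le> D z + k"
  using assms(2)
proof (induction k arbitrary: z)
  case 0
  then show ?case by (simp add: rball_def)
next
  case (Suc k)
  then obtain w where w: "w \<in> rball \<Gamma> k x" "w = z \<or> (w, z) \<in> \<Gamma>" by (auto simp: rball_def)
  have "D w \<le> D z + 1" using w(2) lip by auto
  then show ?case using Suc.IH[OF w(1)] by simp
qed

text \<open>Depth along the handle, cut off at \<open>hl\<close> and 0 outside the fringe, changes
  by at most one along an arc. An occurrence that meets depth \<open>hl\<close> therefore has
  positive depth throughout, and at such vertices the host has exactly the arcs of the placed
  copy.\<close>

lemma occs_attach:
  assumes fs: "fringe_setting V0 s" and V: "V \<subseteq> V0" "card V = s" and hl: "hl < s"
    and C: "is_tree {hl..<s} C" and p: "p \<in> V0 - V" and R: "R \<in> trees (V0 - V)"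
  shows "{q \<in> occs (attach (handle \<union> C) V p R). fst q \<inter> enum V ` {hl..<s} \<noteq> {}}
       = {q \<in> occs (place V (handle \<union> C)). fst q \<inter> enum V ` {hl..<s} \<noteq> {}}"
proof -
  interpret fringe_setting V0 s by fact
  let ?e = "enum V" and ?A = "handle \<union> C" and ?X = "enum V ` {hl..<s}"
  let ?T = "attach ?A V p R"
  have VV: "V \<in> \<V>" using V by simp
  have e: "bij_betw ?e {..<s} V" using enum_bij[OF finV[OF VV]] V(2) by simp
  have inj: "inj_on ?e {..<s}" using e by (rule bij_betw_imp_inj_on)
  have im: "?e ` {..<s} = V" using e by (rule bij_betw_imp_surj_on)
  define D where "D = (\<lambda>v. if v \<in> V then min (the_inv_into {..<s} ?e v) hl else 0)"
  have De: "D (?e i) = min i hl" if "i < s" for i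
    using that im the_inv_into_f_f[OF inj] by (auto simp: D_def)
  have Dout: "D v = 0" if "v \<notin> V" for v using that by (simp add: D_def)
  have Csub: "C \<subseteq> {hl..<s} \<times> {hl..<s}" by (rule is_tree_subset[OF C])
  have Asub: "?A \<subseteq> {..<s} \<times> {..<s}" by (rule is_tree_subset[OF handle_tree[OF hl C]])
  have lipA: "min i hl \<le> min j hl + 1" if "(i, j) \<in> ?A" for i j
    using that Csub by (auto simp: handle_def)
  have lipP: "D u \<le> D v + 1" if "(u, v) \<in> place V ?A" for u v
  proof -
    obtain i j where ij: "(i, j) \<in> ?A" "u = ?e i" "v = ?e j" using \<open>(u, v) \<in> place V ?A\<close> by (auto simp: place_def)
    then have "i < s" "j < s" using Asub by auto
    then show ?thesis using De lipA[OF ij(1)] ij by simp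
  qed
  have root0: "D (enum V 0) = 0" using De[of 0] s by simp
  have lipT: "D u \<le> D v + 1" if uv: "(u, v) \<in> ?T" for u v
  proof -
    consider "(u, v) \<in> R" | "(u, v) \<in> edge p (enum V 0)" | "(u, v) \<in> place V ?A"
      using uv by (auto simp: attach_def)
    then show ?thesis
    proof cases
      case 1
      then have "u \<notin> V" using is_tree_subset[of "V0 - V" R] R by (auto simp: trees_def)
      then show ?thesis using Dout by simp
    next
      case 2
      then show ?thesis using root0 Dout p by auto
    qed (rule lipP)
  qed
  have inside: "u \<in> V \<and> u \<noteq> enum V 0"
    if q: "(U, W) \<in> occs \<Gamma>" and lip: "\<And>u v. (u, v) \<in> \<Gamma> \<Longrightarrow> D u \<le> D v + 1" and X: "U \<inter> ?X \<noteq> {}" and u: "u \<in> U"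
    for U W u and \<Gamma> :: "nat rel"
  proof -
    obtain x where x: "x \<in> U" "x \<in> ?X" using X by auto
    then obtain i where i: "i \<in> {hl..<s}" "x = ?e i" by auto
    have "u \<in> rball \<Gamma> radius x" using occs_rball[OF q order_refl x(1)] u by auto
    from depth_rball[of \<Gamma> D, OF lip this] have "hl \<le> D u + radius" using De[of i] i by simp
    then have "D u \<noteq> 0" by (simp add: hl_def)
    then show ?thesis using Dout root0 by metis
  qed
  have agree: "(u, z) \<in> ?T \<longleftrightarrow> (u, z) \<in> place V ?A" if "u \<in> V" "u \<noteq> enum V 0" for u z
  proof -
    have "(u, z) \<notin> R" using that(1) is_tree_subset[of "V0 - V" R] R by (auto simp: trees_def)
    moreover have "(u, z) \<notin> edge p (enum V 0)" using that p by auto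
    ultimately show ?thesis unfolding attach_def by blast
  qed
  have iff: "(U, W) \<in> occs ?T \<longleftrightarrow> (U, W) \<in> occs (place V ?A)" if X: "U \<inter> ?X \<noteq> {}" for U W
  proof
    assume q: "(U, W) \<in> occs ?T"
    have "\<forall>u \<in> U. \<forall>z. (u, z) \<in> ?T \<longleftrightarrow> (u, z) \<in> place V ?A"
      using inside[OF q lipT X] agree by blast
    then show "(U, W) \<in> occs (place V ?A)" using occs_agree q by blast
  next
    assume q: "(U, W) \<in> occs (place V ?A)"
    have "\<forall>u \<in> U. \<forall>z. (u, z) \<in> ?T \<longleftrightarrow> (u, z) \<in> place V ?A"
      using inside[OF q lipP X] agree by blast
    then show "(U, W) \<in> occs ?T" using occs_agree q by blast
  qed
  show ?thesis
  proof (rule set_eqI)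
    fix q show "q \<in> {q \<in> occs ?T. fst q \<inter> ?X \<noteq> {}} \<longleftrightarrow> q \<in> {q \<in> occs (place V ?A). fst q \<inter> ?X \<noteq> {}}"
      using iff[of "fst q" "snd q"] by auto
  qed
qed

text \<open>The two hosts have different arcs only beyond the handle, and so have the two placed
  copies. Both differences of counts reduce to the same occurrences by \<open>occs_attach\<close>,
  so the surroundings drop out.\<close>

lemma diff_attach:
  assumes fs: "fringe_setting V0 s" and V: "V \<subseteq> V0" "card V = s" and hl: "hl < s"
    and C: "is_tree {hl..<s} C" and C': "is_tree {hl..<s} C'" and p: "p \<in> V0 - V" and R: "R \<in> trees (V0 - V)"
  shows "real (card (occs (attach (handle \<union> C) V p R))) - real (card (occs (attach (handle \<union> C') V p R)))
    = real (card (occs (handle \<union> C))) - real (card (occs (handle \<union> C')))"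
proof -
  interpret fringe_setting V0 s by fact
  let ?X = "enum V ` {hl..<s}"
  have VV: "V \<in> \<V>" using V by simp
  have inj: "inj_on (enum V) {..<s}" using bij_betw_imp_inj_on[OF enum_bij[OF finV[OF VV]]] V(2) by simp
  have fin: "finite (attach (handle \<union> D) V p R)" "finite (place V (handle \<union> D))" if "is_tree {hl..<s} D" for D
    using is_tree_finite_arcs attach_tree[OF VV handle_tree[OF hl that] p R] place_tree[OF finV[OF VV] V(2) handle_tree[OF hl that]]
    by (auto simp: trees_def)
  have Csub: "(x, z) \<in> place V D \<Longrightarrow> x \<in> ?X" if "is_tree {hl..<s} D" for D x z
    using is_tree_subset[OF that] by (auto simp: place_def)
  have pl: "place V (handle \<union> D) = place V handle \<union> place V D" for D by (simp add: place_def image_Un)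
  have agP: "agree_off ?X (place V (handle \<union> C)) (place V (handle \<union> C'))"
    using Csub[OF C] Csub[OF C'] unfolding agree_off_def pl by blast
  have agT: "agree_off ?X (attach (handle \<union> C) V p R) (attach (handle \<union> C') V p R)"
    using Csub[OF C] Csub[OF C'] unfolding agree_off_def attach_def pl by blast
  have cnt: "card (occs (handle \<union> D)) = card (occs (place V (handle \<union> D)))" if "is_tree {hl..<s} D" for D
    unfolding place_def
    by (rule occs_image(2)[OF inj is_tree_subset[OF handle_tree[OF hl that]], symmetric])
  show ?thesis
    unfolding cnt[OF C] cnt[OF C'] diff_card_occs[OF fin(1)[OF C] fin(1)[OF C'] agT]
      diff_card_occs[OF fin(2)[OF C] fin(2)[OF C'] agP]
      occs_attach[OF fs V hl C p R] occs_attach[OF fs V hl C' p R] ..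
qed

lemma variance_trees_lower:
  assumes hl: "hl < s" and C: "is_tree {hl..<s} C" "is_tree {hl..<s} C'"
    and ne: "card (occs (handle \<union> C)) \<noteq> card (occs (handle \<union> C'))"
  shows "\<exists>c > 0. \<forall>V0 :: nat set. finite V0 \<longrightarrow> 2 * s < card V0 \<longrightarrow>
    variance_on (trees V0) (\<lambda>A. real (card (occs A))) \<ge> c * real (card V0)"
proof -
  let ?D = "real (card (occs (handle \<union> C))) - real (card (occs (handle \<union> C')))"
  let ?c = "?D\<^sup>2 / 2 * (exp (- real s) / real s ^ s)"
  have s0: "0 < s" using hl by simp
  have c: "?c > 0" using ne s0 by simp
  have main: "?c * real (card V0) \<le> variance_on (trees V0) (\<lambda>A. real (card (occs A)))"
    if V0p: "finite (V0 :: nat set)" "2 * s < card V0" for V0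
  proof -
    interpret fringe_setting V0 s by unfold_locales (use V0p s0 in auto)
    let ?f = "\<lambda>A. real (card (occs A))" and ?t = "real (card (trees V0))"
    let ?S = "\<Sum>T \<in> trees V0. (?f T - mean (trees V0) ?f)\<^sup>2"
    have fs: "fringe_setting V0 s" ..
    have t: "?t > 0"
    proof -
      have "card V0 = Suc (card V0 - 1)" using V0p by simp
      from cayley[OF V0p(1) this] have "card (trees V0) \<noteq> 0" by (metis mult_0_right power_eq_0_iff nat.distinct(1))
      then show ?thesis by simp
    qed
    have neq: "handle \<union> C \<noteq> handle \<union> C'" using ne by auto
    have "?D\<^sup>2 * (\<Sum>V \<in> \<V>. real (card (slots V))) \<le> 2 * ?S"
      using variance_lower_bound[OF handle_tree[OF hl C(1)] handle_tree[OF hl C(2)] neq, of ?f ?D "mean (trees V0) ?f"]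
        diff_attach[OF fs _ _ hl C] unfolding Q_def[OF handle_tree[OF hl C(1)] handle_tree[OF hl C(2)] neq] by blast
    moreover have "?D\<^sup>2 * (?t * (real (card V0) * (exp (- real s) / real s ^ s)))
        \<le> ?D\<^sup>2 * (\<Sum>V \<in> \<V>. real (card (slots V)))"
      by (intro mult_left_mono sum_card_slots_lower) simp
    ultimately have le: "?D\<^sup>2 * (?t * (real (card V0) * (exp (- real s) / real s ^ s))) \<le> 2 * ?S"
      by (rule order_trans[rotated])
    have eq: "?t * (?c * real (card V0))
        = ?D\<^sup>2 * (?t * (real (card V0) * (exp (- real s) / real s ^ s))) / 2" by (simp add: mult_ac)
    have half: "a \<le> b" if "e \<le> 2 * b" "a = e / 2" for a b e :: real using that by simp
    have "?t * (?c * real (card V0)) \<le> ?S" by (rule half[OF le eq])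
    then have "?c * real (card V0) \<le> ?S / ?t" using t by (simp only: pos_le_divide_eq mult.commute)
    also have "?S / ?t = variance_on (trees V0) ?f"
      unfolding variance_on_def by (rule mean_def[symmetric])
    finally show ?thesis .
  qed
  show ?thesis by (intro exI[of _ ?c] conjI c allI impI main)
qed

end

subsection \<open>Distinguishing gadgets\<close>

definition seg :: "nat \<Rightarrow> nat \<Rightarrow> nat rel" where
  "seg a s = {(i, j). a \<le> i \<and> a \<le> j \<and> i < s \<and> j < s \<and> (j = Suc i \<or> i = Suc j)}"

text \<open>A long path looks like this away from its ends, so embeddings that avoid 0 describe the
  occurrences in the interior of paths.\<close>

definition ray :: "nat rel" where
  "ray = {(i, j). j = Suc i \<or> i = Suc j}"

lemma seg_iff: "(i, j) \<in> seg a s \<longleftrightarrow> a \<le> i \<and> a \<le> j \<and> i < s \<and> j < s \<and> (j = Suc i \<or> i = Suc j)"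
  by (simp add: seg_def)

lemma ray_iff: "(i, j) \<in> ray \<longleftrightarrow> j = Suc i \<or> i = Suc j"
  by (simp add: ray_def)

lemma seg_tree: "a < s \<Longrightarrow> is_tree {a..<s} (seg a s)"
proof (induction s)
  case (Suc s)
  show ?case
  proof (cases "a = s")
    case True
    have "seg a (Suc s) = {}" "{a..<Suc s} = {a}" using True by (auto simp: seg_def)
    then show ?thesis using is_tree.single[of a] by simp
  next
    case False
    then have as: "a < s" using Suc.prems by simp
    obtain k where k: "s = Suc k" using as by (cases s) auto
    have "is_tree (insert s {a..<s}) (seg a s \<union> edge k s)"
      by (rule is_tree.leaf[OF Suc.IH[OF as]]) (use as k in auto)
    moreover have "insert s {a..<s} = {a..<Suc s}" using as by auto
    moreover have "seg a s \<union> edge k s = seg a (Suc s)"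
    proof (rule set_eqI)
      fix p show "p \<in> seg a s \<union> edge k s \<longleftrightarrow> p \<in> seg a (Suc s)"
        using as k by (cases p) (auto simp: seg_iff)
    qed
    ultimately show ?thesis by simp
  qed
qed simp

lemma seg_degree: "finite (seg a s `` {v})" "card (seg a s `` {v}) \<le> 2"
proof -
  have sub: "seg a s `` {v} \<subseteq> {Suc v, v - 1}" by (auto simp: seg_iff)
  show "finite (seg a s `` {v})" by (rule finite_subset[OF sub]) simp
  have "card (seg a s `` {v}) \<le> card {Suc v, v - 1}" by (rule card_mono[OF _ sub]) simp
  then show "card (seg a s `` {v}) \<le> 2" by (simp add: card_insert_if split: if_splits)
qed

definition slot :: "nat \<Rightarrow> nat \<Rightarrow> nat \<Rightarrow> nat \<Rightarrow> nat" where
  "slot h q i x = h + 1 + i * q + x"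

lemma slot_inj:
  assumes "slot h q i x = slot h q j y" "x < q" "y < q" shows "i = j \<and> x = y"
proof -
  have e: "x + i * q = y + j * q" using assms(1) by (simp add: slot_def)
  have "(x + i * q) div q = i" "(y + j * q) div q = j" using assms(2,3) by simp_all
  then have "i = j" using e by simp
  then show ?thesis using e by simp
qed

lemma slot_surj:
  assumes "h < v" "v < h + 1 + m * q" obtains i x where "i < m" "x < q" "v = slot h q i x"
proof -
  let ?w = "v - h - 1"
  have w: "?w < m * q" using assms by simp
  then have q: "0 < q" by (cases q) auto
  have "?w div q < m" using w by (simp add: less_mult_imp_div_less)
  moreover have "?w mod q < q" using q by simp
  moreover have "v = slot h q (?w div q) (?w mod q)" using assms(1) by (simp add: slot_def)
  ultimately show thesis by (rule that)
qed

definition star_of :: "nat \<Rightarrow> nat \<Rightarrow> nat \<Rightarrow> nat rel \<Rightarrow> nat \<Rightarrow> nat rel" where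
  "star_of h m q R \<rho> = (\<Union>i < m. edge h (slot h q i \<rho>) \<union> map_prod (slot h q i) (slot h q i) ` R)"

lemma star_of_tree:
  assumes R: "is_tree {..<q} R" and \<rho>: "\<rho> < q"
  shows "is_tree {h..<h + 1 + m * q} (star_of h m q R \<rho>)"
proof (induction m)
  case 0
  have "{h..<h + 1 + 0 * q} = {h}" by auto
  then show ?case using is_tree.single[of h] by (simp add: star_of_def)
next
  case (Suc m)
  have inj: "inj_on (slot h q m) {..<q}" by (rule inj_onI) (simp add: slot_def)
  have im: "slot h q m ` {..<q} = {h + 1 + m * q..<h + 1 + Suc m * q}"
  proof
    show "{h + 1 + m * q..<h + 1 + Suc m * q} \<subseteq> slot h q m ` {..<q}"
    proof
      fix v assume "v \<in> {h + 1 + m * q..<h + 1 + Suc m * q}"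
      then show "v \<in> slot h q m ` {..<q}"
        by (intro image_eqI[of _ _ "v - (h + 1 + m * q)"]) (auto simp: slot_def)
    qed
  qed (auto simp: slot_def)
  have "is_tree ({h..<h + 1 + m * q} \<union> slot h q m ` {..<q})
      (star_of h m q R \<rho> \<union> edge h (slot h q m \<rho>) \<union> map_prod (slot h q m) (slot h q m) ` R)"
    by (rule is_tree_glue[OF is_tree_image[OF R inj] Suc]) (use \<rho> in \<open>auto simp: slot_def\<close>)
  moreover have "{h..<h + 1 + m * q} \<union> slot h q m ` {..<q} = {h..<h + 1 + Suc m * q}"
    unfolding im by auto
  moreover have "star_of h m q R \<rho> \<union> edge h (slot h q m \<rho>) \<union> map_prod (slot h q m) (slot h q m) ` R
      = star_of h (Suc m) q R \<rho>"
    by (simp add: star_of_def lessThan_Suc Un_ac)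
  ultimately show ?case by (simp only:)
qed

section \<open>Occurrences in paths and in bouquets\<close>

context tree_pattern
begin

lemma neighbour:
  assumes "x \<in> VH" obtains y where "y \<in> VH" "(x, y) \<in> AH" "(y, x) \<in> AH" "y \<noteq> x"
proof -
  have "AH `` {x} \<noteq> {}"
  proof
    assume "AH `` {x} = {}"
    from is_tree_isolated[OF tree assms this] have "card VH = 1" by simp
    then show False using card_VH by simp
  qed
  then obtain y where y: "(x, y) \<in> AH" by auto
  moreover have "(y, x) \<in> AH" by (rule is_tree_sym[OF tree y])
  moreover have "y \<noteq> x" using y is_tree_irrefl[OF tree] by metis
  ultimately show thesis using that AH_sub by blast
qed

lemma crossing:
  assumes "x \<in> VH" "x \<in> S" "y \<in> VH" "y \<notin> S"
  obtains u v where "(u, v) \<in> AH" "u \<in> S" "v \<notin> S"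
proof -
  have "(x, y) \<in> AH\<^sup>*" by (rule is_tree_connected[OF tree assms(1,3)])
  then have "\<exists>u v. (u, v) \<in> AH \<and> u \<in> S \<and> v \<notin> S" using assms(2,4)
    by (induction rule: rtrancl_induct) auto
  then show thesis using that by blast
qed

lemma emb_occs: "emb A f \<Longrightarrow> (f ` VH, f ` WH) \<in> occs A"
  unfolding occs_def by blast

lemma card_occs_ge:
  assumes "finite A" "finite I" "\<And>i. i \<in> I \<Longrightarrow> emb A (f i)" "inj_on (\<lambda>i. f i ` VH) I"
  shows "card I \<le> card (occs A)"
proof -
  have "inj_on (\<lambda>i. (f i ` VH, f i ` WH)) I"
    using assms(4) by (auto simp: inj_on_def)
  then have "card I = card ((\<lambda>i. (f i ` VH, f i ` WH)) ` I)" by (rule card_image[symmetric])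
  also have "\<dots> \<le> card (occs A)"
    by (rule card_mono[OF finite_occs[OF assms(1)]]) (use assms(3) emb_occs in blast)
  finally show ?thesis .
qed

lemma handle_iff: "(i, j) \<in> handle \<longleftrightarrow> (j = Suc i \<and> i < hl) \<or> (i = Suc j \<and> j < hl)"
  by (auto simp: handle_def)

lemma handle_seg: "hl < s \<Longrightarrow> handle \<union> seg hl s = seg 0 s"
proof -
  assume s: "hl < s"
  show ?thesis
  proof (rule set_eqI)
    fix p show "p \<in> handle \<union> seg hl s \<longleftrightarrow> p \<in> seg 0 s"
      using s by (cases p) (auto simp: seg_iff handle_iff)
  qed
qed

lemma finite_seg: "finite (seg a s)"
  by (rule finite_subset[of _ "{..<s} \<times> {..<s}"]) (auto simp: seg_def)

text \<open>Degrees in a path are at most 2, so boundedly many occurrences meet a given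
  vertex.\<close>

lemma path_count_linear: "card (occs (seg 0 s)) \<le> s * (3 ^ radius) ^ card VH"
proof -
  have "occs (seg 0 s) \<subseteq> (\<Union>v < s. {p \<in> occs (seg 0 s). fst p \<inter> {v} \<noteq> {}})"
  proof
    fix p assume p: "p \<in> occs (seg 0 s)"
    have "fst p \<noteq> {}" using occs_nonempty[of "fst p" "snd p"] p by simp
    then obtain v where v: "v \<in> fst p" by auto
    have "fst p \<subseteq> Field (seg 0 s)" using occs_Field[of "fst p" "snd p"] p by simp
    then have "v < s" using v by (auto simp: Field_def seg_iff)
    then show "p \<in> (\<Union>v < s. {p \<in> occs (seg 0 s). fst p \<inter> {v} \<noteq> {}})" using p v by blast
  qed
  then have "card (occs (seg 0 s)) \<le> card (\<Union>v < s. {p \<in> occs (seg 0 s). fst p \<inter> {v} \<noteq> {}})"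
    using finite_occs[OF finite_seg] by (intro card_mono) auto
  also have "\<dots> \<le> (\<Sum>v < s. card {p \<in> occs (seg 0 s). fst p \<inter> {v} \<noteq> {}})" by (rule card_UN_le) simp
  also have "\<dots> \<le> (\<Sum>v < s. (3 ^ radius) ^ card VH)"
  proof (rule sum_mono)
    fix v
    show "card {p \<in> occs (seg 0 s). fst p \<inter> {v} \<noteq> {}} \<le> (3 ^ radius) ^ card VH"
      using card_occs_meeting[OF order_refl seg_degree, of "{v}" 0 s] by simp
  qed
  finally show ?thesis by simp
qed

lemma emb_seg_ray:
  assumes "f ` VH \<subseteq> {1..<s - 1}"
  shows "emb (seg 0 s) f \<longleftrightarrow> emb ray f"
proof (rule emb_agree, intro ballI allI)
  fix u z assume "u \<in> f ` VH"
  then have "1 \<le> u" "u < s - 1" using assms by auto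
  then show "(u, z) \<in> seg 0 s \<longleftrightarrow> (u, z) \<in> ray" by (auto simp: seg_iff ray_iff)
qed

text \<open>An occurrence away from both ends would give an embedding into \<open>ray\<close> that
  avoids 0, so all occurrences meet one of the two ends.\<close>

lemma path_count_bounded:
  assumes no: "\<not> (\<exists>f. emb ray f \<and> 0 \<notin> f ` VH)"
  shows "card (occs (seg 0 s)) \<le> (2 * 3 ^ radius) ^ card VH"
proof -
  have "occs (seg 0 s) = {p \<in> occs (seg 0 s). fst p \<inter> {0, s - 1} \<noteq> {}}"
  proof -
    have meets: "fst p \<inter> {0, s - 1} \<noteq> {}" if p: "p \<in> occs (seg 0 s)" for p
    proof
      assume e: "fst p \<inter> {0, s - 1} = {}"
      obtain f where f: "emb (seg 0 s) f" "p = (f ` VH, f ` WH)" using p by (auto simp: occs_def)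
      have "f ` VH \<subseteq> {..<s}" using occs_Field[OF emb_occs[OF f(1)]] by (fastforce simp: Field_def seg_iff)
      then have "f ` VH \<subseteq> {1..<s - 1}" using e f(2) by (force simp: Suc_le_eq)
      then have "emb ray f" "0 \<notin> f ` VH" using emb_seg_ray f(1) by auto
      then show False using no by blast
    qed
    show ?thesis
    proof (rule set_eqI)
      fix p show "p \<in> occs (seg 0 s) \<longleftrightarrow> p \<in> {p \<in> occs (seg 0 s). fst p \<inter> {0, s - 1} \<noteq> {}}"
        using meets[of p] by blast
    qed
  qed
  then have "card (occs (seg 0 s)) = card {p \<in> occs (seg 0 s). fst p \<inter> {0, s - 1} \<noteq> {}}" by simp
  also have "\<dots> \<le> (card {0, s - 1} * (2 + 1) ^ radius) ^ card VH"
    by (rule card_occs_meeting[OF order_refl seg_degree]) simp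
  also have "\<dots> \<le> (2 * 3 ^ radius) ^ card VH"
    by (intro power_mono mult_mono) (auto simp: card_insert_if)
  finally show ?thesis .
qed

abbreviation bouquet :: "nat \<Rightarrow> nat \<Rightarrow> nat rel \<Rightarrow> nat \<Rightarrow> nat rel" where
  "bouquet m q R \<rho> \<equiv> handle \<union> star_of hl m q R \<rho>"

lemma bouquet_copy:
  assumes R: "R \<subseteq> {..<q} \<times> {..<q}" and \<rho>: "\<rho> < q" and i: "i < m" and x: "x < q"
  shows "(slot hl q i x, z) \<in> bouquet m q R \<rho> \<longleftrightarrow> (z = hl \<and> x = \<rho>) \<or> (\<exists>y. (x, y) \<in> R \<and> z = slot hl q i y)"
proof
  assume "(slot hl q i x, z) \<in> bouquet m q R \<rho>"
  moreover have "(slot hl q i x, z) \<notin> handle" by (auto simp: handle_iff slot_def)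
  ultimately have "(slot hl q i x, z) \<in> star_of hl m q R \<rho>" by blast
  then obtain j where "j \<in> {..<m}"
    "(slot hl q i x, z) \<in> edge hl (slot hl q j \<rho>) \<union> map_prod (slot hl q j) (slot hl q j) ` R"
    unfolding star_of_def by (rule UN_E)
  then have j: "j < m"
    "(slot hl q i x, z) \<in> edge hl (slot hl q j \<rho>) \<or> (slot hl q i x, z) \<in> map_prod (slot hl q j) (slot hl q j) ` R"
    by simp_all
  from j(2) show "(z = hl \<and> x = \<rho>) \<or> (\<exists>y. (x, y) \<in> R \<and> z = slot hl q i y)"
  proof
    assume "(slot hl q i x, z) \<in> edge hl (slot hl q j \<rho>)"
    moreover have "slot hl q i x \<noteq> hl" by (simp add: slot_def)
    ultimately have "z = hl" "slot hl q i x = slot hl q j \<rho>" by auto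
    then show ?thesis using slot_inj[OF _ x \<rho>] by blast
  next
    assume "(slot hl q i x, z) \<in> map_prod (slot hl q j) (slot hl q j) ` R"
    then obtain a b where ab: "(a, b) \<in> R" "slot hl q i x = slot hl q j a" "z = slot hl q j b" by auto
    have "a < q" using ab(1) R by auto
    then have "i = j \<and> x = a" by (rule slot_inj[OF ab(2) x])
    then show ?thesis using ab(1,3) by blast
  qed
next
  assume "(z = hl \<and> x = \<rho>) \<or> (\<exists>y. (x, y) \<in> R \<and> z = slot hl q i y)"
  then show "(slot hl q i x, z) \<in> bouquet m q R \<rho>"
  proof
    assume "z = hl \<and> x = \<rho>"
    then have "(slot hl q i x, z) \<in> edge hl (slot hl q i \<rho>)" by simp
    from UnI1[OF this] have "(slot hl q i x, z) \<in> star_of hl m q R \<rho>"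
      unfolding star_of_def using i by (intro UN_I[of i]) simp_all
    then show ?thesis by (rule UnI2)
  next
    assume "\<exists>y. (x, y) \<in> R \<and> z = slot hl q i y"
    then obtain y where "(x, y) \<in> R" "z = slot hl q i y" by blast
    then have "(slot hl q i x, z) \<in> map_prod (slot hl q i) (slot hl q i) ` R"
      by (intro image_eqI[of _ _ "(x, y)"]) simp_all
    from UnI2[OF this, of "edge hl (slot hl q i \<rho>)"] have "(slot hl q i x, z) \<in> star_of hl m q R \<rho>"
      unfolding star_of_def using i by (intro UN_I[of i]) simp_all
    then show ?thesis by (rule UnI2)
  qed
qed

lemma bouquet_hub:
  assumes R: "R \<subseteq> {..<q} \<times> {..<q}" and \<rho>: "\<rho> < q"
  shows "(hl, z) \<in> bouquet m q R \<rho> \<longleftrightarrow> Suc z = hl \<or> (\<exists>i < m. z = slot hl q i \<rho>)"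
proof -
  have 1: "(hl, z) \<in> handle \<longleftrightarrow> Suc z = hl" by (auto simp: handle_iff)
  have 2: "(hl, z) \<in> edge hl (slot hl q i \<rho>) \<longleftrightarrow> z = slot hl q i \<rho>" for i by (auto simp: slot_def)
  have 3: "(hl, z) \<notin> map_prod (slot hl q i) (slot hl q i) ` R" for i by (auto simp: slot_def)
  show ?thesis unfolding star_of_def using 1 2 3 by auto
qed

lemma bouquet_gadget:
  assumes "is_tree {..<q} R" "\<rho> < q" "0 < m"
  shows "hl < hl + 1 + m * q" "is_tree {hl..<hl + 1 + m * q} (star_of hl m q R \<rho>)"
    "is_tree {hl..<hl + 1 + m * q} (seg hl (hl + 1 + m * q))" "finite (bouquet m q R \<rho>)"
proof -
  show 1: "hl < hl + 1 + m * q" by simp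
  show 2: "is_tree {hl..<hl + 1 + m * q} (star_of hl m q R \<rho>)" by (rule star_of_tree[OF assms(1,2)])
  show "is_tree {hl..<hl + 1 + m * q} (seg hl (hl + 1 + m * q))" by (rule seg_tree[OF 1])
  show "finite (bouquet m q R \<rho>)" by (rule is_tree_finite_arcs[OF handle_tree[OF 1 2]])
qed

definition distinguished :: bool where
  "distinguished \<longleftrightarrow> (\<exists>s C C'. hl < s \<and> is_tree {hl..<s} C \<and> is_tree {hl..<s} C' \<and>
     card (occs (handle \<union> C)) \<noteq> card (occs (handle \<union> C')))"

lemma distinguishedI:
  assumes "is_tree {..<q} R" "\<rho> < q" "0 < m"
    and "card (occs (bouquet m q R \<rho>)) \<noteq> card (occs (seg 0 (hl + 1 + m * q)))"
  shows distinguished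
  unfolding distinguished_def
  using bouquet_gadget[OF assms(1-3)] assms(4) handle_seg[of "hl + 1 + m * q"] by metis

text \<open>
  If the pattern does not occur inside a long path, the path has boundedly many occurrences, but a bouquet of
  copies of the pattern has arbitrarily many. Otherwise the pattern is itself a path and the count of
  a path is linear in its length. If \<open>WH\<close> contains an inner vertex, place it at the hub of a bouquet of
  paths: any two legs carry an occurrence, so their number is quadratic. If \<open>WH\<close> consists of end vertices,
  a star has boundedly many occurrences.
\<close>

lemma distinguished_pendant:
  assumes no: "\<not> (\<exists>f. emb ray f \<and> 0 \<notin> f ` VH)"
  shows distinguished
proof -
  let ?q = "card VH"
  obtain g where g: "bij_betw g VH {..<?q}"
    using ex_bij_betw_finite_nat[OF finite_VH] by (auto simp: atLeast0LessThan)
  have gi: "inj_on g VH" and gim: "g ` VH = {..<?q}" using g by (auto simp: bij_betw_def)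
  have gq: "g x < ?q" if "x \<in> VH" for x using gim that by auto
  \<comment> \<open>Copies are joined to the hub at a vertex of \<open>WH\<close>, since only such
    vertices may have neighbours outside an occurrence.\<close>
  obtain w where w: "w \<in> WH" "w \<in> VH" using WH WH_ne by auto
  define R where "R = map_prod g g ` AH"
  have R: "is_tree {..<?q} R" using is_tree_image[OF tree gi] gim by (simp add: R_def)
  have Rsub: "R \<subseteq> {..<?q} \<times> {..<?q}" by (rule is_tree_subset[OF R])
  have Riff: "(g x, z) \<in> R \<longleftrightarrow> (\<exists>y. (x, y) \<in> AH \<and> z = g y)" if "x \<in> VH" for x z
  proof
    assume "(g x, z) \<in> R"
    then obtain a b where ab: "(a, b) \<in> AH" "g x = g a" "z = g b" by (auto simp: R_def)
    then have "a = x" using inj_onD[OF gi ab(2) that] AH_sub by auto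
    then show "\<exists>y. (x, y) \<in> AH \<and> z = g y" using ab by blast
  next
    assume "\<exists>y. (x, y) \<in> AH \<and> z = g y"
    then obtain y where "(x, y) \<in> AH" "z = g y" by blast
    then show "(g x, z) \<in> R" unfolding R_def by (intro image_eqI[of _ _ "(x, y)"]) simp_all
  qed
  \<comment> \<open>One copy more than the bound of \<open>path_count_bounded\<close>.\<close>
  define m :: nat where "m = (2 * 3 ^ radius) ^ card VH + 1"
  let ?B = "bouquet m ?q R (g w)"
  let ?f = "\<lambda>i x. slot hl ?q i (g x)"
  have nb: "(?f i x, z) \<in> ?B \<longleftrightarrow> (z = hl \<and> x = w) \<or> (\<exists>y. (x, y) \<in> AH \<and> z = ?f i y)"
    if "i < m" "x \<in> VH" for i x z
  proof -
    have "g x = g w \<longleftrightarrow> x = w" using gi that(2) w(2) by (auto dest: inj_onD)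
    then show ?thesis
      unfolding bouquet_copy[OF Rsub gq[OF w(2)] that(1) gq[OF that(2)]] Riff[OF that(2)] by blast
  qed
  have sinj: "?f i x = ?f j y \<longleftrightarrow> i = j \<and> x = y" if "x \<in> VH" "y \<in> VH" for i j x y
    using slot_inj[OF _ gq[OF that(1)] gq[OF that(2)]] inj_onD[OF gi _ that] by blast
  have emb: "emb ?B (?f i)" if i: "i \<in> {..<m}" for i
    unfolding emb_def
  proof (intro conjI ballI allI impI)
    show "inj_on (?f i) VH" using sinj by (auto simp: inj_on_def)
    fix x y assume xy: "x \<in> VH" "y \<in> VH"
    have "?f i y \<noteq> hl" by (simp add: slot_def)
    then show "(x, y) \<in> AH \<longleftrightarrow> (?f i x, ?f i y) \<in> ?B"
      using nb[of i x "?f i y"] i xy sinj[OF xy(2)] AH_sub by auto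
  next
    fix x z assume x: "x \<in> VH - WH" and z: "(?f i x, z) \<in> ?B"
    then have "x \<noteq> w" "x \<in> VH" using w by auto
    then obtain y where "(x, y) \<in> AH" "z = ?f i y" using nb[of i x z] i z by auto
    then show "z \<in> ?f i ` VH" using AH_sub by auto
  qed
  have "inj_on (\<lambda>i. ?f i ` VH) {..<m}"
  proof (rule inj_onI)
    fix i j assume "?f i ` VH = ?f j ` VH"
    then have "?f i w \<in> ?f j ` VH" using w(2) by blast
    then show "i = j" using sinj[OF w(2)] by auto
  qed
  then have "card {..<m} \<le> card (occs ?B)"
    using bouquet_gadget(4)[OF R gq[OF w(2)]] emb by (intro card_occs_ge) (auto simp: m_def)
  moreover have "card (occs (seg 0 (hl + 1 + m * ?q))) < m"
    using path_count_bounded[OF no] by (simp add: m_def less_Suc_eq_le)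
  ultimately have "card (occs ?B) \<noteq> card (occs (seg 0 (hl + 1 + m * ?q)))" by simp
  then show ?thesis by (rule distinguishedI[OF R gq[OF w(2)], rotated]) (simp add: m_def)
qed

section \<open>Patterns that occur inside a path\<close>

context
  fixes f0 :: "'a \<Rightarrow> nat"
  assumes f0: "emb ray f0" and f0_0: "0 \<notin> f0 ` VH"
begin

definition lo :: nat where "lo = Min (f0 ` VH)"
definition hi :: nat where "hi = Max (f0 ` VH)"

lemma f0_inj: "inj_on f0 VH" using f0 by (simp add: emb_def)

lemma f0_arc: "x \<in> VH \<Longrightarrow> y \<in> VH \<Longrightarrow> (x, y) \<in> AH \<longleftrightarrow> f0 y = Suc (f0 x) \<or> f0 x = Suc (f0 y)"
  using f0 by (simp add: emb_def ray_iff)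

lemma lo_hi: "lo \<in> f0 ` VH" "hi \<in> f0 ` VH" "x \<in> VH \<Longrightarrow> lo \<le> f0 x \<and> f0 x \<le> hi"
  using finite_VH is_tree_nonempty[OF tree] by (auto simp: lo_def hi_def)

text \<open>The pattern is connected and arcs of \<open>ray\<close> step by one, so no value between
  the extremes can be skipped.\<close>

lemma f0_image: "f0 ` VH = {lo..hi}"
proof
  show "f0 ` VH \<subseteq> {lo..hi}" using lo_hi(3) by auto
  show "{lo..hi} \<subseteq> f0 ` VH"
  proof
    fix c assume c: "c \<in> {lo..hi}"
    show "c \<in> f0 ` VH"
    proof (rule ccontr)
      assume nc: "c \<notin> f0 ` VH"
      obtain x y where x: "x \<in> VH" "f0 x = lo" and y: "y \<in> VH" "f0 y = hi" using lo_hi(1,2) by auto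
      have "f0 x < c" "c \<le> f0 y" using c x y nc lo_hi(1) by (auto simp: order_le_less)
      then have "x \<in> {v. f0 v < c}" "y \<notin> {v. f0 v < c}" by auto
      from crossing[OF x(1) this(1) y(1) this(2)]
      obtain u v where uv: "(u, v) \<in> AH" "f0 u < c" "c \<le> f0 v" by (auto simp: not_less)
      then have "u \<in> VH" "v \<in> VH" using AH_sub by auto
      then have "f0 v = Suc (f0 u)" using f0_arc uv by auto
      then have "f0 v = c" using uv by simp
      then show False using nc \<open>v \<in> VH\<close> by auto
    qed
  qed
qed

lemma lo_pos: "1 \<le> lo" using f0_0 lo_hi(1) by (cases lo) auto

lemma card_interval: "card VH = hi + 1 - lo" "lo \<le> hi"
proof -
  have "card VH = card (f0 ` VH)" using card_image[OF f0_inj] by simp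
  then show "card VH = hi + 1 - lo" unfolding f0_image by simp
  show "lo \<le> hi" using lo_hi(1) f0_image by auto
qed

text \<open>An end of the interval has a further neighbour on the ray outside the image, which only
  vertices of \<open>WH\<close> may have. At the lower end this neighbour exists because the image
  avoids 0.\<close>

lemma ends_W:
  assumes "x \<in> VH" "f0 x = lo \<or> f0 x = hi" shows "x \<in> WH"
proof (rule ccontr)
  assume "x \<notin> WH"
  then have out: "z \<in> {lo..hi}" if "(f0 x, z) \<in> ray" for z
    using f0 assms(1) that unfolding emb_def f0_image by blast
  show False
    using assms(2) out[of "f0 x - 1"] out[of "Suc (f0 x)"] lo_pos by (auto simp: ray_iff)
qed

lemma inner: "x \<in> VH - WH \<Longrightarrow> lo < f0 x \<and> f0 x < hi"
  using ends_W[of x] lo_hi(3)[of x] by (auto simp: order_le_less)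

lemma three: "3 \<le> card VH"
proof (rule ccontr)
  assume "\<not> 3 \<le> card VH"
  then have "hi \<le> Suc lo" using card_interval by simp
  then have "x \<in> WH" if "x \<in> VH" for x
    using ends_W[OF that] lo_hi(3)[OF that] by (auto simp: le_Suc_eq order_le_less)
  then have "WH = VH" using WH by blast
  then show False using nondeg \<open>\<not> 3 \<le> card VH\<close> by simp
qed

lemma path_count_lower: "s - card VH \<le> card (occs (seg 0 s))"
proof -
  let ?f = "\<lambda>t x. f0 x - lo + t"
  have "emb (seg 0 s) (?f t)" if t: "t \<in> {..<s - card VH}" for t
    unfolding emb_def
  proof (intro conjI ballI allI impI)
    have le: "f0 x - lo + t < s - 1" if "x \<in> VH" for x
      using lo_hi(3)[OF that] t card_interval by auto
    show "inj_on (?f t) VH"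
    proof (rule inj_onI)
      fix x y assume h: "x \<in> VH" "y \<in> VH" "?f t x = ?f t y"
      then have "f0 x = f0 y" using lo_hi(3) by (metis add_right_cancel eq_diff_iff)
      then show "x = y" using inj_onD[OF f0_inj] h by blast
    qed
    fix x y assume xy: "x \<in> VH" "y \<in> VH"
    show "(x, y) \<in> AH \<longleftrightarrow> (?f t x, ?f t y) \<in> seg 0 s"
      unfolding f0_arc[OF xy] seg_iff using le[OF xy(1)] le[OF xy(2)] lo_hi(3)[OF xy(1)] lo_hi(3)[OF xy(2)] by auto
  next
    fix x z assume x: "x \<in> VH - WH" and z: "(?f t x, z) \<in> seg 0 s"
    have i: "lo < f0 x" "f0 x < hi" using inner[OF x] by auto
    then have "z = ?f t x + 1 \<or> z + 1 = ?f t x" using z by (auto simp: seg_iff)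
    then have "z - t + lo \<in> {lo..hi} \<and> z = (z - t + lo) - lo + t" using i by auto
    then have "z - t + lo \<in> f0 ` VH" "z = (z - t + lo) - lo + t" unfolding f0_image by auto
    then obtain y where "y \<in> VH" "f0 y = z - t + lo" by auto
    then show "z \<in> ?f t ` VH" using \<open>z = (z - t + lo) - lo + t\<close> by (intro image_eqI[of _ _ y]) auto
  qed
  moreover have "inj_on (\<lambda>t. ?f t ` VH) {..<s - card VH}"
  proof (rule inj_onI)
    fix t t' assume e: "?f t ` VH = ?f t' ` VH"
    obtain x where x: "x \<in> VH" "f0 x = lo" using lo_hi(1) by auto
    have "t' \<le> t" if "?f t ` VH = ?f t' ` VH" for t t'
    proof -
      have "?f t x \<in> ?f t' ` VH" using x(1) that by blast
      then show ?thesis using x(2) by auto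
    qed
    then show "t = t'" using e by (metis antisym)
  qed
  ultimately have "card {..<s - card VH} \<le> card (occs (seg 0 s))"
    by (intro card_occs_ge finite_seg) auto
  then show ?thesis by simp
qed

lemma distinguished_spider:
  assumes x0: "x0 \<in> WH" "lo < f0 x0" "f0 x0 < hi"
  shows distinguished
proof -
  let ?q = "card VH"
  define c where "c = f0 x0"
  have c: "lo < c" "c < hi" "x0 \<in> VH" using x0 WH by (auto simp: c_def)
  have q: "?q = hi + 1 - lo" "0 < ?q" using card_interval by auto
  define R where "R = seg 0 ?q"
  have R: "is_tree {..<?q} R" using seg_tree[OF q(2)] by (simp add: R_def atLeast0LessThan)
  have Rsub: "R \<subseteq> {..<?q} \<times> {..<?q}" by (rule is_tree_subset[OF R])
  define K where "K = ((3::nat) ^ radius) ^ card VH"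
  \<comment> \<open>The path with as many vertices as a bouquet of \<open>2 * k\<close> legs and its
    handle has at most \<open>k * ((hl + 1 + 2 * ?q) * K)\<close> occurrences; \<open>k\<close>
    exceeds the second factor, so \<open>k * k\<close> wins.\<close>
  define k where "k = (hl + 1 + 2 * ?q) * K + 1"
  let ?m = "2 * k"
  let ?B = "bouquet ?m ?q R 0"
  let ?S = "slot hl ?q"
  have leg: "(?S i a, z) \<in> ?B \<longleftrightarrow> (z = hl \<and> a = 0) \<or> (\<exists>b < ?q. (b = Suc a \<or> a = Suc b) \<and> z = ?S i b)"
    if "i < ?m" "a < ?q" for i a z
    unfolding bouquet_copy[OF Rsub q(2) that] using that(2) by (auto simp: R_def seg_iff)
  have hub: "(hl, z) \<in> ?B \<longleftrightarrow> Suc z = hl \<or> (\<exists>i < ?m. z = ?S i 0)" for z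
    by (rule bouquet_hub[OF Rsub q(2)])
  have Shl: "?S i a \<noteq> hl" "Suc (?S i a) \<noteq> hl" for i a by (auto simp: slot_def)
  have same: "?S i a = ?S i b \<longleftrightarrow> a = b" for i a b by (simp add: slot_def)
  have ex2: "(\<exists>b < ?q. (b = Suc a \<or> a = Suc b) \<and> ?S i x = ?S i b) \<longleftrightarrow> x = Suc a \<or> a = Suc x"
    if "x < ?q" for a i x
  proof
    assume "\<exists>b < ?q. (b = Suc a \<or> a = Suc b) \<and> ?S i x = ?S i b"
    then obtain b where b: "b = Suc a \<or> a = Suc b" "?S i x = ?S i b" by blast
    have "x = b" using b(2) unfolding same .
    then show "x = Suc a \<or> a = Suc x" using b(1) by simp
  next
    assume "x = Suc a \<or> a = Suc x"
    then show "\<exists>b < ?q. (b = Suc a \<or> a = Suc b) \<and> ?S i x = ?S i b" using that by (intro exI[of _ x]) simp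
  qed
  \<comment> \<open>The vertex \<open>x0\<close> of \<open>WH\<close> sits at the hub, the part of
    the interval below \<open>c\<close> runs outwards along leg \<open>i\<close> and the part above
    along leg \<open>j\<close>. Further legs at the hub do no harm, as it is the image of a vertex
    of \<open>WH\<close>.\<close>
  define \<psi> where "\<psi> = (\<lambda>(i, j) v. if v < c then ?S i (c - v - 1) else if v = c then hl else ?S j (v - c - 1))"
  have small: "c - v - 1 < ?q" "v - c - 1 < ?q" if "v \<in> {lo..hi}" for v using that c q(1) by auto
  have \<psi>_inj: "\<psi> (i, j) v = \<psi> (i, j) v' \<longleftrightarrow> v = v'" if "i \<noteq> j" "v \<in> {lo..hi}" "v' \<in> {lo..hi}" for i j v v'
  proof
    assume e: "\<psi> (i, j) v = \<psi> (i, j) v'"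
    have mid: "\<psi> (i, j) u = hl \<longleftrightarrow> u = c" for u using Shl(1) by (simp add: \<psi>_def)
    consider (a) "v < c" "v' < c" | (b) "c < v" "c < v'" | (m) "v = c \<or> v' = c"
      | (d) "v < c" "c < v'" | (f) "c < v" "v' < c" by linarith
    then show "v = v'"
    proof cases
      case a
      then have "?S i (c - v - 1) = ?S i (c - v' - 1)" using e by (simp add: \<psi>_def)
      from slot_inj[OF this small(1)[OF that(2)] small(1)[OF that(3)]] show ?thesis using a by linarith
    next
      case b
      then have "?S j (v - c - 1) = ?S j (v' - c - 1)" using e by (simp add: \<psi>_def)
      from slot_inj[OF this small(2)[OF that(2)] small(2)[OF that(3)]] show ?thesis using b by linarith
    next
      case m
      then show ?thesis using mid[of v] mid[of v'] e by metis
    next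
      case d
      then have "?S i (c - v - 1) = ?S j (v' - c - 1)" using e by (simp add: \<psi>_def)
      from slot_inj[OF this small(1)[OF that(2)] small(2)[OF that(3)]] show ?thesis using that(1) by simp
    next
      case f
      then have "?S j (v - c - 1) = ?S i (c - v' - 1)" using e by (simp add: \<psi>_def)
      from slot_inj[OF this small(2)[OF that(2)] small(1)[OF that(3)]] show ?thesis using that(1) by simp
    qed
  qed simp
  have ex: "(\<exists>b < ?q. (b = Suc a \<or> a = Suc b) \<and> z = ?S i b) \<longleftrightarrow> z = ?S i (Suc a) \<or> (a \<noteq> 0 \<and> z = ?S i (a - 1))"
    if "Suc a < ?q" for a i z
  proof (cases a)
    case 0
    then show ?thesis using that by auto
  next
    case (Suc a')
    then have "a' < ?q" using that by simp
    show ?thesis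
    proof
      assume "\<exists>b < ?q. (b = Suc a \<or> a = Suc b) \<and> z = ?S i b"
      then show "z = ?S i (Suc a) \<or> (a \<noteq> 0 \<and> z = ?S i (a - 1))" using Suc by auto
    next
      assume "z = ?S i (Suc a) \<or> (a \<noteq> 0 \<and> z = ?S i (a - 1))"
      then show "\<exists>b < ?q. (b = Suc a \<or> a = Suc b) \<and> z = ?S i b"
      proof
        assume "z = ?S i (Suc a)"
        then show ?thesis using that by (intro exI[of _ "Suc a"]) simp
      next
        assume "a \<noteq> 0 \<and> z = ?S i (a - 1)"
        then show ?thesis using Suc \<open>a' < ?q\<close> by (intro exI[of _ a']) simp
      qed
    qed
  qed
  have \<psi>_nb: "(\<psi> (i, j) v, z) \<in> ?B \<longleftrightarrow> z = \<psi> (i, j) (Suc v) \<or> z = \<psi> (i, j) (v - 1)"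
    if "i < ?m" "j < ?m" "i \<noteq> j" "lo < v" "v < hi" "v \<noteq> c" for i j v z
  proof (cases "v < c")
    case True
    have a: "c - v - 1 < ?q" using small that by auto
    have 1: "\<psi> (i, j) v = ?S i (c - v - 1)" using True by (simp add: \<psi>_def)
    have 2: "\<psi> (i, j) (v - 1) = ?S i (Suc (c - v - 1))" using True that(4) by (auto simp: \<psi>_def Suc_diff_Suc)
    have 3: "\<psi> (i, j) (Suc v) = (if Suc v = c then hl else ?S i (c - v - 2))" using True by (auto simp: \<psi>_def)
    have b: "Suc (c - v - 1) < ?q" using that c q(1) by auto
    show ?thesis
    proof (cases "Suc v = c")
      case e: True
      then have "c - v - 1 = 0" by simp
      then show ?thesis unfolding 1 leg[OF that(1) a] ex[OF b] 2 3 using e by auto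
    next
      case ne: False
      then have "c - v - 1 \<noteq> 0" "c - v - 1 - 1 = c - v - 2" using True by auto
      then show ?thesis unfolding 1 leg[OF that(1) a] ex[OF b] 2 3 using ne by auto
    qed
  next
    case False
    then have vc: "c < v" using that(6) by simp
    have a: "v - c - 1 < ?q" using small that by auto
    have 1: "\<psi> (i, j) v = ?S j (v - c - 1)" using vc by (simp add: \<psi>_def)
    have 2: "\<psi> (i, j) (Suc v) = ?S j (Suc (v - c - 1))" using vc by (auto simp: \<psi>_def Suc_diff_Suc)
    have 3: "\<psi> (i, j) (v - 1) = (if v - 1 = c then hl else ?S j (v - c - 2))" using vc by (auto simp: \<psi>_def)
    have b: "Suc (v - c - 1) < ?q" using that c q(1) by auto
    show ?thesis
    proof (cases "v - 1 = c")
      case e: True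
      then have "v - c - 1 = 0" by simp
      then show ?thesis unfolding 1 leg[OF that(2) a] ex[OF b] 2 3 using e by auto
    next
      case ne: False
      then have "v - c - 1 \<noteq> 0" "v - c - 1 - 1 = v - c - 2" using vc by auto
      then show ?thesis unfolding 1 leg[OF that(2) a] ex[OF b] 2 3 using ne by auto
    qed
  qed
  have \<psi>_arc: "(\<psi> (i, j) v, \<psi> (i, j) v') \<in> ?B \<longleftrightarrow> v' = Suc v \<or> v = Suc v'"
    if ij: "i < ?m" "j < ?m" "i \<noteq> j" and v: "v \<in> {lo..hi}" and v': "v' \<in> {lo..hi}" for i j v v'
  proof -
    have symB: "(a, b) \<in> ?B \<longleftrightarrow> (b, a) \<in> ?B" for a b
      using is_tree_sym[OF handle_tree[OF bouquet_gadget(1,2)[OF R q(2)]], of ?m] by (auto simp: k_def)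
    have main: "(\<psi> (i, j) v, \<psi> (i, j) v') \<in> ?B \<longleftrightarrow> v' = Suc v \<or> v = Suc v'"
      if "v < v'" and v: "v \<in> {lo..hi}" and v': "v' \<in> {lo..hi}" for v v'
    proof -
      consider "v = c" | "v < c" "v' \<le> c" | "v < c" "c < v'" | "c < v" by linarith
      then show ?thesis
      proof cases
        case 1
        then have p: "\<psi> (i, j) v = hl" "\<psi> (i, j) v' = ?S j (v' - c - 1)" using that(1) by (auto simp: \<psi>_def)
        have "(hl, ?S j (v' - c - 1)) \<in> ?B \<longleftrightarrow> v' - c - 1 = 0"
          unfolding hub
        proof
          assume "Suc (?S j (v' - c - 1)) = hl \<or> (\<exists>l < ?m. ?S j (v' - c - 1) = ?S l 0)"
          then obtain l where "?S j (v' - c - 1) = ?S l 0" using Shl(2) by blast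
          from slot_inj[OF this small(2)[OF v'] q(2)] show "v' - c - 1 = 0" by simp
        next
          assume "v' - c - 1 = 0"
          then have "?S j (v' - c - 1) = ?S j 0" by (simp only:)
          then show "Suc (?S j (v' - c - 1)) = hl \<or> (\<exists>l < ?m. ?S j (v' - c - 1) = ?S l 0)"
            using ij(2) by blast
        qed
        then show ?thesis unfolding p using 1 that(1) by auto
      next
        case 2
        have p: "\<psi> (i, j) v = ?S i (c - v - 1)" using 2 by (simp add: \<psi>_def)
        show ?thesis
        proof (cases "v' = c")
          case True
          then have p': "\<psi> (i, j) v' = hl" by (simp add: \<psi>_def)
          show ?thesis unfolding p p' leg[OF ij(1) small(1)[OF v]] using True 2 Shl(1)[symmetric] that(1) by auto
        next
          case False
          then have p': "\<psi> (i, j) v' = ?S i (c - v' - 1)" using 2 by (simp add: \<psi>_def)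
          have "(\<psi> (i, j) v, \<psi> (i, j) v') \<in> ?B \<longleftrightarrow> (c - v' - 1 = Suc (c - v - 1) \<or> c - v - 1 = Suc (c - v' - 1))"
            unfolding p p' leg[OF ij(1) small(1)[OF v]] ex2[OF small(1)[OF v']] by (simp only: Shl(1) simp_thms)
          moreover have "(c - v' - 1 = Suc (c - v - 1) \<or> c - v - 1 = Suc (c - v' - 1)) \<longleftrightarrow> v' = Suc v \<or> v = Suc v'"
            using 2 False that(1) by arith
          ultimately show ?thesis by (simp only:)
        qed
      next
        case 3
        then have p: "\<psi> (i, j) v = ?S i (c - v - 1)" "\<psi> (i, j) v' = ?S j (v' - c - 1)" by (auto simp: \<psi>_def)
        have "\<not> (\<exists>b < ?q. (b = Suc (c - v - 1) \<or> c - v - 1 = Suc b) \<and> ?S j (v' - c - 1) = ?S i b)"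
        proof
          assume "\<exists>b < ?q. (b = Suc (c - v - 1) \<or> c - v - 1 = Suc b) \<and> ?S j (v' - c - 1) = ?S i b"
          then obtain b where "b < ?q" "?S j (v' - c - 1) = ?S i b" by blast
          from slot_inj[OF this(2) small(2)[OF v'] this(1)] show False using ij(3) by simp
        qed
        then have "(\<psi> (i, j) v, \<psi> (i, j) v') \<notin> ?B"
          unfolding p leg[OF ij(1) small(1)[OF v]] by (simp only: Shl(1) simp_thms)
        moreover have "\<not> (v' = Suc v \<or> v = Suc v')" using 3 by arith
        ultimately show ?thesis by (simp only: simp_thms)
      next
        case 4
        then have p: "\<psi> (i, j) v = ?S j (v - c - 1)" "\<psi> (i, j) v' = ?S j (v' - c - 1)" using that(1) by (auto simp: \<psi>_def)
        have "(\<psi> (i, j) v, \<psi> (i, j) v') \<in> ?B \<longleftrightarrow> (v' - c - 1 = Suc (v - c - 1) \<or> v - c - 1 = Suc (v' - c - 1))"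
          unfolding p leg[OF ij(2) small(2)[OF v]] ex2[OF small(2)[OF v']] by (simp only: Shl(1) simp_thms)
        moreover have "(v' - c - 1 = Suc (v - c - 1) \<or> v - c - 1 = Suc (v' - c - 1)) \<longleftrightarrow> v' = Suc v \<or> v = Suc v'"
          using 4 that(1) by arith
        ultimately show ?thesis by (simp only:)
      qed
    qed
    consider "v = v'" | "v < v'" | "v' < v" by linarith
    then show ?thesis
    proof cases
      case 1
      then show ?thesis
        using is_tree_irrefl[OF handle_tree[OF bouquet_gadget(1,2)[OF R q(2)]], of ?m] by (auto simp: k_def)
    next
      case 2
      then show ?thesis using main v v' by blast
    next
      case 3
      then show ?thesis using main[OF 3 v' v] symB by blast
    qed
  qed
  \<comment> \<open>One leg from the first half and one from the second: the pair can then be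
    recovered from the set of its two legs.\<close>
  let ?I = "{..<k} \<times> {k..<?m}"
  have I: "i < ?m" "j < ?m" "i \<noteq> j" if "(i, j) \<in> ?I" for i j using that by auto
  have emb: "emb ?B (\<psi> p \<circ> f0)" if p: "p \<in> ?I" for p
  proof -
    obtain i j where ij: "p = (i, j)" by (cases p)
    note I = I[of i j, OF p[unfolded ij]]
    have in_int: "f0 x \<in> {lo..hi}" if "x \<in> VH" for x using that f0_image by blast
    show ?thesis unfolding emb_def ij
    proof (intro conjI ballI allI impI)
      show "inj_on (\<psi> (i, j) \<circ> f0) VH"
      proof (rule inj_onI)
        fix x y assume h: "x \<in> VH" "y \<in> VH" "(\<psi> (i, j) \<circ> f0) x = (\<psi> (i, j) \<circ> f0) y"
        then have "f0 x = f0 y" using \<psi>_inj[OF I(3) in_int[OF h(1)] in_int[OF h(2)]] by simp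
        then show "x = y" using inj_onD[OF f0_inj] h(1,2) by blast
      qed
      fix x y assume xy: "x \<in> VH" "y \<in> VH"
      show "(x, y) \<in> AH \<longleftrightarrow> ((\<psi> (i, j) \<circ> f0) x, (\<psi> (i, j) \<circ> f0) y) \<in> ?B"
        unfolding f0_arc[OF xy] o_apply \<psi>_arc[OF I in_int[OF xy(1)] in_int[OF xy(2)]] ..
    next
      fix x z assume x: "x \<in> VH - WH" and z: "((\<psi> (i, j) \<circ> f0) x, z) \<in> ?B"
      have "f0 x \<noteq> c" using inj_onD[OF f0_inj, of x x0] x x0(1) c(3) by (auto simp: c_def)
      moreover have v: "lo < f0 x" "f0 x < hi" using inner[OF x] by auto
      ultimately have "z = \<psi> (i, j) (Suc (f0 x)) \<or> z = \<psi> (i, j) (f0 x - 1)"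
        using \<psi>_nb[OF I v] z by simp
      moreover have "Suc (f0 x) \<in> f0 ` VH" "f0 x - 1 \<in> f0 ` VH" unfolding f0_image using v by auto
      ultimately show "z \<in> (\<psi> (i, j) \<circ> f0) ` VH" unfolding image_comp[symmetric] by blast
    qed
  qed
  have "inj_on (\<lambda>p. (\<psi> p \<circ> f0) ` VH) ?I"
  proof (rule inj_onI)
    fix p p' assume p: "p \<in> ?I" and p': "p' \<in> ?I" and e: "(\<psi> p \<circ> f0) ` VH = (\<psi> p' \<circ> f0) ` VH"
    obtain i j where ij: "p = (i, j)" by (cases p)
    obtain i' j' where ij': "p' = (i', j')" by (cases p')
    have e': "\<psi> (i, j) ` {lo..hi} = \<psi> (i', j') ` {lo..hi}" using e unfolding ij ij' image_comp[symmetric] f0_image .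
    have root: "l = i' \<or> l = j'" if l: "?S l 0 \<in> \<psi> (i', j') ` {lo..hi}" for l
    proof -
      obtain v where v: "v \<in> {lo..hi}" "?S l 0 = \<psi> (i', j') v" using l by blast
      consider "v < c" | "v = c" | "c < v" by linarith
      then show ?thesis
      proof cases
        case 1
        then have "?S l 0 = ?S i' (c - v - 1)" using v(2) by (simp add: \<psi>_def)
        then show ?thesis using slot_inj[OF _ q(2) small(1)[OF v(1)]] by blast
      next
        case 2
        then show ?thesis using v(2) Shl(1) by (simp add: \<psi>_def)
      next
        case 3
        then have "?S l 0 = ?S j' (v - c - 1)" using v(2) by (simp add: \<psi>_def)
        then show ?thesis using slot_inj[OF _ q(2) small(2)[OF v(1)]] by blast
      qed
    qed
    \<comment> \<open>The neighbours of the hub in the image are the first vertices of the legs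
      used, so the image determines the legs.\<close>
    have "\<psi> (i, j) (c - 1) = ?S i 0" "\<psi> (i, j) (c + 1) = ?S j 0" using c(1) by (auto simp: \<psi>_def)
    moreover have "c - 1 \<in> {lo..hi}" "c + 1 \<in> {lo..hi}" using c(1,2) by auto
    ultimately have "?S i 0 \<in> \<psi> (i', j') ` {lo..hi}" "?S j 0 \<in> \<psi> (i', j') ` {lo..hi}"
      using e' by (metis image_eqI)+
    then have "i = i' \<or> i = j'" "j = i' \<or> j = j'" using root by auto
    then show "p = p'" using p p' unfolding ij ij' by auto
  qed
  from card_occs_ge[where f = "\<lambda>p. \<psi> p \<circ> f0", OF bouquet_gadget(4)[OF R q(2)] _ emb this]
  have "card ?I \<le> card (occs ?B)" by (simp add: k_def)
  then have lower: "k * k \<le> card (occs ?B)" by (simp add: card_cartesian_product)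
  have "card (occs (seg 0 (hl + 1 + ?m * ?q))) \<le> (hl + 1 + ?m * ?q) * K"
    unfolding K_def by (rule path_count_linear)
  also have "\<dots> \<le> (k * (hl + 1 + 2 * ?q)) * K"
  proof (rule mult_le_mono1)
    have "1 \<le> k" by (simp add: k_def)
    then have "hl + 1 \<le> k * (hl + 1)" by (metis mult_le_mono1 nat_mult_1)
    then show "hl + 1 + ?m * ?q \<le> k * (hl + 1 + 2 * ?q)" by (simp add: algebra_simps)
  qed
  also have "\<dots> = k * ((hl + 1 + 2 * ?q) * K)" by (simp only: mult.assoc)
  also have "\<dots> < k * k" by (simp add: k_def)
  finally have "card (occs (seg 0 (hl + 1 + ?m * ?q))) < card (occs ?B)" using lower by simp
  then have "card (occs ?B) \<noteq> card (occs (seg 0 (hl + 1 + ?m * ?q)))" by simp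
  then show ?thesis by (rule distinguishedI[OF R q(2), rotated]) (simp add: k_def)
qed

text \<open>An occurrence through a leaf of the star uses the hub as an inner vertex of the pattern,
  hence outside \<open>WH\<close>, and would have to contain all leaves, which are too many. So
  occurrences are confined to the handle, whereas in the path their number grows with its
  length.\<close>

lemma distinguished_star:
  assumes ends: "\<And>x. x \<in> WH \<Longrightarrow> f0 x = lo \<or> f0 x = hi"
  shows distinguished
proof -
  \<comment> \<open>The power bounds the number of occurrences among the \<open>hl + 1\<close>
    vertices of the handle; adding \<open>card VH\<close> makes up for the loss in
    \<open>path_count_lower\<close> and gives more leaves than an occurrence can contain.\<close>
  define m where "m = (hl + 1) ^ card VH + card VH"
  have m0: "0 < m" using card_VH by (simp add: m_def)
  have R: "is_tree {..<1} ({} :: nat rel)" using is_tree.single[of 0] by (simp add: lessThan_Suc)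
  let ?B = "bouquet m 1 {} 0"
  note gad = bouquet_gadget[OF R zero_less_one m0]
  have tB: "is_tree {..<hl + 1 + m * 1} ?B" by (rule handle_tree[OF gad(1,2)])
  have leaf: "(slot hl 1 i 0, z) \<in> ?B \<longleftrightarrow> z = hl" if "i < m" for i z
    using bouquet_copy[of "{}" 1 0 i m 0 z] that by simp
  have hub: "(hl, slot hl 1 i 0) \<in> ?B" if "i < m" for i
    using bouquet_hub[of "{}" 1 0 "slot hl 1 i 0" m] that by auto
  have within: "f ` VH \<subseteq> {..hl}" if f: "emb ?B f" for f
  proof (rule ccontr)
    assume "\<not> f ` VH \<subseteq> {..hl}"
    then obtain y where y: "y \<in> VH" "hl < f y" by (meson atMost_iff image_subsetI not_le)
    have "f y \<in> Field ?B" using occs_Field[OF emb_occs[OF f]] y(1) by blast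
    then have "f y < hl + 1 + m * 1" using is_tree_subset[OF tB] by (auto simp: Field_def)
    from slot_surj[OF y(2) this] obtain i a where "i < m" "a < 1" "f y = slot hl 1 i a" by blast
    then have i: "i < m" "f y = slot hl 1 i 0" by auto
    have inj: "inj_on f VH" and arc: "\<And>u v. u \<in> VH \<Longrightarrow> v \<in> VH \<Longrightarrow> (u, v) \<in> AH \<longleftrightarrow> (f u, f v) \<in> ?B"
      and out: "\<And>u z. u \<in> VH - WH \<Longrightarrow> (f u, z) \<in> ?B \<Longrightarrow> z \<in> f ` VH"
      using f unfolding emb_def by blast+
    obtain y' where y': "y' \<in> VH" "(y, y') \<in> AH" "(y', y) \<in> AH" "y' \<noteq> y" by (rule neighbour[OF y(1)])
    have fy': "f y' = hl" using arc[OF y(1) y'(1)] y'(2) leaf[OF i(1)] i(2) by simp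
    have only: "v = y'" if "(y, v) \<in> AH" for v
    proof -
      have v: "v \<in> VH" using that AH_sub by auto
      then have "f v = hl" using arc[OF y(1) v] that leaf[OF i(1)] i(2) by simp
      then show ?thesis using inj_onD[OF inj] fy' v y'(1) by simp
    qed
    have "\<not> VH \<subseteq> {y, y'}"
    proof
      assume "VH \<subseteq> {y, y'}"
      then have "card VH \<le> card {y, y'}" by (intro card_mono) auto
      also have "\<dots> \<le> 2" by (simp add: card_insert_if)
      finally show False using three by simp
    qed
    then obtain z where z: "z \<in> VH" "z \<notin> {y, y'}" by blast
    obtain u v where uv: "(u, v) \<in> AH" "u \<in> {y, y'}" "v \<notin> {y, y'}"
      by (rule crossing[OF y(1) insertI1 z])
    have "u = y'" using uv only by blast
    have v: "v \<in> VH" "v \<noteq> y" using uv AH_sub by auto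
    have "f0 y = Suc (f0 y') \<or> f0 y' = Suc (f0 y)" "f0 v = Suc (f0 y') \<or> f0 y' = Suc (f0 v)"
      using f0_arc[OF y'(1) y(1)] y'(3) f0_arc[OF y'(1) v(1)] uv(1) \<open>u = y'\<close> by auto
    moreover have "f0 y \<noteq> f0 v" using inj_onD[OF f0_inj _ y(1) v(1)] v(2) by blast
    ultimately have "lo < f0 y'" "f0 y' < hi" using lo_hi(3)[OF y(1)] lo_hi(3)[OF v(1)] by auto
    then have "y' \<in> VH - WH" using ends[of y'] y'(1) by auto
    then have "slot hl 1 j 0 \<in> f ` VH" if "j < m" for j using out hub[OF that] fy' by simp
    then have "(\<lambda>j. slot hl 1 j 0) ` {..<m} \<subseteq> f ` VH" by auto
    then have "card ((\<lambda>j. slot hl 1 j 0) ` {..<m}) \<le> card (f ` VH)" using finite_VH by (intro card_mono) auto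
    also have "\<dots> \<le> card VH" using finite_VH by (rule card_image_le)
    also have "card ((\<lambda>j. slot hl 1 j 0) ` {..<m}) = m"
      by (subst card_image) (auto simp: inj_on_def slot_def)
    finally show False by (simp add: m_def)
  qed
  have "fst p \<subseteq> {..hl}" if p: "p \<in> occs ?B" for p
  proof -
    obtain f where f: "emb ?B f" "p = (f ` VH, f ` WH)" using p by (auto simp: occs_def)
    show ?thesis using within[OF f(1)] f(2) by simp
  qed
  then have "occs ?B = {p \<in> occs ?B. fst p \<subseteq> {..hl}}" by blast
  then have "card (occs ?B) \<le> card {..hl} ^ card VH"
    using card_occs_within[of "{..hl}" ?B] by simp
  moreover have "hl + 1 + m * 1 - card VH \<le> card (occs (seg 0 (hl + 1 + m * 1)))" by (rule path_count_lower)
  moreover have "card {..hl} ^ card VH < hl + 1 + m * 1 - card VH" by (simp add: m_def)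
  ultimately have "card (occs ?B) \<noteq> card (occs (seg 0 (hl + 1 + m * 1)))" by linarith
  then show ?thesis by (rule distinguishedI[OF R zero_less_one m0])
qed

end

theorem gadgets_exist: distinguished
proof (cases "\<exists>f. emb ray f \<and> 0 \<notin> f ` VH")
  case False
  then show ?thesis by (rule distinguished_pendant)
next
  case True
  then obtain f0 where f0: "emb ray f0" "0 \<notin> f0 ` VH" by blast
  show ?thesis
  proof (cases "\<exists>x \<in> WH. lo f0 < f0 x \<and> f0 x < hi f0")
    case True
    then show ?thesis using distinguished_spider[OF f0] by blast
  next
    case False
    have "f0 x = lo f0 \<or> f0 x = hi f0" if "x \<in> WH" for x
      using False that lo_hi(3)[OF f0, of x] WH by force
    then show ?thesis by (rule distinguished_star[OF f0])
  qed
qed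

end

subsection \<open>Uniform trees\<close>

context tree_pattern
begin

abbreviation cnt :: "nat rel \<Rightarrow> real" where "cnt A \<equiv> real (card (occs A))"

lemma cnt_relabel:
  assumes "distinct xs" "length xs = Suc (length us)"
  shows "cnt (relabel xs (code_graph us)) = F us"
proof -
  have "inj_on ((!) xs) {..length us}"
    using assms by (auto simp: inj_on_def nth_eq_iff_index_eq)
  from occs_image(2)[OF this code_graph_subset] show ?thesis by (simp add: relabel_def F_def)
qed

text \<open>\<open>\<psi>\<close> is arbitrary so that the mean, the variance and the distribution
  function of the count are all transferred by one statement.\<close>

lemma mean_trees_eq_mean_codes:
  assumes n: "1 \<le> n"
  shows "mean (trees {1..n}) (\<lambda>A. \<psi> (cnt A)) = mean (words {..<n} (n - 1)) (\<lambda>u. \<psi> (F u))"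
proof -
  define m where "m = n - 1"
  have m: "n = Suc m" using n by (simp add: m_def)
  have c: "card {1..n} = Suc m" using m by simp
  have "real (Suc m) * (\<Sum>A \<in> trees {1..n}. \<psi> (cnt A)) = (\<Sum>us \<in> words {..<Suc m} m. \<psi> (F us))"
  proof (rule sum_trees_eq_sum_codes[OF _ c])
    fix xs us assume h: "distinct xs" "set xs = {1..n}" "us \<in> words {..<Suc m} m"
    have "length xs = Suc (length us)"
      using distinct_card[OF h(1)] h(2) c length_words[OF h(3)] by simp
    then show "\<psi> (cnt (relabel xs (code_graph us))) = \<psi> (F us)" using cnt_relabel[OF h(1)] by simp
  qed simp
  moreover have "real (Suc m) * real (card (trees {1..n})) = real (card (words {..<Suc m} m))"
    using cayley[OF _ c] by (simp add: card_words flip: of_nat_mult of_nat_power of_nat_Suc)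
  moreover have "mean (trees {1..n}) (\<lambda>A. \<psi> (cnt A))
      = (real (Suc m) * (\<Sum>A \<in> trees {1..n}. \<psi> (cnt A))) / (real (Suc m) * real (card (trees {1..n})))"
    unfolding mean_def by simp
  ultimately show ?thesis unfolding mean_def m by simp
qed

lemma variance_trees_eq_variance_codes:
  assumes "1 \<le> n"
  shows "variance_on (trees {1..n}) cnt = variance_on (words {..<n} (n - 1)) F"
  unfolding variance_on_def mean_trees_eq_mean_codes[OF assms, of "\<lambda>x. x"]
  by (rule mean_trees_eq_mean_codes[OF assms, of "\<lambda>x. (x - mean (words {..<n} (n - 1)) F)\<^sup>2"])

text \<open>The threshold \<open>N\<close> comes from the size of the gadgets and does not depend on
  \<epsilon>; positivity of the variance justifies dividing by the standard deviation.\<close>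

lemma tree_rate:
  shows "\<exists>N. \<forall>\<epsilon> > 0. \<exists>C. \<forall>n \<ge> N. 1 \<le> n \<and> 0 < variance_on (trees {1..n}) cnt \<and>
    (\<forall>t. \<bar>mean (trees {1..n}) (\<lambda>A. of_bool ((cnt A - mean (trees {1..n}) cnt) / sqrt (variance_on (trees {1..n}) cnt) \<le> t))
      - cdf std_normal_distribution t\<bar> \<le> C * real n powr (- (1 / 4) + \<epsilon>))"
proof -
  obtain s C C' where g: "hl < s" "is_tree {hl..<s} C" "is_tree {hl..<s} C'"
    "card (occs (handle \<union> C)) \<noteq> card (occs (handle \<union> C'))"
    using gadgets_exist unfolding distinguished_def by blast
  obtain c where c: "c > 0" and low: "\<And>V0 :: nat set. finite V0 \<Longrightarrow> 2 * s < card V0 \<Longrightarrow> variance_on (trees V0) cnt \<ge> c * real (card V0)"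
    using variance_trees_lower[OF g] by blast
  define N where "N = 2 * s + 1"
  have var: "variance_on (words {..<n} (n - 1)) F \<ge> c * real n" if "n \<ge> N" for n
    using low[of "{1..n}"] variance_trees_eq_variance_codes[of n] that by (simp add: N_def)
  show ?thesis
  proof (intro exI[of _ N] allI impI)
    fix \<epsilon> :: real assume "\<epsilon> > 0"
    from kolmogorov_rate[OF c var this] obtain C where C: "\<And>n t. n \<ge> max 1 N \<Longrightarrow>
      \<bar>mean (words {..<n} (n - 1)) (\<lambda>u. of_bool ((F u - mean (words {..<n} (n - 1)) F) / sqrt (variance_on (words {..<n} (n - 1)) F) \<le> t))
      - cdf std_normal_distribution t\<bar> \<le> C * real n powr (- (1 / 4) + \<epsilon>)" by blast
    show "\<exists>C. \<forall>n \<ge> N. 1 \<le> n \<and> 0 < variance_on (trees {1..n}) cnt \<and>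
      (\<forall>t. \<bar>mean (trees {1..n}) (\<lambda>A. of_bool ((cnt A - mean (trees {1..n}) cnt) / sqrt (variance_on (trees {1..n}) cnt) \<le> t))
      - cdf std_normal_distribution t\<bar> \<le> C * real n powr (- (1 / 4) + \<epsilon>))"
    proof (intro exI[of _ C] allI impI conjI)
      fix n :: nat and t :: real assume n: "N \<le> n"
      show n1: "1 \<le> n" using n by (simp add: N_def)
      have "0 < c * real n" using c n1 by simp
      then show "0 < variance_on (trees {1..n}) cnt"
        using var[OF n] unfolding variance_trees_eq_variance_codes[OF n1] by simp
      have "max 1 N \<le> n" using n n1 by simp
      from C[OF this, of t]
      show "\<bar>mean (trees {1..n}) (\<lambda>A. of_bool ((cnt A - mean (trees {1..n}) cnt) / sqrt (variance_on (trees {1..n}) cnt) \<le> t))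
        - cdf std_normal_distribution t\<bar> \<le> C * real n powr (- (1 / 4) + \<epsilon>)"
        unfolding variance_trees_eq_variance_codes[OF n1] mean_trees_eq_mean_codes[OF n1, of "\<lambda>x. x"]
          mean_trees_eq_mean_codes[OF n1, of "\<lambda>x. of_bool ((x - mean (words {..<n} (n - 1)) F) / sqrt (variance_on (words {..<n} (n - 1)) F) \<le> t)"] .
    qed
  qed
qed

end

text \<open>A digraph isomorphism also transports arcs, tails and heads. Equality with the induced
  subgraph forces the tail and head maps to be \<open>fst\<close> and \<open>snd\<close>, so on the
  arcs of \<open>H\<close> the arc map is \<open>map_prod f f\<close> and only the vertex map is
  left to choose.\<close>

lemma pattern_occurrence_iff:
  assumes tp: "tree_pattern (pverts H) (parcs H) {v i | i. i \<in> {1..l} \<and> \<theta> i = 1}"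
    and T: "is_tree (pverts T) (parcs T)"
  shows "pattern_occurrence H l v \<theta> T U W \<longleftrightarrow>
    (U, W) \<in> tree_pattern.occs (pverts H) (parcs H) {v i | i. i \<in> {1..l} \<and> \<theta> i = 1} (parcs T)"
proof -
  let ?W = "{v i | i. i \<in> {1..l} \<and> \<theta> i = 1}"
  interpret tree_pattern "pverts H" "parcs H" ?W by fact
  have Tsub: "parcs T \<subseteq> pverts T \<times> pverts T" by (rule is_tree_subset[OF T])
  have wf: "wf_digraph (with_proj H)"
    unfolding wf_digraph_wp_iff using AH_sub by unfold_locales auto
  show ?thesis
  proof
    assume "pattern_occurrence H l v \<theta> T U W"
    then obtain \<phi> where U: "U \<subseteq> pverts T"
      and iso: "pre_digraph.digraph_isomorphism (with_proj H) \<phi>"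
      and app: "app_iso \<phi> (with_proj H) = with_proj T \<restriction> U"
      and W: "W = iso_verts \<phi> ` ?W"
      and out: "\<forall>x \<in> U - W. \<forall>y \<in> pverts T - U. (x, y) \<notin> parcs T"
      unfolding pattern_occurrence_def by blast
    define f where "f = iso_verts \<phi>"
    have inj: "inj_on f (pverts H)"
      using iso by (simp add: pre_digraph.digraph_isomorphism_def f_def)
    have fU: "f ` pverts H = U" using arg_cong[OF app, of verts] by (simp add: f_def)
    have tl: "iso_tail \<phi> = fst" using arg_cong[OF app, of tail] by (simp add: induce_subgraph_def)
    have hd: "iso_head \<phi> = snd" using arg_cong[OF app, of head] by (simp add: induce_subgraph_def)
    have "iso_arcs \<phi> a = map_prod f f a" if "a \<in> parcs H" for a
      using iso that tl hd by (simp add: pre_digraph.digraph_isomorphism_def f_def prod_eq_iff)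
    then have "iso_arcs \<phi> ` parcs H = map_prod f f ` parcs H" by (rule image_cong[OF refl])
    then have arcs: "map_prod f f ` parcs H = {e \<in> parcs T. fst e \<in> U \<and> snd e \<in> U}"
      using arg_cong[OF app, of arcs] by (simp add: induce_subgraph_def)
    have "emb (parcs T) f"
      unfolding emb_def
    proof (intro conjI ballI allI impI)
      show "inj_on f (pverts H)" by (rule inj)
      fix x y assume xy: "x \<in> pverts H" "y \<in> pverts H"
      show "(x, y) \<in> parcs H \<longleftrightarrow> (f x, f y) \<in> parcs T"
      proof
        assume "(x, y) \<in> parcs H"
        then have "(f x, f y) \<in> map_prod f f ` parcs H" by force
        then show "(f x, f y) \<in> parcs T" unfolding arcs by simp
      next
        assume "(f x, f y) \<in> parcs T"
        then have "(f x, f y) \<in> map_prod f f ` parcs H" unfolding arcs using xy fU by auto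
        then obtain a b where ab: "(a, b) \<in> parcs H" "f x = f a" "f y = f b" by auto
        then have "a \<in> pverts H" "b \<in> pverts H" using AH_sub by auto
        then have "x = a" "y = b" using inj_onD[OF inj] ab(2,3) xy by blast+
        then show "(x, y) \<in> parcs H" using ab(1) by simp
      qed
    next
      fix x z assume x: "x \<in> pverts H - ?W" and z: "(f x, z) \<in> parcs T"
      have "f x \<notin> f ` ?W" using inj_on_image_mem_iff[OF inj, of x ?W] x WH by blast
      then have "f x \<in> U - W" using x fU W by (auto simp: f_def)
      moreover have "z \<in> pverts T" using z Tsub by auto
      ultimately show "z \<in> f ` pverts H" using out z fU by blast
    qed
    from emb_occs[OF this] show "(U, W) \<in> occs (parcs T)" using fU W by (simp add: f_def)
  next
    assume "(U, W) \<in> occs (parcs T)"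
    then obtain f where f: "emb (parcs T) f" "U = f ` pverts H" "W = f ` ?W" unfolding occs_def by blast
    have inj: "inj_on f (pverts H)"
      and arc: "\<And>x y. x \<in> pverts H \<Longrightarrow> y \<in> pverts H \<Longrightarrow> (x, y) \<in> parcs H \<longleftrightarrow> (f x, f y) \<in> parcs T"
      and out: "\<And>x z. x \<in> pverts H - ?W \<Longrightarrow> (f x, z) \<in> parcs T \<Longrightarrow> z \<in> f ` pverts H"
      using f(1) unfolding emb_def by blast+
    define \<phi> where "\<phi> = \<lparr>iso_verts = f, iso_arcs = map_prod f f, iso_head = snd, iso_tail = fst\<rparr>"
    have "U \<subseteq> pverts T"
      using occs_Field[OF \<open>(U, W) \<in> occs (parcs T)\<close>] Tsub by (auto simp: Field_def)
    moreover have "W \<subseteq> U" using f(2,3) WH by auto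
    moreover have "inj_on (map_prod f f) (parcs H)"
      by (rule inj_on_subset[OF map_prod_inj_on[OF inj inj] AH_sub])
    then have "pre_digraph.digraph_isomorphism (with_proj H) \<phi>"
      using wf inj by (simp add: pre_digraph.digraph_isomorphism_def \<phi>_def)
    moreover have "app_iso \<phi> (with_proj H) = with_proj T \<restriction> U"
    proof -
      have "map_prod f f ` parcs H = {e \<in> parcs T. fst e \<in> U \<and> snd e \<in> U}"
      proof (rule set_eqI)
        fix e
        show "e \<in> map_prod f f ` parcs H \<longleftrightarrow> e \<in> {e \<in> parcs T. fst e \<in> U \<and> snd e \<in> U}"
        proof
          assume "e \<in> map_prod f f ` parcs H"
          then obtain a b where ab: "(a, b) \<in> parcs H" "e = (f a, f b)" by auto
          then have "a \<in> pverts H" "b \<in> pverts H" using AH_sub by auto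
          then show "e \<in> {e \<in> parcs T. fst e \<in> U \<and> snd e \<in> U}" using arc ab f(2) by simp
        next
          assume "e \<in> {e \<in> parcs T. fst e \<in> U \<and> snd e \<in> U}"
          then obtain a b where ab: "a \<in> pverts H" "b \<in> pverts H" "e = (f a, f b)" "e \<in> parcs T"
            unfolding f(2) by (cases e) auto
          then have "(a, b) \<in> parcs H" using arc by simp
          then show "e \<in> map_prod f f ` parcs H" using ab(3) by force
        qed
      qed
      then show ?thesis
        by (simp add: app_iso_def induce_subgraph_def \<phi>_def f(2))
    qed
    moreover have "W = iso_verts \<phi> ` ?W" using f(3) by (simp add: \<phi>_def)
    moreover have "\<forall>x \<in> U - W. \<forall>y \<in> pverts T - U. (x, y) \<notin> parcs T"
      using out f(2,3) by blast
    ultimately show "pattern_occurrence H l v \<theta> T U W"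
      unfolding pattern_occurrence_def by blast
  qed
qed

abbreviation on_verts :: "nat \<Rightarrow> nat rel \<Rightarrow> nat pair_pre_digraph" where
  "on_verts n A \<equiv> \<lparr>pverts = {1..n}, parcs = A\<rparr>"

lemma bij_labelled_trees: "bij_betw (on_verts n) (trees {1..n}) (labelled_trees n)"
proof (rule bij_betw_byWitness[where f' = parcs])
  show "on_verts n ` trees {1..n} \<subseteq> labelled_trees n"
    by (auto simp: labelled_trees_def trees_def undirected_tree_iff)
  show "parcs ` labelled_trees n \<subseteq> trees {1..n}"
    by (auto simp: labelled_trees_def trees_def undirected_tree_iff)
  show "\<forall>T \<in> labelled_trees n. on_verts n (parcs T) = T"
    by (auto simp: labelled_trees_def)
qed simp

lemma mean_labelled_trees: "mean (labelled_trees n) f = mean (trees {1..n}) (\<lambda>A. f (on_verts n A))"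
  by (rule mean_bij[OF bij_labelled_trees])

lemma labelled_trees_finite_nonempty:
  assumes "1 \<le> n" shows "finite (labelled_trees n)" "labelled_trees n \<noteq> {}"
proof -
  have fin: "finite (trees {1..n})" by (rule finite_trees) simp
  then show "finite (labelled_trees n)" using bij_betw_finite[OF bij_labelled_trees] by blast
  have "card {1..n} = Suc (n - 1)" using assms by simp
  from cayley[OF _ this] have "card (trees {1..n}) \<noteq> 0" by (metis finite_atLeastAtMost mult_0_right power_eq_0_iff nat.distinct(1))
  then have "trees {1..n} \<noteq> {}" by auto
  then show "labelled_trees n \<noteq> {}" using bij_betw_imp_surj_on[OF bij_labelled_trees] by blast
qed

lemma expectation_uniform_tree:
  assumes "1 \<le> n" shows "measure_pmf.expectation (uniform_tree n) f = mean (labelled_trees n) f"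
  unfolding uniform_tree_def mean_def
  using labelled_trees_finite_nonempty[OF assms] by (simp add: integral_pmf_of_set)

lemma prob_uniform_tree:
  assumes "1 \<le> n"
  shows "measure_pmf.prob (uniform_tree n) {T. P T} = mean (labelled_trees n) (\<lambda>T. of_bool (P T))"
proof -
  note fin = labelled_trees_finite_nonempty[OF assms]
  have "(\<Sum>T \<in> labelled_trees n. of_bool (P T) :: real) = real (card (labelled_trees n \<inter> {T. P T}))"
    using fin by (simp add: of_bool_def sum.If_cases)
  then show ?thesis
    unfolding uniform_tree_def mean_def using fin by (simp add: measure_pmf_of_set)
qed

text \<open>The value at \<open>t = 0\<close> bounds the supremum from below by 0; the hypothesis
  also supplies the boundedness that a supremum of reals requires.\<close>

lemma delta_K_le:
  assumes "\<And>t. \<bar>measure_pmf.prob p {x. X x - measure_pmf.expectation p X \<le> t * sqrt (measure_pmf.variance p X)}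
    - cdf std_normal_distribution t\<bar> \<le> b"
  shows "\<bar>delta_K p X\<bar> \<le> b"
proof -
  let ?g = "\<lambda>t. \<bar>measure_pmf.prob p {x. X x - measure_pmf.expectation p X \<le> t * sqrt (measure_pmf.variance p X)}
    - cdf std_normal_distribution t\<bar>"
  have "delta_K p X \<le> b" unfolding delta_K_def by (rule cSUP_least) (use assms in auto)
  moreover have "?g 0 \<le> delta_K p X" unfolding delta_K_def
    by (rule cSUP_upper) (use assms in \<open>auto intro!: bdd_aboveI2\<close>)
  moreover have "0 \<le> ?g 0" by simp
  ultimately show ?thesis by linarith
qed

text \<open>\<open>nondegenerate\<close> excludes the single vertex and the edge with both ends
  marked. They count the n vertices and the n - 1 edges, so the variance is 0 and
  \<open>delta_K\<close> equals 1 for every positive n.\<close>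

theorem theorem2p8:
  fixes H :: "'a pair_pre_digraph"
    and l :: nat
    and v :: "nat \<Rightarrow> 'a"
    and \<theta> :: "nat \<Rightarrow> nat"
  assumes tree_H: "undirected_tree H"
    and vertices_H: "bij_betw v {1..l} (pverts H)"
    and theta_01: "\<forall>i \<in> {1..l}. \<theta> i \<in> {0, 1}"
    and theta_nonzero: "\<exists>i \<in> {1..l}. \<theta> i \<noteq> 0"
    and nondegenerate: "\<not> (l \<le> 2 \<and> (\<forall>i \<in> {1..l}. \<theta> i = 1))"
  shows "asymptotically_normal uniform_tree (\<lambda>n T. real (pattern_count H l v \<theta> T)) \<and>
         (\<forall>\<epsilon>::real. \<epsilon> > 0 \<longrightarrow>
            (\<lambda>n. delta_K (uniform_tree n) (\<lambda>T. real (pattern_count H l v \<theta> T)))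
              \<in> O(\<lambda>n. real n powr (- (1 / 4) + \<epsilon>)))"
proof -
  let ?W = "{v i | i. i \<in> {1..l} \<and> \<theta> i = 1}"
  have vim: "v ` {1..l} = pverts H" and vinj: "inj_on v {1..l}"
    using vertices_H by (auto simp: bij_betw_def)
  have tp: "tree_pattern (pverts H) (parcs H) ?W"
  proof
    show "is_tree (pverts H) (parcs H)" using tree_H by (simp add: undirected_tree_iff)
    show "?W \<subseteq> pverts H" using vim by auto
    show "?W \<noteq> {}" using theta_01 theta_nonzero by fastforce
    show "\<not> (card (pverts H) \<le> 2 \<and> ?W = pverts H)"
    proof
      assume h: "card (pverts H) \<le> 2 \<and> ?W = pverts H"
      have "l \<le> 2" using h bij_betw_same_card[OF vertices_H] by simp
      moreover have "\<theta> i = 1" if i: "i \<in> {1..l}" for i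
      proof -
        have "v i \<in> ?W" using h vim i by blast
        then obtain j where j: "v i = v j" "j \<in> {1..l}" "\<theta> j = 1" by blast
        have "i = j" by (rule inj_onD[OF vinj j(1) i j(2)])
        then show ?thesis using j(3) by simp
      qed
      ultimately show False using nondegenerate by blast
    qed
  qed
  then interpret tree_pattern "pverts H" "parcs H" ?W .
  define X where "X = (\<lambda>T :: nat pair_pre_digraph. real (pattern_count H l v \<theta> T))"
  have X: "X (on_verts n A) = cnt A" if "A \<in> trees {1..n}" for n A
  proof -
    have "is_tree (pverts (on_verts n A)) (parcs (on_verts n A))" using that by (simp add: trees_def)
    from pattern_occurrence_iff[OF tp this]
    have "{(U, W). pattern_occurrence H l v \<theta> (on_verts n A) U W} = occs A" by auto
    then show ?thesis by (simp add: X_def pattern_count_def)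
  qed
  obtain N where N: "\<And>\<epsilon>. \<epsilon> > 0 \<Longrightarrow> \<exists>C. \<forall>n \<ge> N. 1 \<le> n \<and> 0 < variance_on (trees {1..n}) cnt \<and>
    (\<forall>t. \<bar>mean (trees {1..n}) (\<lambda>A. of_bool ((cnt A - mean (trees {1..n}) cnt) / sqrt (variance_on (trees {1..n}) cnt) \<le> t))
      - cdf std_normal_distribution t\<bar> \<le> C * real n powr (- (1 / 4) + \<epsilon>))"
    using tree_rate by blast
  have rate: "\<exists>C. \<forall>n \<ge> N. \<bar>delta_K (uniform_tree n) X\<bar> \<le> C * real n powr (- (1 / 4) + \<epsilon>)" if "\<epsilon> > 0" for \<epsilon>
  proof -
    from N[OF that] obtain C where C: "\<And>n. n \<ge> N \<Longrightarrow> 1 \<le> n" "\<And>n. n \<ge> N \<Longrightarrow> 0 < variance_on (trees {1..n}) cnt"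
      "\<And>n t. n \<ge> N \<Longrightarrow> \<bar>mean (trees {1..n}) (\<lambda>A. of_bool ((cnt A - mean (trees {1..n}) cnt) / sqrt (variance_on (trees {1..n}) cnt) \<le> t))
      - cdf std_normal_distribution t\<bar> \<le> C * real n powr (- (1 / 4) + \<epsilon>)" by blast
    have "\<bar>delta_K (uniform_tree n) X\<bar> \<le> C * real n powr (- (1 / 4) + \<epsilon>)" if n: "n \<ge> N" for n
    proof (rule delta_K_le)
      fix t :: real
      let ?\<mu> = "mean (trees {1..n}) cnt" and ?V = "variance_on (trees {1..n}) cnt"
      have E: "measure_pmf.expectation (uniform_tree n) X = ?\<mu>"
        unfolding expectation_uniform_tree[OF C(1)[OF n]] mean_labelled_trees by (rule mean_cong) (rule X)
      have V: "measure_pmf.variance (uniform_tree n) X = ?V"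
        unfolding E unfolding expectation_uniform_tree[OF C(1)[OF n]] mean_labelled_trees variance_on_def
        by (rule mean_cong) (simp only: X)
      have sd: "0 < sqrt ?V" using C(2)[OF n] by simp
      have "measure_pmf.prob (uniform_tree n) {T. X T - ?\<mu> \<le> t * sqrt ?V}
          = mean (trees {1..n}) (\<lambda>A. of_bool ((cnt A - ?\<mu>) / sqrt ?V \<le> t))"
        unfolding prob_uniform_tree[OF C(1)[OF n]] mean_labelled_trees
        by (rule mean_cong) (simp only: X pos_divide_le_eq[OF sd])
      then show "\<bar>measure_pmf.prob (uniform_tree n)
          {x. X x - measure_pmf.expectation (uniform_tree n) X \<le> t * sqrt (measure_pmf.variance (uniform_tree n) X)}
        - cdf std_normal_distribution t\<bar> \<le> C * real n powr (- (1 / 4) + \<epsilon>)"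
        unfolding V unfolding E using C(3)[OF n, of t] by (simp only:)
    qed
    then show ?thesis by blast
  qed
  have "asymptotically_normal uniform_tree (\<lambda>n. X)"
  proof -
    \<comment> \<open>Any \<epsilon> below 1/4 gives convergence to 0.\<close>
    obtain C where C: "\<And>n. n \<ge> N \<Longrightarrow> \<bar>delta_K (uniform_tree n) X\<bar> \<le> C * real n powr (- (1 / 4) + 1 / 8)"
      using rate[of "1/8"] by auto
    have "(\<lambda>n. delta_K (uniform_tree n) X) \<longlonglongrightarrow> 0"
    proof (rule Lim_null_comparison)
      show "\<forall>\<^sub>F n in sequentially. norm (delta_K (uniform_tree n) X) \<le> C * real n powr (- (1 / 4) + 1 / 8)"
        unfolding eventually_sequentially real_norm_def using C by blast
      show "(\<lambda>n. C * real n powr (- (1 / 4) + 1 / 8)) \<longlonglongrightarrow> 0" by real_asymp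
    qed
    then show ?thesis unfolding asymptotically_normal_def .
  qed
  moreover have "(\<lambda>n. delta_K (uniform_tree n) X) \<in> O(\<lambda>n. real n powr (- (1 / 4) + \<epsilon>))" if eps: "\<epsilon> > 0" for \<epsilon> :: real
  proof -
    obtain C where C: "\<And>n. n \<ge> N \<Longrightarrow> \<bar>delta_K (uniform_tree n) X\<bar> \<le> C * real n powr (- (1 / 4) + \<epsilon>)"
      using rate[OF eps] by blast
    show ?thesis
      by (rule bigoI[of _ C]) (use C in \<open>auto simp: eventually_sequentially\<close>)
  qed
  ultimately show ?thesis unfolding X_def by blast
qed

end
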